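(* Let $k,N\ge1$, let $\chi$ be a Dirichlet character of conductor $m$ dividing $N$ (viewed as a primitive character modulo $m$), let $f\in M_k(\Gamma_0(N),\chi)$ with $K_f$ the field generated by its Fourier coefficients, and let $g=\begin{pmatrix}A&B\\C&D\end{pmatrix}\in\mathrm{SL}_2(\mathbb{Z})$. Put $N'=N/\gcd(CD,N)$, $m'=m/\gcd(BC,m)$, $M=\mathrm{lcm}(N',m')$, $K=K_f(\zeta_{N'})$, $L=K_f(\zeta_M)$, $G=\mathrm{Gal}(L/K)$, let $\lambda:G\to(\mathbb{Z}/m'\mathbb{Z})^\times$ be the cyclotomic character ($\sigma(\zeta_{m'})=\zeta_{m'}^{\lambda(\sigma)}$), and let $\chi_g:G\to\mathbb{C}^\times$ be the homomorphism $\chi_g(\sigma)=\chi(AD-\lambda(\sigma)^{-1}BC)$ (the argument being a well-defined unit modulo $m$). Then all Fourier coefficients of $f|_k g$ lie in \[ L^{\chi_g}=\{x\in L:\ \sigma(x)=\chi_g(\sigma)x\ \text{for all }\sigma\in G\}. \]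
   Context: $\zeta_n=e^{2\pi i/n}$. $M_k(\Gamma_0(N),\chi)$ is the space of holomorphic modular forms $f$ of weight $k$ with $f|_k\gamma=\chi(d)f$ for all $\gamma=\begin{pmatrix}a&b\\c&d\end{pmatrix}\in\Gamma_0(N)$, where $(f|_k\gamma)(\tau)=(c\tau+d)^{-k}f\bigl(\frac{a\tau+b}{c\tau+d}\bigr)$. The form $f|_kg$ is modular on $\Gamma(N)$ with Fourier expansion in powers of $e^{2\pi i\tau/N}$; its Fourier coefficients are the coefficients of this expansion. *)

theory Defs
  imports
    "HOL-Complex_Analysis.Complex_Analysis"
    "HOL-Algebra.Algebraic_Closure_Type"
    "HOL-Algebra.Generated_Fields"
    "HOL-Algebra.Bij"
    "HOL-Number_Theory.Modular_Inverse"
begin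

section \<open>Dirichlet characters\<close>

text \<open>Characters modulo \<open>m\<close> are represented as functions on the integers, extended by zero to the
  integers that are not coprime to \<open>m\<close>.\<close>

definition dirichlet_character :: "nat \<Rightarrow> (int \<Rightarrow> complex) \<Rightarrow> bool" where
  "dirichlet_character m chi \<longleftrightarrow>
     (\<forall>a b. chi (a * b) = chi a * chi b) \<and>
     (\<forall>a b. [a = b] (mod int m) \<longrightarrow> chi a = chi b) \<and>
     (\<forall>a. chi a \<noteq> 0 \<longleftrightarrow> coprime a (int m))"

definition character_conductor :: "nat \<Rightarrow> (int \<Rightarrow> complex) \<Rightarrow> nat" where
  "character_conductor m chi =
     (LEAST d. 0 < d \<and> d dvd m \<and>
        (\<forall>a. coprime a (int m) \<and> [a = 1] (mod int d) \<longrightarrow> chi a = 1))"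

definition primitive_character :: "nat \<Rightarrow> (int \<Rightarrow> complex) \<Rightarrow> bool" where
  "primitive_character m chi \<longleftrightarrow>
     0 < m \<and> dirichlet_character m chi \<and> character_conductor m chi = m"

section \<open>Modular forms\<close>

definition SL2Z :: "(int ^ 2 ^ 2) set" where
  "SL2Z = {g. det g = 1}"

definition Gamma0 :: "nat \<Rightarrow> (int ^ 2 ^ 2) set" where
  "Gamma0 N = {g \<in> SL2Z. int N dvd g $ 2 $ 1}"

definition upper_half_plane :: "complex set" where
  "upper_half_plane = {\<tau>. Im \<tau> > 0}"

definition slash :: "nat \<Rightarrow> (complex \<Rightarrow> complex) \<Rightarrow> int ^ 2 ^ 2 \<Rightarrow> complex \<Rightarrow> complex" where
  "slash k f g \<tau> =
     (of_int (g $ 2 $ 1) * \<tau> + of_int (g $ 2 $ 2)) powi (- int k) *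
     f ((of_int (g $ 1 $ 1) * \<tau> + of_int (g $ 1 $ 2)) /
        (of_int (g $ 2 $ 1) * \<tau> + of_int (g $ 2 $ 2)))"

definition has_fourier_expansion :: "nat \<Rightarrow> (complex \<Rightarrow> complex) \<Rightarrow> (nat \<Rightarrow> complex) \<Rightarrow> bool" where
  "has_fourier_expansion h F a \<longleftrightarrow>
     (\<forall>\<tau>\<in>upper_half_plane.
        (\<lambda>n. a n * exp (2 * of_real pi * \<i> * of_nat n * \<tau> / of_nat h)) sums F \<tau>)"

definition fourier_coeff :: "nat \<Rightarrow> (complex \<Rightarrow> complex) \<Rightarrow> nat \<Rightarrow> complex" where
  "fourier_coeff h F = (THE a. has_fourier_expansion h F a)"

text \<open>The last clause is holomorphy at the cusps: if the character has modulus dividing \<open>N\<close>, each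
  \<open>slash k f g\<close> is modular on \<open>\<Gamma>(N)\<close>, hence \<open>N\<close>-periodic, and its expansion in powers of
  \<open>exp (2 \<pi> \<i> \<tau> / N)\<close> is required to involve non-negative exponents only.\<close>

definition modular_forms :: "nat \<Rightarrow> nat \<Rightarrow> (int \<Rightarrow> complex) \<Rightarrow> (complex \<Rightarrow> complex) set" where
  "modular_forms k N chi =
     {f. f holomorphic_on upper_half_plane \<and>
         (\<forall>g\<in>Gamma0 N. \<forall>\<tau>\<in>upper_half_plane. slash k f g \<tau> = chi (g $ 2 $ 2) * f \<tau>) \<and>
         (\<forall>g\<in>SL2Z. \<exists>a. has_fourier_expansion N (slash k f g) a)}"

section \<open>Subfields of the complex numbers and Galois groups\<close>

abbreviation complex_field :: "complex ring" where
  "complex_field \<equiv> ring_of_type_algebra"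

definition zeta :: "nat \<Rightarrow> complex" where
  "zeta n = exp (2 * of_real pi * \<i> / of_nat n)"

definition coeff_field :: "(complex \<Rightarrow> complex) \<Rightarrow> complex set" where
  "coeff_field f = generate_field complex_field (range (fourier_coeff 1 f))"

definition adjoin :: "complex set \<Rightarrow> complex \<Rightarrow> complex set" where
  "adjoin F x = generate_field complex_field (insert x F)"

definition galois_group :: "complex set \<Rightarrow> complex set \<Rightarrow> (complex \<Rightarrow> complex) set" where
  "galois_group L K =
     {\<sigma> \<in> Bij L. \<sigma> \<in> ring_hom (complex_field\<lparr>carrier := L\<rparr>) (complex_field\<lparr>carrier := L\<rparr>) \<and>
                 (\<forall>x\<in>K. \<sigma> x = x)}"

text \<open>The value in \<open>(\<int>/n\<int>)\<^sup>\<times>\<close> is given by its representative in \<open>{0..<n}\<close>.\<close>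

definition cyclotomic_character :: "nat \<Rightarrow> (complex \<Rightarrow> complex) \<Rightarrow> int" where
  "cyclotomic_character n \<sigma> =
     (THE l. l \<in> {0..<int n} \<and> coprime l (int n) \<and> \<sigma> (zeta n) = zeta n powi l)"

definition eigen_subset ::
  "complex set \<Rightarrow> (complex \<Rightarrow> complex) set \<Rightarrow> ((complex \<Rightarrow> complex) \<Rightarrow> complex) \<Rightarrow> complex set" where
  "eigen_subset L G \<psi> = {x \<in> L. \<forall>\<sigma>\<in>G. \<sigma> x = \<psi> \<sigma> * x}"

section \<open>Well-definedness\<close>

lemma has_fourier_expansion_unique:
  assumes h: "h > 0" and a: "has_fourier_expansion h F a" and b: "has_fourier_expansion h F b"
  shows "a = b"
proof -
  have s: "(\<lambda>n. a n * q ^ n) sums F (of_nat h * Ln q / (2 * of_real pi * \<i>))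
         \<and> (\<lambda>n. b n * q ^ n) sums F (of_nat h * Ln q / (2 * of_real pi * \<i>))"
    if q: "q \<noteq> 0" "norm q < 1" for q
  proof -
    define \<tau> where "\<tau> = of_nat h * Ln q / (2 * of_real pi * \<i>)"
    have t: "\<tau> = \<i> * (- (of_real (real h / (2 * pi)) * Ln q))"
      by (simp add: \<tau>_def field_simps)
    have "Im \<tau> = - (real h / (2 * pi) * ln (norm q))"
      using q by (simp only: t Im_i_times) simp
    moreover have "ln (norm q) < 0" using q by simp
    ultimately have "Im \<tau> > 0" using h by (simp add: mult_less_0_iff divide_less_0_iff)
    hence *: "\<tau> \<in> upper_half_plane" by (simp add: upper_half_plane_def)
    have "exp (2 * of_real pi * \<i> * of_nat n * \<tau> / of_nat h) = q ^ n" for n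
    proof -
      have "2 * of_real pi * \<i> * of_nat n * \<tau> / of_nat h = of_nat n * Ln q"
        using h by (simp add: \<tau>_def field_simps)
      thus ?thesis using q by (simp add: exp_of_nat_mult)
    qed
    moreover have "(\<lambda>n. e n * exp (2 * of_real pi * \<i> * of_nat n * \<tau> / of_nat h)) sums F \<tau>"
      if "has_fourier_expansion h F e" for e
      using that * unfolding has_fourier_expansion_def by blast
    ultimately show ?thesis using a b unfolding \<tau>_def[symmetric] by simp
  qed
  define c where "c n = a n - b n" for n
  have c: "(\<lambda>n. c n * q ^ n) sums 0" if "q \<noteq> 0" "norm q < 1" for q
    using sums_diff[OF conjunct1[OF s[OF that]] conjunct2[OF s[OF that]]]
    by (simp add: c_def algebra_simps)
  define d where "d n = (case n of 0 \<Rightarrow> 0 | Suc n \<Rightarrow> c n)" for n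
  have d: "(\<lambda>n. d n * (q - 0) ^ n) sums 0" if "norm (q - 0) < 1" for q
  proof (cases "q = 0")
    case True
    thus ?thesis using powser_sums_zero[of d] by (simp add: d_def)
  next
    case False
    with that have "(\<lambda>n. q * (c n * q ^ n)) sums (q * 0)" by (intro sums_mult c) auto
    hence "(\<lambda>n. d (Suc n) * q ^ Suc n) sums 0" by (simp add: d_def mult_ac)
    thus ?thesis by (subst (asm) sums_Suc_iff) (simp add: d_def)
  qed
  have "c n = 0" for n
  proof (rule ccontr)
    assume "c n \<noteq> 0"
    hence "d (Suc n) \<noteq> 0" by (simp add: d_def)
    then obtain r :: real where r: "r > 0" "\<And>z :: complex. z \<in> cball 0 r - {0} \<Longrightarrow> (0 :: complex) \<noteq> 0"
      using powser_0_nonzero[of 1 0 d "\<lambda>_. 0" "Suc n"] d by auto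
    thus False using r(2)[of "of_real r"] by auto
  qed
  thus ?thesis by (auto simp: c_def)
qed

lemma fourier_coeff_eqI:
  assumes "h > 0" "has_fourier_expansion h F a"
  shows "fourier_coeff h F = a"
  unfolding fourier_coeff_def
  using assms has_fourier_expansion_unique by (intro the_equality) auto

lemma zeta_powi_eq_iff:
  assumes "n > 0"
  shows "zeta n powi i = zeta n powi j \<longleftrightarrow> [i = j] (mod int n)"
proof -
  have *: "zeta n powi i = exp (2 * of_real pi * \<i> * of_int i / of_nat n)" for i
    by (simp add: zeta_def exp_power_int mult_ac)
  show ?thesis
  proof
    assume "zeta n powi i = zeta n powi j"
    then obtain k :: int where "2 * of_real pi * \<i> * of_int i / of_nat n
        = 2 * of_real pi * \<i> * of_int j / of_nat n + (of_int (2 * k) * pi) * \<i>"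
      unfolding * exp_eq by blast
    hence "(2 * of_real pi * \<i>) * of_int i = (2 * of_real pi * \<i>) * of_int (j + k * int n)"
      using assms by (simp add: field_simps)
    hence "(of_int i :: complex) = of_int (j + k * int n)"
      by (subst (asm) mult_cancel_left) simp
    hence "i = j + k * int n" by (simp only: of_int_eq_iff)
    thus "[i = j] (mod int n)" by (simp add: cong_def)
  next
    assume "[i = j] (mod int n)"
    then obtain k where "i = j + int n * k" by (metis cong_iff_lin cong_sym)
    thus "zeta n powi i = zeta n powi j"
      unfolding * exp_eq using assms by (intro exI[of _ k]) (simp add: field_simps)
  qed
qed

lemma cyclotomic_character_ex1:
  assumes L: "subfield L complex_field" and n: "n > 0" "zeta n \<in> L"
    and s: "\<sigma> \<in> galois_group L K"
  shows "\<exists>!l. l \<in> {0..<int n} \<and> coprime l (int n) \<and> \<sigma> (zeta n) = zeta n powi l"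
proof -
  interpret L: subring L complex_field using L by (rule subfieldE)
  have one: "1 \<in> L" using L.one_closed by (simp add: ring_of_type_algebra_def)
  have mult: "x * y \<in> L" if "x \<in> L" "y \<in> L" for x y
    using L.m_closed[OF that] by (simp add: ring_of_type_algebra_def)
  have s1: "\<sigma> 1 = 1" and sm: "\<And>x y. x \<in> L \<Longrightarrow> y \<in> L \<Longrightarrow> \<sigma> (x * y) = \<sigma> x * \<sigma> y"
    and inj: "inj_on \<sigma> L"
    using s by (auto simp: galois_group_def ring_hom_def ring_of_type_algebra_def Bij_def bij_betw_def)
  have pow: "x ^ i \<in> L \<and> \<sigma> (x ^ i) = \<sigma> x ^ i" if "x \<in> L" for x i
    by (induction i) (use that one s1 mult sm in auto)
  define z where "z = \<sigma> (zeta n)"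
  have zn: "zeta n ^ n = 1"
    using zeta_powi_eq_iff[OF n(1), of "int n" 0] by (simp add: cong_def)
  have "z ^ n = 1" using pow[OF n(2), of n] s1 zn by (simp add: z_def)
  then obtain j where j: "j < n" "z = exp (2 * of_real pi * \<i> * of_nat j / of_nat n)"
    using complex_roots_unity[of n] n(1) by auto
  hence z: "z = zeta n powi int j"
    by (simp add: zeta_def field_simps flip: exp_of_nat_mult)
  have "coprime (int j) (int n)"
  proof -
    define d where "d = gcd j n"
    have d: "d > 0" "d dvd j" "d dvd n" using n by (auto simp: d_def)
    then obtain u v where uv: "j = d * u" "n = d * v" by (meson dvdE)
    have "z ^ v = zeta n powi int (j * v)" unfolding z power_int_power' by simp
    also have "\<dots> = 1" using zeta_powi_eq_iff[OF n(1), of "int (j * v)" 0]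
      by (simp add: uv cong_def)
    finally have "\<sigma> (zeta n ^ v) = \<sigma> 1" using pow[OF n(2), of v] s1 by (simp add: z_def)
    hence "zeta n ^ v = 1" using inj pow[OF n(2), of v] one by (auto dest: inj_onD)
    hence "int n dvd int v" using zeta_powi_eq_iff[OF n(1), of "int v" 0]
      by (simp add: cong_0_iff)
    hence "d = 1" using uv n(1) by (metis int_dvd_int_iff dvd_antisym dvd_triv_right mult_eq_self_implies_10 mult.commute neq0_conv)
    thus ?thesis by (simp add: d_def coprime_iff_gcd_eq_1)
  qed
  show ?thesis
  proof (rule ex1I[of _ "int j"])
    show "int j \<in> {0..<int n} \<and> coprime (int j) (int n) \<and> \<sigma> (zeta n) = zeta n powi int j"
      using j(1) z \<open>coprime (int j) (int n)\<close> by (simp add: z_def)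
  next
    fix l assume l: "l \<in> {0..<int n} \<and> coprime l (int n) \<and> \<sigma> (zeta n) = zeta n powi l"
    hence "zeta n powi l = zeta n powi int j" using z by (simp add: z_def)
    hence "[l = int j] (mod int n)" using zeta_powi_eq_iff[OF n(1)] by blast
    thus "l = int j" using l j(1) by (simp add: cong_def)
  qed
qed

text \<open>With \<open>m' = m / gcd(b, m)\<close>, the residue of \<open>a - u * b\<close> modulo \<open>m\<close> only depends on
  \<open>u\<close> modulo \<open>m'\<close>.\<close>

lemma twist_argument_cong:
  fixes a b u v :: int and m :: nat
  assumes "m > 0" and "[u = v] (mod int (m div nat (gcd b (int m))))"
  shows "[a - u * b = a - v * b] (mod int m)"
proof -
  define d where "d = gcd b (int m)"
  have d: "d > 0" "d dvd int m" "d dvd b" using assms(1) by (auto simp: d_def)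
  have "int (m div nat d) = int m div d" using d by (simp add: zdiv_int)
  with assms(2) have "int m div d dvd u - v" by (simp add: d_def cong_iff_dvd_diff)
  hence "(int m div d) * d dvd (u - v) * b" using d by (intro mult_dvd_mono)
  hence "int m dvd (u - v) * b" using d by simp
  hence "int m dvd (a - v * b) - (a - u * b)" by (simp add: algebra_simps)
  thus ?thesis by (metis cong_iff_dvd_diff cong_sym)
qed

end

theory Submission
  imports Defs
begin

text \<open>
  Let \<open>Q = 3 * N\<close> and let \<open>s\<close> be an embedding into \<open>\<complex>\<close> of a field containing \<open>\<zeta>\<^sub>Q\<close> and the Fourier
  coefficients of \<open>f\<close>, with \<open>s\<close> fixing the latter and \<open>s \<zeta>\<^sub>Q = \<zeta>\<^sub>Q ^ l\<close>. The heart of the matter is that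
  \<open>s\<close> maps the expansion of \<open>f | g\<close> to that of \<open>f | h\<close> whenever \<open>h\<close> is congruent modulo \<open>Q\<close> to the
  conjugate of \<open>g\<close> by \<open>diag(1, l)\<close>.

  For Eisenstein series of level \<open>Q\<close> and weight 3 this is visible on their explicit Fourier
  expansions, and it carries over to the ring generated by them and by two Eisenstein series of
  level one. Hence it holds for \<open>f\<close> as soon as \<open>A * f = B\<close> for some \<open>A \<noteq> 0\<close> and \<open>B\<close> in this ring.
  Such a relation comes from Lagrange interpolation, which expresses \<open>f\<close> through traces of level one,
  and from a Pade argument that writes a form of level one as a quotient of polynomials in the
  Eisenstein series; the only analytic input is that a form of level one and weight \<open>W\<close> vanishes if
  its first \<open>W / 8\<close> coefficients do.

  The theorem follows from \<open>f | h = \<chi>(A * D - l\<inverse> * B * C) f | g\<close> for \<open>l \<equiv> 1\<close> modulo \<open>N'\<close>, and from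
  the extension of automorphisms of \<open>L\<close> to embeddings of \<open>L(\<zeta>\<^sub>Q)\<close>.
\<close>

text \<open>Working with a quotient \<open>B / A\<close> instead of a basis of a space of forms pays
  off because \<open>s\<close> can be pushed through \<open>A * f = B\<close> and nonzero power
  series can be cancelled. The price is that \<open>A\<close> and \<open>B\<close> first arise with
  complex coefficients, on which \<open>s\<close> is not defined; linear algebra over the
  coefficient field repairs this. The factor 3 in \<open>Q\<close> separates cosets: for
  \<open>Q \<le> 2\<close> the rows \<open>(0, 1)\<close> and \<open>(0, -1)\<close> agree and
  Eisenstein series of odd weight are zero, while for \<open>Q \<ge> 3\<close> the constant terms in
  weight 3 already tell \<open>(0, 1)\<close> from every other row. Weight 3 is the least one in
  which the lattice sums converge absolutely. The 8 in \<open>W / 8\<close> (the sharp value is 12)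
  is what an elementary estimate with \<open>3 < pi\<close> yields, and it just suffices for the
  Pade count. The coefficients of \<open>f | g\<close> are first placed in
  \<open>E = L(zeta Q)\<close>. That they lie in \<open>L\<close> is itself deduced from the action,
  applied to the embeddings of \<open>E\<close> that fix \<open>L\<close>.\<close>

no_notation fps_nth (infixl "$" 75)

section \<open>The action of the modular group\<close>

lemma SL2Z_iff: "g \<in> SL2Z \<longleftrightarrow> g $ 1 $ 1 * g $ 2 $ 2 - g $ 1 $ 2 * g $ 2 $ 1 = 1"
  by (simp add: SL2Z_def det_2)

definition mat22 :: "int \<Rightarrow> int \<Rightarrow> int \<Rightarrow> int \<Rightarrow> int ^ 2 ^ 2" where
  "mat22 a b c d = vector [vector [a, b], vector [c, d]]"

lemma mat22_nth [simp]:
  "mat22 a b c d $ 1 $ 1 = a" "mat22 a b c d $ 1 $ 2 = b"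
  "mat22 a b c d $ 2 $ 1 = c" "mat22 a b c d $ 2 $ 2 = d"
  by (simp_all add: mat22_def)

lemma mat22_SL2Z_iff: "mat22 a b c d \<in> SL2Z \<longleftrightarrow> a * d - b * c = 1"
  by (simp add: SL2Z_iff)

lemma matrix_mult_nth2:
  fixes g h :: "int ^ 2 ^ 2"
  shows "(g ** h) $ i $ j = g $ i $ 1 * h $ 1 $ j + g $ i $ 2 * h $ 2 $ j"
  by (simp add: matrix_matrix_mult_def sum_2)

lemma SL2Z_mult: "g \<in> SL2Z \<Longrightarrow> h \<in> SL2Z \<Longrightarrow> g ** h \<in> SL2Z"
  by (simp add: SL2Z_def det_mul)

lemma SL2Z_one: "mat 1 \<in> SL2Z"
  by (simp add: SL2Z_def)

definition jac :: "int ^ 2 ^ 2 \<Rightarrow> complex \<Rightarrow> complex" where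
  "jac g \<tau> = of_int (g $ 2 $ 1) * \<tau> + of_int (g $ 2 $ 2)"

definition mob :: "int ^ 2 ^ 2 \<Rightarrow> complex \<Rightarrow> complex" where
  "mob g \<tau> = (of_int (g $ 1 $ 1) * \<tau> + of_int (g $ 1 $ 2)) / jac g \<tau>"

lemma slash_eq: "slash k f g \<tau> = inverse (jac g \<tau> ^ k) * f (mob g \<tau>)"
  by (simp add: slash_def jac_def mob_def power_int_minus)

lemma linear_form_nonzero:
  assumes "Im \<tau> > 0" "(c, d) \<noteq> (0, 0)"
  shows "of_int c * \<tau> + of_int d \<noteq> 0"
proof
  assume *: "of_int c * \<tau> + of_int d = 0"
  hence "Im (of_int c * \<tau> + of_int d) = 0" by simp
  hence "c = 0" using assms(1) by simp
  with * assms(2) show False by simp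
qed

lemma jac_nonzero:
  assumes "g \<in> SL2Z" "\<tau> \<in> upper_half_plane"
  shows "jac g \<tau> \<noteq> 0"
  unfolding jac_def
  by (rule linear_form_nonzero) (use assms in \<open>auto simp: SL2Z_iff upper_half_plane_def\<close>)

lemma Im_mob:
  assumes "g \<in> SL2Z" "\<tau> \<in> upper_half_plane"
  shows "Im (mob g \<tau>) = Im \<tau> / norm (jac g \<tau>) ^ 2"
proof -
  define a b c d where "a = g $ 1 $ 1" "b = g $ 1 $ 2" "c = g $ 2 $ 1" "d = g $ 2 $ 2"
  have det: "real_of_int a * of_int d - of_int b * of_int c = 1"
    using assms(1) by (simp add: SL2Z_iff a_b_c_d_def flip: of_int_mult of_int_diff)
  have "Im (mob g \<tau>) = Im ((of_int a * \<tau> + of_int b) * cnj (jac g \<tau>)) / norm (jac g \<tau>) ^ 2"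
    unfolding mob_def a_b_c_d_def[symmetric] by (subst complex_div_cnj) (simp flip: of_real_power)
  also have "Im ((of_int a * \<tau> + of_int b) * cnj (jac g \<tau>)) =
      (real_of_int a * of_int d - of_int b * of_int c) * Im \<tau>"
    by (simp add: jac_def algebra_simps flip: a_b_c_d_def)
  finally show ?thesis by (simp add: det)
qed

lemma mob_upper:
  assumes "g \<in> SL2Z" "\<tau> \<in> upper_half_plane"
  shows "mob g \<tau> \<in> upper_half_plane"
  using assms Im_mob[OF assms] jac_nonzero[OF assms] by (simp add: upper_half_plane_def)

lemma jac_mult:
  assumes "h \<in> SL2Z" "\<tau> \<in> upper_half_plane"
  shows "jac (g ** h) \<tau> = jac g (mob h \<tau>) * jac h \<tau>"
proof -
  have u: "jac h \<tau> \<noteq> 0" using jac_nonzero assms by blast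
  have m: "mob h \<tau> * jac h \<tau> = of_int (h $ 1 $ 1) * \<tau> + of_int (h $ 1 $ 2)"
    using u by (simp add: mob_def)
  have "jac (g ** h) \<tau> = of_int (g $ 2 $ 1) * (of_int (h $ 1 $ 1) * \<tau> + of_int (h $ 1 $ 2)) 
      + of_int (g $ 2 $ 2) * jac h \<tau>"
    by (simp add: matrix_mult_nth2 jac_def algebra_simps)
  also have "\<dots> = jac g (mob h \<tau>) * jac h \<tau>"
    by (simp only: m[symmetric] jac_def[of g] ring_distribs mult.assoc)
  finally show ?thesis .
qed

lemma mob_mult:
  assumes "g \<in> SL2Z" "h \<in> SL2Z" "\<tau> \<in> upper_half_plane"
  shows "mob (g ** h) \<tau> = mob g (mob h \<tau>)"
proof -
  have u: "jac h \<tau> \<noteq> 0" using jac_nonzero assms by blast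
  have m: "mob h \<tau> * jac h \<tau> = of_int (h $ 1 $ 1) * \<tau> + of_int (h $ 1 $ 2)"
    using u by (simp add: mob_def)
  have "of_int ((g ** h) $ 1 $ 1) * \<tau> + of_int ((g ** h) $ 1 $ 2)
      = of_int (g $ 1 $ 1) * (of_int (h $ 1 $ 1) * \<tau> + of_int (h $ 1 $ 2)) + of_int (g $ 1 $ 2) * jac h \<tau>"
    by (simp add: matrix_mult_nth2 jac_def algebra_simps)
  also have "\<dots> = (of_int (g $ 1 $ 1) * mob h \<tau> + of_int (g $ 1 $ 2)) * jac h \<tau>"
    by (simp only: m[symmetric] ring_distribs mult.assoc)
  finally show ?thesis unfolding mob_def[of "g ** h"] mob_def[of g] jac_mult[OF assms(2,3)]
    using u by simp
qed

lemma slash_mult: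
  assumes "g \<in> SL2Z" "h \<in> SL2Z" "\<tau> \<in> upper_half_plane"
  shows "slash k f (g ** h) \<tau> = slash k (slash k f g) h \<tau>"
  using assms by (simp add: slash_eq jac_mult mob_mult power_mult_distrib)

lemma slash_one [simp]: "slash k f (mat 1) = f"
  by (simp add: slash_eq jac_def mob_def fun_eq_iff mat_def)

lemma slash_times:
  "slash (k + l) (\<lambda>\<tau>. F \<tau> * G \<tau>) g \<tau> = slash k F g \<tau> * slash l G g \<tau>"
  by (simp add: slash_eq power_add)

lemma slash_plus:
  "slash k (\<lambda>\<tau>. F \<tau> + G \<tau>) g \<tau> = slash k F g \<tau> + slash k G g \<tau>"
  by (simp add: slash_eq algebra_simps)

lemma slash_cmult: "slash k (\<lambda>\<tau>. c * F \<tau>) g \<tau> = c * slash k F g \<tau>"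
  by (simp add: slash_eq)

lemma slash_cong:
  assumes "g \<in> SL2Z" "\<tau> \<in> upper_half_plane" "\<And>\<tau>. \<tau> \<in> upper_half_plane \<Longrightarrow> F \<tau> = G \<tau>"
  shows "slash k F g \<tau> = slash k G g \<tau>"
  using assms by (simp add: slash_eq mob_upper)

definition SL2_inv :: "int ^ 2 ^ 2 \<Rightarrow> int ^ 2 ^ 2" where
  "SL2_inv g = mat22 (g $ 2 $ 2) (- (g $ 1 $ 2)) (- (g $ 2 $ 1)) (g $ 1 $ 1)"

lemma SL2_inv_in: "g \<in> SL2Z \<Longrightarrow> SL2_inv g \<in> SL2Z"
  by (simp add: SL2_inv_def mat22_SL2Z_iff SL2Z_iff algebra_simps)

lemma SL2_inv_left: "g \<in> SL2Z \<Longrightarrow> SL2_inv g ** g = mat 1"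
  by (simp add: vec_eq_iff forall_2 matrix_mult_nth2 SL2_inv_def SL2Z_iff mat_def algebra_simps)

section \<open>Fourier expansions\<close>

text \<open>Coefficients are packaged as formal power series: products of functions become products
  in an integral domain, in which nonzero factors can be cancelled.\<close>

definition fexp :: "nat \<Rightarrow> (complex \<Rightarrow> complex) \<Rightarrow> complex fps \<Rightarrow> bool" where
  "fexp h F a \<longleftrightarrow> has_fourier_expansion h F (fps_nth a)"

definition qpar :: "nat \<Rightarrow> complex \<Rightarrow> complex" where
  "qpar h \<tau> = exp (2 * of_real pi * \<i> * \<tau> / of_nat h)"

lemma qpar_power: "qpar h \<tau> ^ n = exp (2 * of_real pi * \<i> * of_nat n * \<tau> / of_nat h)"
  by (simp add: qpar_def mult_ac flip: exp_of_nat_mult)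

lemma qpar_nonzero [simp]: "qpar h \<tau> \<noteq> 0"
  by (simp add: qpar_def)

lemma norm_qpar: "norm (qpar h \<tau>) = exp (- 2 * pi * Im \<tau> / real h)"
  by (simp add: qpar_def norm_exp_eq_Re)

lemma norm_qpar_less_1:
  assumes "h > 0" "\<tau> \<in> upper_half_plane"
  shows "norm (qpar h \<tau>) < 1"
  using assms by (simp add: norm_qpar upper_half_plane_def)

lemma qpar_surj:
  assumes "h > 0" "q \<noteq> 0" "norm q < 1"
  obtains \<tau> where "\<tau> \<in> upper_half_plane" "qpar h \<tau> = q"
proof
  define \<tau> where "\<tau> = of_nat h * Ln q / (2 * of_real pi * \<i>)"
  have "qpar h \<tau> = q" using assms by (simp add: qpar_def \<tau>_def)
  moreover have "exp (- 2 * pi * Im \<tau> / real h) < exp 0"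
    using assms(3) calculation norm_qpar[of h \<tau>] by simp
  hence "0 < Im \<tau>"
    unfolding exp_less_cancel_iff using assms(1)
    by (simp add: divide_less_0_iff mult_less_0_iff zero_less_divide_iff zero_less_mult_iff)
  ultimately show "\<tau> \<in> upper_half_plane" "qpar h \<tau> = q" by (simp_all add: upper_half_plane_def)
qed

lemma fexp_iff:
  "fexp h F a \<longleftrightarrow> (\<forall>\<tau>\<in>upper_half_plane. (\<lambda>n. fps_nth a n * qpar h \<tau> ^ n) sums F \<tau>)"
  by (simp add: fexp_def has_fourier_expansion_def qpar_power)

lemma fexpD: "fexp h F a \<Longrightarrow> \<tau> \<in> upper_half_plane \<Longrightarrow> (\<lambda>n. fps_nth a n * qpar h \<tau> ^ n) sums F \<tau>"
  by (simp add: fexp_iff)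

lemma fexp_unique: "h > 0 \<Longrightarrow> fexp h F a \<Longrightarrow> fexp h F b \<Longrightarrow> a = b"
  unfolding fexp_def using has_fourier_expansion_unique by (metis fps_ext)

lemma fexp_cong:
  assumes "\<And>\<tau>. \<tau> \<in> upper_half_plane \<Longrightarrow> F \<tau> = G \<tau>"
  shows "fexp h F a \<longleftrightarrow> fexp h G a"
  using assms by (simp add: fexp_iff)

lemma fexp_eqD:
  assumes "fexp h F a" "fexp h G a" "\<tau> \<in> upper_half_plane"
  shows "F \<tau> = G \<tau>"
  using fexpD[OF assms(1,3)] fexpD[OF assms(2,3)] by (rule sums_unique2)

text \<open>Convergence at a real point \<open>r\<close> with \<open>norm q < r < 1\<close> forces
  absolute convergence at \<open>q\<close>. Such an \<open>r\<close> is a value of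
  \<open>qpar h\<close>, whereas \<open>q = 0\<close> is not.\<close>

lemma fexp_summable:
  assumes h: "h > 0" and a: "fexp h F a" and q: "norm q < 1"
  shows "summable (\<lambda>n. norm (fps_nth a n * q ^ n))"
proof -
  obtain r where r: "norm q < r" "r < 1" using q dense by blast
  hence r0: "r > 0" using norm_ge_zero[of q] by linarith
  obtain \<tau> where t: "\<tau> \<in> upper_half_plane" "qpar h \<tau> = of_real r"
    using qpar_surj[of h "of_real r"] h r r0 by auto
  have "summable (\<lambda>n. fps_nth a n * of_real r ^ n)"
    using fexpD[OF a t(1)] t(2) sums_summable by simp
  thus ?thesis by (rule powser_insidea) (use r r0 in auto)
qed

lemma fexp_const: "fexp h (\<lambda>_. c) (fps_const c)"
  unfolding fexp_iff
proof safe
  fix \<tau>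
  have "(\<lambda>n. fps_nth (fps_const c) n * qpar h \<tau> ^ n) = (\<lambda>n. if n = 0 then c else 0)"
    by (auto simp: fun_eq_iff)
  thus "(\<lambda>n. fps_nth (fps_const c) n * qpar h \<tau> ^ n) sums c"
    using sums_single[of 0 "\<lambda>_. c"] by simp
qed

lemma fexp_add: "fexp h F a \<Longrightarrow> fexp h G b \<Longrightarrow> fexp h (\<lambda>\<tau>. F \<tau> + G \<tau>) (a + b)"
  by (auto simp: fexp_iff ring_distribs intro!: sums_add)

lemma fexp_mult:
  assumes "h > 0" "fexp h F a" "fexp h G b"
  shows "fexp h (\<lambda>\<tau>. F \<tau> * G \<tau>) (a * b)"
  unfolding fexp_iff
proof safe
  fix \<tau> assume t: "\<tau> \<in> upper_half_plane"
  let ?q = "qpar h \<tau>"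
  have q: "norm ?q < 1" using norm_qpar_less_1 assms t by blast
  have "(\<lambda>n. \<Sum>i\<le>n. (fps_nth a i * ?q ^ i) * (fps_nth b (n - i) * ?q ^ (n - i))) sums
     ((\<Sum>n. fps_nth a n * ?q ^ n) * (\<Sum>n. fps_nth b n * ?q ^ n))"
    using assms q by (intro Cauchy_product_sums fexp_summable)
  moreover have "(\<Sum>n. fps_nth a n * ?q ^ n) = F \<tau>" "(\<Sum>n. fps_nth b n * ?q ^ n) = G \<tau>"
    using assms t fexpD sums_unique by metis+
  moreover have "(\<Sum>i\<le>n. (fps_nth a i * ?q ^ i) * (fps_nth b (n - i) * ?q ^ (n - i)))
      = fps_nth (a * b) n * ?q ^ n" for n
    unfolding fps_mult_nth sum_distrib_right atMost_atLeast0
    by (intro sum.cong) (auto simp flip: power_add simp: mult_ac)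
  ultimately show "(\<lambda>n. fps_nth (a * b) n * ?q ^ n) sums (F \<tau> * G \<tau>)" by simp
qed

lemma fexp_cmult: "fexp h F a \<Longrightarrow> fexp h (\<lambda>\<tau>. c * F \<tau>) (fps_const c * a)"
  by (auto simp: fexp_iff mult.assoc intro!: sums_mult)

lemma fexp_sum:
  assumes "\<And>i. i \<in> I \<Longrightarrow> fexp h (F i) (a i)"
  shows "fexp h (\<lambda>\<tau>. \<Sum>i\<in>I. F i \<tau>) (\<Sum>i\<in>I. a i)"
  using assms fexp_const[of h 0] by (induction I rule: infinite_finite_induct) (auto intro!: fexp_add)

lemma fexp_prod:
  assumes "h > 0" "\<And>i. i \<in> I \<Longrightarrow> fexp h (F i) (a i)"
  shows "fexp h (\<lambda>\<tau>. \<Prod>i\<in>I. F i \<tau>) (\<Prod>i\<in>I. a i)"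
  using assms fexp_const[of h 1]
  by (induction I rule: infinite_finite_induct) (auto intro!: fexp_mult)

lemma fexp_power:
  assumes "h > 0" "fexp h F a"
  shows "fexp h (\<lambda>\<tau>. F \<tau> ^ n) (a ^ n)"
  using fexp_prod[of h "{..<n}" "\<lambda>_. F" "\<lambda>_. a"] assms by simp

lemma zeta_power: "zeta h ^ n = exp (2 * of_real pi * \<i> * of_nat n / of_nat h)"
  by (simp add: zeta_def mult_ac flip: exp_of_nat_mult)

lemma zeta_nonzero [simp]: "zeta h \<noteq> 0"
  by (simp add: zeta_def)

lemma zeta_power_eq_1_iff:
  assumes "h > 0"
  shows "zeta h ^ n = 1 \<longleftrightarrow> h dvd n"
  using zeta_powi_eq_iff[OF assms, of "int n" 0] by (simp add: cong_0_iff)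

lemma qpar_plus_1: "qpar h (\<tau> + 1) = qpar h \<tau> * zeta h"
  by (simp add: qpar_def zeta_def ring_distribs add_divide_distrib flip: exp_add)

lemma fexp_translate:
  assumes "fexp h F a"
  shows "fexp h (\<lambda>\<tau>. F (\<tau> + 1)) (Abs_fps (\<lambda>n. zeta h ^ n * fps_nth a n))"
  unfolding fexp_iff
proof safe
  fix \<tau> assume "\<tau> \<in> upper_half_plane"
  hence "\<tau> + 1 \<in> upper_half_plane" by (simp add: upper_half_plane_def)
  from fexpD[OF assms this]
  show "(\<lambda>n. fps_nth (Abs_fps (\<lambda>n. zeta h ^ n * fps_nth a n)) n * qpar h \<tau> ^ n) sums F (\<tau> + 1)"
    by (simp add: qpar_plus_1 power_mult_distrib mult_ac)
qed

text \<open>Translation by 1 multiplies the coefficient of index \<open>n\<close> by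
  \<open>zeta h ^ n\<close>, so uniqueness of expansions kills it unless
  \<open>zeta h ^ n = 1\<close>.\<close>

lemma fexp_periodic_coeff:
  assumes h: "h > 0" and a: "fexp h F a" and F: "\<And>\<tau>. \<tau> \<in> upper_half_plane \<Longrightarrow> F (\<tau> + 1) = F \<tau>"
    and n: "\<not> h dvd n"
  shows "fps_nth a n = 0"
proof -
  have "fexp h F (Abs_fps (\<lambda>n. zeta h ^ n * fps_nth a n))"
    using fexp_translate[OF a] fexp_cong[of "\<lambda>\<tau>. F (\<tau> + 1)" F] F by blast
  hence "a = Abs_fps (\<lambda>n. zeta h ^ n * fps_nth a n)" using fexp_unique h a by blast
  hence "fps_nth a n = zeta h ^ n * fps_nth a n" by (metis fps_nth_Abs_fps)
  thus ?thesis using zeta_power_eq_1_iff[OF h, of n] n by auto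
qed

lemma sums_multiples:
  fixes u :: "nat \<Rightarrow> complex"
  assumes h: "h > 0" and u: "\<And>n. \<not> h dvd n \<Longrightarrow> u n = 0"
  shows "(\<lambda>n. u (h * n)) sums s \<longleftrightarrow> u sums s"
proof (rule sums_mono_reindex)
  show "strict_mono (\<lambda>n. h * n)" using h by (simp add: strict_mono_def)
  show "u n = 0" if "n \<notin> range (\<lambda>n. h * n)" for n using that u by (metis dvdE rangeI)
qed

lemma qpar_pow_period: "h > 0 \<Longrightarrow> qpar h \<tau> ^ (h * n) = qpar 1 \<tau> ^ n"
  by (simp add: qpar_power mult_ac)

lemma fexp_descend:
  assumes h: "h > 0" and a: "fexp h F a" and F: "\<And>\<tau>. \<tau> \<in> upper_half_plane \<Longrightarrow> F (\<tau> + 1) = F \<tau>"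
  shows "fexp 1 F (Abs_fps (\<lambda>n. fps_nth a (h * n)))"
  unfolding fexp_iff
proof safe
  fix \<tau> assume t: "\<tau> \<in> upper_half_plane"
  have "(\<lambda>n. fps_nth a (h * n) * qpar h \<tau> ^ (h * n)) sums F \<tau>"
    using sums_multiples[OF h, of "\<lambda>n. fps_nth a n * qpar h \<tau> ^ n" "F \<tau>"]
      fexpD[OF a t] fexp_periodic_coeff[OF h a F] by auto
  thus "(\<lambda>n. fps_nth (Abs_fps (\<lambda>n. fps_nth a (h * n))) n * qpar 1 \<tau> ^ n) sums F \<tau>"
    by (simp add: qpar_pow_period[OF h])
qed

text \<open>The substitution of \<open>q ^ h\<close> for \<open>q\<close>, which rereads an
  expansion in a finer parameter.\<close>

definition stretch_fps :: "nat \<Rightarrow> complex fps \<Rightarrow> complex fps" where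
  "stretch_fps h a = Abs_fps (\<lambda>n. if h dvd n then fps_nth a (n div h) else 0)"

lemma fexp_ascend:
  assumes h: "h > 0" and a: "fexp l F a"
  shows "fexp (h * l) F (stretch_fps h a)"
  unfolding fexp_iff
proof safe
  fix \<tau> assume t: "\<tau> \<in> upper_half_plane"
  let ?u = "\<lambda>n. fps_nth (stretch_fps h a) n * qpar (h * l) \<tau> ^ n"
  have "qpar (h * l) \<tau> ^ (h * n) = qpar l \<tau> ^ n" for n
    using h by (simp add: qpar_power mult_ac)
  hence "(\<lambda>n. ?u (h * n)) sums F \<tau>"
    using fexpD[OF a t] h by (simp add: stretch_fps_def)
  thus "?u sums F \<tau>" using sums_multiples[OF h, of ?u "F \<tau>"]
    by (auto simp: stretch_fps_def)
qed

section \<open>Forms of level one\<close>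

text \<open>The expansion as a function on the unit disc. It also covers the cusp
  \<open>q = 0\<close>, to which no point of the half plane is mapped.\<close>

definition fps_fun :: "complex fps \<Rightarrow> complex \<Rightarrow> complex" where
  "fps_fun a q = (\<Sum>n. fps_nth a n * q ^ n)"

lemma fexp_fun:
  assumes "fexp h F a" "\<tau> \<in> upper_half_plane"
  shows "F \<tau> = fps_fun a (qpar h \<tau>)"
  using fexpD[OF assms] by (simp add: fps_fun_def sums_iff)

lemma fexp_fps_fun_sums:
  assumes "h > 0" "fexp h F a" "norm q < 1"
  shows "(\<lambda>n. fps_nth a n * q ^ n) sums fps_fun a q"
  using summable_norm_cancel[OF fexp_summable[OF assms]] by (simp add: fps_fun_def summable_sums)

lemma fps_fun_shift_holomorphic:
  assumes "h > 0" "fexp h F a"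
  shows "fps_fun (fps_shift m a) holomorphic_on ball 0 1"
proof (rule power_series_holomorphic[where a = "fps_nth (fps_shift m a)"])
  fix q :: complex assume q: "q \<in> ball 0 1"
  have "summable (\<lambda>n. fps_nth (fps_shift m a) n * q ^ n)"
  proof (cases "q = 0")
    case True
    thus ?thesis using powser_sums_zero[of "fps_nth (fps_shift m a)"] sums_summable by auto
  next
    case False
    have "summable (\<lambda>n. fps_nth a (n + m) * q ^ (n + m))"
      using fexp_fps_fun_sums[OF assms, of q] q sums_summable 
      by (subst summable_iff_shift) auto
    hence "summable (\<lambda>n. inverse (q ^ m) * (fps_nth a (n + m) * q ^ (n + m)))"
      by (rule summable_mult)
    thus ?thesis using False by (simp add: power_add field_simps)
  qed
  thus "(\<lambda>n. fps_nth (fps_shift m a) n * (q - 0) ^ n) sums fps_fun (fps_shift m a) q"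
    by (simp add: fps_fun_def summable_sums)
qed

lemma fps_fun_shift:
  assumes "h > 0" "fexp h F a" "norm q < 1" "\<And>i. i < m \<Longrightarrow> fps_nth a i = 0"
  shows "fps_fun a q = q ^ m * fps_fun (fps_shift m a) q"
proof (cases "q = 0")
  case True
  thus ?thesis using assms(4)[of 0] 
    by (cases m) (simp_all add: fps_fun_def)
next
  case False
  have "(\<lambda>n. fps_nth a (n + m) * q ^ (n + m)) sums fps_fun a q"
    using sums_split_initial_segment[OF fexp_fps_fun_sums[OF assms(1-3)], of m] by (simp add: assms(4))
  hence "(\<lambda>n. inverse (q ^ m) * (fps_nth a (n + m) * q ^ (n + m))) sums (inverse (q ^ m) * fps_fun a q)"
    by (rule sums_mult)
  hence "(\<lambda>n. fps_nth (fps_shift m a) n * q ^ n) sums (inverse (q ^ m) * fps_fun a q)"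
    using False by (simp add: power_add field_simps)
  hence "fps_fun (fps_shift m a) q = inverse (q ^ m) * fps_fun a q"
    by (simp add: fps_fun_def sums_iff)
  thus ?thesis using False by simp
qed

section \<open>Reduction theory and a vanishing criterion in level one\<close>

text \<open>The square of \<open>norm (c * \<tau> + d)\<close> is a positive definite quadratic form
  in \<open>c\<close> and \<open>d\<close>. The bound gives both the finiteness behind the
  minimisation below and the convergence of the lattice sums.\<close>

lemma linear_form_lower_bound:
  assumes "Im \<tau> > 0"
  obtains K where "K > 0"
    "\<And>c d :: int. real_of_int c ^ 2 + real_of_int d ^ 2 \<le> K * norm (of_int c * \<tau> + of_int d) ^ 2"
proof -
  define x y where "x = Re \<tau>" "y = Im \<tau>"
  define R where "R = (1 + 2 * x ^ 2) / y ^ 2"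
  have y: "y > 0" using assms by (simp add: x_y_def)
  have R: "R \<ge> 0" by (simp add: R_def)
  show ?thesis
  proof (rule that[of "2 + R"])
    show "2 + R > 0" using R by simp
    fix c d :: int
    define C u v where "C = real_of_int c" "u = C * x + real_of_int d" "v = C * y"
    have n: "norm (of_int c * \<tau> + of_int d) ^ 2 = u ^ 2 + v ^ 2"
      by (simp add: cmod_power2 C_u_v_def x_y_def)
    have d: "real_of_int d = u - C * x" by (simp add: C_u_v_def)
    have "(u - C * x) ^ 2 \<le> 2 * u ^ 2 + 2 * (C * x) ^ 2"
      using zero_le_power2[of "u + C * x"] by (simp add: power2_eq_square algebra_simps)
    moreover have "C ^ 2 + 2 * (C * x) ^ 2 = R * v ^ 2"
      using y by (simp add: R_def C_u_v_def field_simps power2_eq_square)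
    moreover have "2 * u ^ 2 + R * v ^ 2 \<le> (2 + R) * (u ^ 2 + v ^ 2)"
      using R by (simp add: algebra_simps)
    ultimately show "real_of_int c ^ 2 + real_of_int d ^ 2 \<le> (2 + R) * norm (of_int c * \<tau> + of_int d) ^ 2"
      unfolding n C_u_v_def(1)[symmetric] unfolding d by linarith
  qed
qed

text \<open>A matrix minimising \<open>norm (jac g \<tau>)\<close> moves \<open>\<tau>\<close> to a point at distance at least 1
  from every integer.\<close>

lemma exists_SL2Z_Im_ge:
  assumes t: "\<tau> \<in> upper_half_plane"
  obtains g where "g \<in> SL2Z" "Im (mob g \<tau>) \<ge> 17 / 20"
proof -
  have "Im \<tau> > 0" using t by (simp add: upper_half_plane_def)
  then obtain K where K: "K > 0"
    "\<And>c d :: int. real_of_int c ^ 2 + real_of_int d ^ 2 \<le> K * norm (of_int c * \<tau> + of_int d) ^ 2"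
    using linear_form_lower_bound by blast
  define S where "S = {(g $ 2 $ 1, g $ 2 $ 2) |g. g \<in> SL2Z \<and> norm (jac g \<tau>) \<le> 1}"
  define B where "B = \<lceil>K\<rceil>"
  have "S \<subseteq> {-B..B} \<times> {-B..B}"
  proof safe
    fix c d assume "(c, d) \<in> S"
    hence n: "norm (of_int c * \<tau> + of_int d) \<le> 1" by (auto simp: S_def jac_def)
    hence "norm (of_int c * \<tau> + of_int d) ^ 2 \<le> 1" by (simp add: power_le_one)
    hence "K * norm (of_int c * \<tau> + of_int d) ^ 2 \<le> K" using K(1) by simp
    hence "real_of_int (c ^ 2 + d ^ 2) \<le> K" using K(2)[of c d] by simp
    hence "c ^ 2 + d ^ 2 \<le> B" unfolding B_def by linarith
    moreover have "\<bar>c\<bar> \<le> c ^ 2" "\<bar>d\<bar> \<le> d ^ 2" 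
      by (metis abs_ge_zero abs_mult_self_eq int_one_le_iff_zero_less linorder_not_le mult_le_cancel_left1 order_le_less power2_eq_square zero_less_abs_iff mult_zero_right)+
    moreover have "c ^ 2 \<ge> 0" "d ^ 2 \<ge> 0" by auto
    ultimately have "\<bar>c\<bar> \<le> B" "\<bar>d\<bar> \<le> B" by linarith+
    thus "c \<in> {-B..B}" "d \<in> {-B..B}" by auto
  qed
  hence fin: "finite S" by (rule finite_subset) auto
  have "norm (jac (mat 1) \<tau>) \<le> 1" by (simp add: jac_def mat_def)
  hence ne: "S \<noteq> {}" using SL2Z_one unfolding S_def by blast
  define \<phi> where "\<phi> = (\<lambda>(c, d). norm (of_int c * \<tau> + of_int d :: complex))"
  obtain p where p: "p \<in> S" "\<And>p'. p' \<in> S \<Longrightarrow> \<phi> p \<le> \<phi> p'"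
    using ex_is_arg_min_if_finite[OF fin ne, of \<phi>] by (auto simp: is_arg_min_linorder)
  then obtain g where g: "g \<in> SL2Z" "norm (jac g \<tau>) \<le> 1" "\<phi> p = norm (jac g \<tau>)"
    by (auto simp: S_def \<phi>_def jac_def)
  have min: "norm (jac g \<tau>) \<le> norm (jac g' \<tau>)" if "g' \<in> SL2Z" for g'
  proof (cases "norm (jac g' \<tau>) \<le> 1")
    case True
    hence "(g' $ 2 $ 1, g' $ 2 $ 2) \<in> S" using that by (auto simp: S_def)
    from p(2)[OF this] show ?thesis unfolding g(3) by (simp add: \<phi>_def jac_def)
  qed (use g in linarith)
  define \<sigma> where "\<sigma> = mob g \<tau>"
  have s: "\<sigma> \<in> upper_half_plane" using g t mob_upper \<sigma>_def by blast
  \<comment> \<open>Translate \<sigma> to real part at most 1/2 in absolute value, then invert.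
    Minimality gives \<open>norm (\<sigma> + n) \<ge> 1\<close>, so \<open>Im \<sigma>\<close> is at
    least the square root of 3/4, and \<open>17 / 20\<close> is a rational just below that.\<close>
  define n where "n = - round (Re \<sigma>)"
  define h where "h = mat22 0 (-1) 1 n"
  have h: "h \<in> SL2Z" by (simp add: h_def mat22_SL2Z_iff)
  have "norm (jac g \<tau>) \<le> norm (jac h \<sigma>) * norm (jac g \<tau>)"
    using min[of "h ** g"] SL2Z_mult[OF h g(1)] jac_mult[OF g(1) t, of h]
    by (simp add: \<sigma>_def norm_mult)
  hence "norm (jac h \<sigma>) \<ge> 1" using jac_nonzero[OF g(1) t] by simp
  hence "1 \<le> norm (\<sigma> + of_int n) ^ 2" by (simp add: jac_def h_def)
  also have "\<dots> = (Re \<sigma> + n) ^ 2 + Im \<sigma> ^ 2" by (simp add: cmod_power2)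
  also have "(Re \<sigma> + n) ^ 2 \<le> (1 / 2) ^ 2"
    using of_int_round_abs_le[of "Re \<sigma>"] by (intro power2_le_iff_abs_le[THEN iffD2]) (auto simp: n_def abs_minus_commute)
  finally have "(17 / 20) ^ 2 \<le> Im \<sigma> ^ 2" by (simp add: power2_eq_square)
  hence "17 / 20 \<le> Im \<sigma>" by (rule power2_le_imp_le) (use s in \<open>auto simp: upper_half_plane_def\<close>)
  thus ?thesis using that g(1) \<sigma>_def by blast
qed

lemma pi_gt3: "3 < pi"
  using pi_approx by simp

definition level_one :: "nat \<Rightarrow> (complex \<Rightarrow> complex) \<Rightarrow> bool" where
  "level_one W f \<longleftrightarrow> (\<forall>g\<in>SL2Z. \<forall>\<tau>\<in>upper_half_plane. slash W f g \<tau> = f \<tau>)"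

text \<open>The invariant function \<open>\<psi>\<close>, that is
  \<open>norm f ^ 2 * Im ^ W\<close>, has a finite supremum \<open>S\<close>. The maximum principle
  for \<open>f / q ^ n\<close> on the disc corresponding to \<open>Im \<ge> 2 / 3\<close> bounds
  \<open>\<psi>\<close> by \<open>\<kappa> * S\<close> with \<open>\<kappa> < 1\<close> at all
  heights from \<open>17 / 20\<close> on, hence everywhere by reduction, so \<open>S = 0\<close>.
  The constant 8 comes from \<open>8 * 3 / 2 = 12 < 4 * pi\<close>.\<close>

lemma level_one_vanishing:
  assumes inv: "level_one W f" and a: "fexp 1 f a"
    and n: "n > 0" "W \<le> 8 * n" "\<And>i. i < n \<Longrightarrow> fps_nth a i = 0"
    and t: "\<tau> \<in> upper_half_plane"
  shows "f \<tau> = 0"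
proof -
  define \<psi> where "\<psi> \<tau> = norm (f \<tau>) ^ 2 * Im \<tau> ^ W" for \<tau>
  define G where "G = fps_fun (fps_shift n a)"
  define r where "r = exp (- 2 * pi * (2 / 3))"
  have r: "0 < r" "r < 1" by (simp_all add: r_def)
  have norm_q: "norm (qpar 1 \<tau>) = exp (- 2 * pi * Im \<tau>)" for \<tau> using norm_qpar[of 1 \<tau>] by simp
  have f_eq: "f \<tau> = qpar 1 \<tau> ^ n * G (qpar 1 \<tau>)" if "\<tau> \<in> upper_half_plane" for \<tau>
    using fexp_fun[OF a that] fps_fun_shift[OF _ a _ n(3)] norm_qpar_less_1[of 1 \<tau>] that by (simp add: G_def)
  have \<psi>_inv: "\<psi> (mob g \<tau>) = \<psi> \<tau>" if "g \<in> SL2Z" "\<tau> \<in> upper_half_plane" for g \<tau>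
  proof -
    have j: "norm (jac g \<tau>) \<noteq> 0" using jac_nonzero that by simp
    have "inverse (jac g \<tau> ^ W) * f (mob g \<tau>) = f \<tau>"
      using inv that by (auto simp: level_one_def slash_eq)
    hence "f (mob g \<tau>) = jac g \<tau> ^ W * f \<tau>" using j by (auto simp: field_simps)
    thus ?thesis using j by (simp add: \<psi>_def Im_mob[OF that] norm_mult norm_power power_mult_distrib
          power_divide flip: power_mult) (simp add: mult.commute)
  qed
  have "continuous_on (cball 0 r) G"
    using fps_fun_shift_holomorphic[OF _ a, of n] r unfolding G_def
    by (intro holomorphic_on_imp_continuous_on) (auto elim: holomorphic_on_subset)
  hence "bounded (G ` cball 0 r)" by (intro compact_imp_bounded compact_continuous_image) auto
  then obtain M where M: "\<And>q. norm q \<le> r \<Longrightarrow> norm (G q) \<le> M" 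
    unfolding bounded_iff by force
  have q_le: "norm (qpar 1 \<tau>) \<le> r" if "Im \<tau> \<ge> 17 / 20" for \<tau>
    unfolding norm_q r_def using that by (simp add: mult_left_mono)
  have \<psi>_high: "\<psi> \<tau> = exp (- 4 * pi * n * Im \<tau>) * Im \<tau> ^ W * norm (G (qpar 1 \<tau>)) ^ 2"
    if "\<tau> \<in> upper_half_plane" for \<tau>
  proof -
    have "(norm (qpar 1 \<tau>) ^ n) ^ 2 = exp (- 4 * pi * n * Im \<tau>)"
      unfolding norm_q by (simp add: mult_ac flip: exp_of_nat_mult)
    thus ?thesis by (simp add: \<psi>_def f_eq[OF that] norm_mult norm_power power_mult_distrib)
  qed
  \<comment> \<open>A crude bound, needed only for the supremum to exist.\<close>
  have "\<psi> \<tau> \<le> M ^ 2" if t': "\<tau> \<in> upper_half_plane" for \<tau>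
  proof -
    obtain g where g: "g \<in> SL2Z" "Im (mob g \<tau>) \<ge> 17 / 20" using exists_SL2Z_Im_ge[OF t'] by blast
    define \<sigma> where "\<sigma> = mob g \<tau>"
    have s: "\<sigma> \<in> upper_half_plane" "Im \<sigma> \<ge> 17 / 20" using g that mob_upper by (auto simp: \<sigma>_def)
    have "real W \<le> 8 * real n" using n(2) by linarith
    moreover have "12 * real n \<le> 4 * pi * n" using pi_gt3 by (intro mult_right_mono) auto
    ultimately have W: "real W \<le> 4 * pi * n" by linarith
    have "Im \<sigma> \<le> exp (Im \<sigma>)" using exp_ge_add_one_self[of "Im \<sigma>"] by linarith
    hence "Im \<sigma> ^ W \<le> exp (Im \<sigma>) ^ W" using s by (intro power_mono) auto
    also have "\<dots> = exp (W * Im \<sigma>)" by (simp flip: exp_of_nat_mult)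
    also have "exp (W * Im \<sigma>) \<le> exp (4 * pi * n * Im \<sigma>)" using s W by (simp add: mult_right_mono)
    finally have "exp (- 4 * pi * n * Im \<sigma>) * Im \<sigma> ^ W \<le> exp (- 4 * pi * n * Im \<sigma>) * exp (4 * pi * n * Im \<sigma>)"
      by (intro mult_left_mono) auto
    hence 1: "exp (- 4 * pi * n * Im \<sigma>) * Im \<sigma> ^ W \<le> 1" by (simp flip: exp_add)
    have "\<psi> \<tau> = \<psi> \<sigma>" using \<psi>_inv[OF g(1) that] by (simp add: \<sigma>_def)
    also have "\<dots> \<le> 1 * M ^ 2" unfolding \<psi>_high[OF s(1)]
      by (rule mult_mono[OF 1]) (use M[OF q_le[OF s(2)]] in \<open>auto intro: power_mono\<close>)
    finally show ?thesis by simp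
  qed
  hence bdd: "bdd_above (\<psi> ` upper_half_plane)" by (intro bdd_aboveI[of _ "M ^ 2"]) auto
  define S where "S = Sup (\<psi> ` upper_half_plane)"
  have S: "\<psi> \<tau> \<le> S" if "\<tau> \<in> upper_half_plane" for \<tau>
    unfolding S_def using that bdd by (intro cSup_upper) auto
  have S0: "S \<ge> 0" using S[OF t] by (smt (verit) \<psi>_def t upper_half_plane_def mem_Collect_eq zero_le_power2 zero_le_power mult_nonneg_nonneg)
  \<comment> \<open>\<open>11 / 60\<close> is \<open>17 / 20 - 2 / 3\<close>, the distance between
    the height reached by reduction and the height of the bounding circle.\<close>
  define \<kappa> where "\<kappa> = exp (- ((4 * pi - 12) * (11 / 60)))"
  have \<kappa>: "\<kappa> < 1" using pi_gt3 by (simp add: \<kappa>_def)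
  define B where "B = sqrt (S * (3 / 2) ^ W) / r ^ n"
  have G_le: "norm (G q) \<le> B" if "norm q \<le> r" for q
  proof (rule maximum_modulus_frontier[of G "cball 0 r"])
    show "G holomorphic_on interior (cball 0 r)"
      using fps_fun_shift_holomorphic[OF _ a, of n] r unfolding G_def
      by (auto elim!: holomorphic_on_subset)
    show "continuous_on (closure (cball 0 r)) G" using \<open>continuous_on (cball 0 r) G\<close> by simp
    show "q \<in> cball 0 r" using that by simp
    fix z assume "z \<in> frontier (cball (0::complex) r)"
    hence z: "norm z = r" using r by (simp add: frontier_cball)
    obtain \<sigma> where s: "\<sigma> \<in> upper_half_plane" "qpar 1 \<sigma> = z"
      by (rule qpar_surj[of 1 z]) (use r z in auto)
    hence "exp (- 2 * pi * Im \<sigma>) = exp (- 2 * pi * (2 / 3))" using norm_q[of \<sigma>] z by (simp add: r_def)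
    hence im: "Im \<sigma> = 2 / 3" by (simp only: exp_inj_iff) simp
    have "norm (f \<sigma>) ^ 2 * (2 / 3) ^ W \<le> S" using S[OF s(1)] by (simp add: \<psi>_def im)
    hence "norm (f \<sigma>) ^ 2 \<le> S * (3 / 2) ^ W" by (simp add: field_simps)
    hence "norm (f \<sigma>) \<le> sqrt (S * (3 / 2) ^ W)" by (rule real_le_rsqrt)
    moreover have "norm (f \<sigma>) = r ^ n * norm (G z)"
      using f_eq[OF s(1)] by (simp add: s(2) norm_mult norm_power z del: One_nat_def)
    ultimately show "norm (G z) \<le> B" using r by (simp add: B_def field_simps)
  qed auto
  have \<psi>_le: "\<psi> \<tau> \<le> \<kappa> * S" if t': "\<tau> \<in> upper_half_plane" for \<tau>
  proof -
    obtain g where g: "g \<in> SL2Z" "Im (mob g \<tau>) \<ge> 17 / 20" using exists_SL2Z_Im_ge[OF t'] by blast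
    define \<sigma> y where "\<sigma> = mob g \<tau>" "y = Im (mob g \<tau>)"
    have s: "\<sigma> \<in> upper_half_plane" "Im \<sigma> \<ge> 17 / 20" "y \<ge> 17 / 20" "Im \<sigma> = y"
      using g that mob_upper by (auto simp: \<sigma>_y_def)
    have B2: "B ^ 2 = S * (3 / 2) ^ W * exp (4 * pi * n * (2 / 3))"
    proof -
      have eq: "(r ^ n) ^ 2 = exp (- (4 * pi * n * (2 / 3)))"
        by (simp add: r_def flip: exp_of_nat_mult power_mult)
      have "B ^ 2 = (sqrt (S * (3 / 2) ^ W)) ^ 2 / (r ^ n) ^ 2" by (simp only: B_def power_divide)
      also have "(sqrt (S * (3 / 2) ^ W)) ^ 2 = S * (3 / 2) ^ W" using S0 by simp
      finally show ?thesis unfolding eq by (simp only: exp_minus divide_inverse inverse_inverse_eq)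
    qed
    \<comment> \<open>This is \<open>1 + x \<le> exp x\<close> at \<open>x = 3 / 2 * y - 1\<close>.
      It is an equality at \<open>y = 2 / 3\<close>, so the growth of \<open>y ^ W\<close> is
      measured from the same height as the decay of \<open>q ^ n\<close>.\<close>
    have "3 / 2 * y \<le> e" if "1 + 3 / 2 * (y - 2 / 3) \<le> e" for e using that by argo
    hence "3 / 2 * y \<le> exp (3 / 2 * (y - 2 / 3))" using exp_ge_add_one_self by blast
    hence "(3 / 2 * y) ^ W \<le> exp (3 / 2 * (y - 2 / 3)) ^ W"
      by (rule power_mono) (use s(3) in simp)
    also have "\<dots> = exp (W * (3 / 2 * (y - 2 / 3)))" by (simp flip: exp_of_nat_mult)
    also have "real W * (3 / 2) \<le> 12 * real n" using n(2) by linarith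
    hence "W * (3 / 2 * (y - 2 / 3)) \<le> 12 * n * (y - 2 / 3)" using s(3) 
      by (simp only: mult.assoc[symmetric]) (intro mult_right_mono, auto)
    finally have A: "(3 / 2 * y) ^ W \<le> exp (12 * n * (y - 2 / 3))" by simp
    have "\<psi> \<tau> = \<psi> \<sigma>" using \<psi>_inv[OF g(1) that] by (simp add: \<sigma>_y_def)
    also have "\<dots> \<le> exp (- 4 * pi * n * y) * y ^ W * B ^ 2" unfolding \<psi>_high[OF s(1)] s(4)
      using G_le[OF q_le[OF s(2)]] s by (intro mult_left_mono power_mono) auto
    also have "\<dots> = (3 / 2 * y) ^ W * exp (- (4 * pi * n * (y - 2 / 3))) * S"
      by (simp add: B2 power_mult_distrib mult_ac exp_diff exp_minus ring_distribs field_simps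
            flip: exp_add)
    also have "\<dots> \<le> exp (12 * n * (y - 2 / 3)) * exp (- (4 * pi * n * (y - 2 / 3))) * S"
      using A S0 by (intro mult_right_mono) auto
    also have "exp (12 * n * (y - 2 / 3)) * exp (- (4 * pi * n * (y - 2 / 3))) =
       exp (- ((4 * pi - 12) * (n * (y - 2 / 3))))"
      by (simp add: algebra_simps flip: exp_add)
    also have "\<dots> \<le> \<kappa>"
    proof -
      have "1 * (11 / 60) \<le> real n * (y - 2 / 3)" using n(1) s(3) by (intro mult_mono) auto
      hence "(4 * pi - 12) * (11 / 60) \<le> (4 * pi - 12) * (n * (y - 2 / 3))"
        using pi_gt3 by (intro mult_left_mono) auto
      thus ?thesis by (simp add: \<kappa>_def)
    qed
    finally show ?thesis using S0 by (simp add: mult_right_mono)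
  qed
  have "S \<le> \<kappa> * S" unfolding S_def
    by (rule cSup_least) (use t \<psi>_le in \<open>auto simp: S_def\<close>)
  hence "(1 - \<kappa>) * S \<le> 0" by (simp add: algebra_simps)
  hence "S \<le> 0" using \<kappa> by (simp add: mult_le_0_iff)
  hence "S = 0" using S0 by simp
  hence "\<psi> \<tau> \<le> 0" using S[OF t] by simp
  moreover have "Im \<tau> ^ W > 0" using t by (simp add: upper_half_plane_def)
  ultimately have "norm (f \<tau>) ^ 2 \<le> 0" by (simp only: \<psi>_def mult_le_0_iff) linarith
  thus ?thesis by simp
qed

section \<open>Lipschitz' formula\<close>

text \<open>The rational functions \<open>lip n\<close> with \<open>lip n x = (\<Sum>r\<ge>1. r ^ n * x ^ r)\<close> for \<open>norm x < 1\<close>; by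
  Lipschitz' formula they also give the lattice sums \<open>\<Sum>k. (z + k) ^ (-(n+1))\<close>, including real \<open>z\<close>.\<close>

fun eulerian_poly :: "nat \<Rightarrow> complex poly" where
  "eulerian_poly 0 = [:0, 1:]"
| "eulerian_poly (Suc n) = [:0, 1:] * ([:1, -1:] * pderiv (eulerian_poly n) + of_nat (Suc n) * eulerian_poly n)"

definition lip :: "nat \<Rightarrow> complex \<Rightarrow> complex" where
  "lip n x = poly (eulerian_poly n) x / (1 - x) ^ Suc n"

lemma lip_values:  "lip 0 x = x / (1 - x)" "lip 3 (-1) = 1/8" "lip 5 (-1) = -1/4"
  unfolding lip_def 
  by (simp_all add: eval_nat_numeral pderiv_pCons pderiv_mult pderiv_add of_nat_poly)

text \<open>The operator \<open>x * d/dx\<close> raises the index of \<open>lip\<close> by one. The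
  recursion for \<open>eulerian_poly\<close> is the quotient rule over the denominator
  \<open>(1 - x) ^ (n + 2)\<close>.\<close>

lemma lip_deriv:
  assumes "x \<noteq> 1" "x \<noteq> 0"
  shows "(lip n has_field_derivative lip (Suc n) x / x) (at x)"
proof -
  let ?p = "eulerian_poly n"
  have "((\<lambda>x. poly ?p x / (1 - x) ^ Suc n) has_field_derivative
     (poly (pderiv ?p) x * (1 - x) ^ Suc n - poly ?p x * (of_nat (Suc n) * (1 - x) ^ n * (- 1)))
       / ((1 - x) ^ Suc n * (1 - x) ^ Suc n)) (at x)"
    by (rule derivative_eq_intros poly_DERIV refl | use assms in simp)+
  also have "(poly (pderiv ?p) x * (1 - x) ^ Suc n - poly ?p x * (of_nat (Suc n) * (1 - x) ^ n * (- 1)))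
       / ((1 - x) ^ Suc n * (1 - x) ^ Suc n) = 
      ((1 - x) ^ n * (poly (pderiv ?p) x * (1 - x) + poly ?p x * of_nat (Suc n)))
       / ((1 - x) ^ n * (1 - x) ^ Suc (Suc n))"
    by (simp add: algebra_simps)
  also have "\<dots> = (poly (pderiv ?p) x * (1 - x) + poly ?p x * of_nat (Suc n)) / (1 - x) ^ Suc (Suc n)"
    using assms by (intro nonzero_mult_divide_mult_cancel_left) simp
  also have "\<dots> = lip (Suc n) x / x"
    using assms by (simp add: lip_def of_nat_poly del: of_nat_Suc power_Suc) (simp add: field_simps)
  finally show ?thesis by (simp add: lip_def [abs_def])
qed

lemma lip_sums:
  assumes "norm x < 1"
  shows "(\<lambda>r. of_nat (Suc r) ^ n * x ^ Suc r) sums lip n x"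
  using assms
proof (induction n arbitrary: x)
  case 0
  have "(\<lambda>r. x * x ^ r) sums (x * (1 / (1 - x)))"
    using 0 by (intro sums_mult geometric_sums)
  thus ?case by (simp add: lip_values)
next
  case (Suc n)
  show ?case
  proof (cases "x = 0")
    case True
    have "eulerian_poly (Suc n) = [:0, 1:] * q \<Longrightarrow> lip (Suc n) 0 = 0" for q
      by (simp add: lip_def)
    thus ?thesis using True by (auto simp del: power_Suc)
  next
    case False
    define c :: "nat \<Rightarrow> complex" where "c r = (if r = 0 then 0 else of_nat r ^ n)" for r
    have "(\<lambda>r. c r * z ^ r) sums lip n z" if "norm z < 1" for z
      using Suc.IH[OF that] sums_Suc_iff[of "\<lambda>r. c r * z ^ r" "lip n z"] by (simp add: c_def)
    moreover have "x \<noteq> 1" using Suc.prems by auto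
    ultimately have "(\<lambda>r. diffs c r * x ^ r) sums (lip (Suc n) x / x)"
      using lip_deriv[of x n] False Suc.prems by (intro termdiffs_sums_strong[of 1]) auto
    hence "(\<lambda>r. x * (diffs c r * x ^ r)) sums (x * (lip (Suc n) x / x))" by (rule sums_mult)
    thus ?thesis using False by (simp add: diffs_def c_def mult_ac)
  qed
qed

abbreviation cis_2pi :: "complex \<Rightarrow> complex" where
  "cis_2pi z \<equiv> exp (2 * of_real pi * \<i> * z)"

lemma cis_2pi_eq_1_iff: "cis_2pi z = 1 \<longleftrightarrow> z \<in> \<int>"
proof
  assume "cis_2pi z = 1"
  then obtain k :: int where "Im (2 * of_real pi * \<i> * z) = of_int (2 * k) * pi" "Re (2 * of_real pi * \<i> * z) = 0"
    unfolding exp_eq_1 by blast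
  hence "z = of_int k" by (simp add: complex_eq_iff)
  thus "z \<in> \<int>" by simp
next
  assume "z \<in> \<int>"
  then obtain k where "z = of_int k" by (rule Ints_cases)
  thus "cis_2pi z = 1" by (auto simp: exp_eq_1 intro!: exI[of _ k])
qed

text \<open>The logarithmic derivative of
  \<open>Gamma z * Gamma (1 - z) = pi / sin (pi * z)\<close>, with the cotangent rewritten as a
  rational function of \<open>cis_2pi z\<close>.\<close>

lemma Digamma_reflection:
  assumes z: "z \<notin> (\<int> :: complex set)"
  shows "Digamma z - Digamma (1 - z) = of_real pi * \<i> + 2 * of_real pi * \<i> * lip 0 (cis_2pi z)"
proof -
  have np: "z \<notin> \<int>\<^sub>\<le>\<^sub>0" "1 - z \<notin> \<int>\<^sub>\<le>\<^sub>0"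
    using z nonpos_Ints_Int Ints_diff[of 1 "1 - z"] by auto
  have s: "sin (of_real pi * z) \<noteq> 0"
  proof
    assume "sin (of_real pi * z) = 0"
    then obtain k :: int where "of_real pi * z = of_real (of_int k * pi)"
      unfolding sin_eq_0 by blast
    hence "z = of_int k" by simp
    thus False using z by simp
  qed
  have "((\<lambda>z. Gamma z * Gamma (1 - z)) has_field_derivative
      (Gamma z * Gamma (1 - z) * (Digamma z - Digamma (1 - z)))) (at z)"
    using np by (auto intro!: derivative_eq_intros simp: algebra_simps)
  moreover have "((\<lambda>z. of_real pi / sin (of_real pi * z)) has_field_derivative
      (of_real pi / sin (of_real pi * z) * (- (of_real pi * cos (of_real pi * z) / sin (of_real pi * z))))) (at z)"
    using s by (auto intro!: derivative_eq_intros simp: power2_eq_square)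
  ultimately have "of_real pi / sin (of_real pi * z) * (Digamma z - Digamma (1 - z)) =
     of_real pi / sin (of_real pi * z) * (- (of_real pi * cos (of_real pi * z) / sin (of_real pi * z)))"
    unfolding Gamma_reflection_complex by (rule DERIV_unique)
  hence 1: "Digamma z - Digamma (1 - z) = - (of_real pi * cos (of_real pi * z) / sin (of_real pi * z))"
    using s by (subst (asm) mult_cancel_left) auto
  define y where "y = exp (\<i> * (of_real pi * z))"
  have y: "y \<noteq> 0" "cis_2pi z = y ^ 2" 
    by (simp_all add: y_def power2_eq_square flip: exp_add) (simp add: algebra_simps)
  have y2: "y ^ 2 \<noteq> 1" using cis_2pi_eq_1_iff[of z] z y(2) by simp
  have sc: "sin (of_real pi * z) = (y - inverse y) / (2 * \<i>)" "cos (of_real pi * z) = (y + inverse y) / 2"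
    by (simp_all add: sin_exp_eq cos_exp_eq y_def exp_minus)
  define Y where "Y = y ^ 2"
  have yY: "y + inverse y = inverse y * (Y + 1)" "y - inverse y = inverse y * (Y - 1)"
    using y(1) by (simp_all add: Y_def power2_eq_square algebra_simps)
  have "a * b / 2 = \<i> * (b / d) * (a * d / (2 * \<i>))" if "d \<noteq> 0" for a b d :: complex
    using that by simp (simp add: mult.left_commute[of b \<i>] mult.commute)
  from this[of "Y - 1" "inverse y" "Y + 1"]
  have "cos (of_real pi * z) = \<i> * ((Y + 1) / (Y - 1)) * sin (of_real pi * z)"
    unfolding sc yY using y2 by (simp only: Y_def) simp
  hence "cos (of_real pi * z) / sin (of_real pi * z) = \<i> * ((Y + 1) / (Y - 1))"
    using s by simp
  also have "(Y + 1) / (Y - 1) = - 1 - 2 * (Y / (1 - Y))"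
    using y2 unfolding Y_def[symmetric] by (simp add: divide_simps) (simp add: algebra_simps)
  finally have fin: "cos (of_real pi * z) / sin (of_real pi * z) = - \<i> - 2 * \<i> * (y ^ 2 / (1 - y ^ 2))"
    by (simp add: Y_def algebra_simps)
  have "Digamma z - Digamma (1 - z) = - (of_real pi * (cos (of_real pi * z) / sin (of_real pi * z)))"
    unfolding 1 by simp
  thus ?thesis unfolding fin y(2) lip_values by (simp add: algebra_simps)
qed

text \<open>The reflection formula differentiated \<open>n\<close> times; \<open>1 - z\<close>
  contributes the sign, and the additive constant survives only for \<open>n = 0\<close>.\<close>

lemma Polygamma_reflection:
  assumes "z \<notin> (\<int> :: complex set)"
  shows "Polygamma n z - (-1) ^ n * Polygamma n (1 - z) =
    (2 * of_real pi * \<i>) ^ Suc n * lip n (cis_2pi z) + (if n = 0 then of_real pi * \<i> else 0)"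
  using assms
proof (induction n arbitrary: z)
  case 0
  thus ?case using Digamma_reflection[of z] by simp
next
  case (Suc n)
  have np: "z \<notin> \<int>\<^sub>\<le>\<^sub>0" "1 - z \<notin> \<int>\<^sub>\<le>\<^sub>0"
    using Suc.prems nonpos_Ints_Int Ints_diff[of 1 "1 - z"] by auto
  have "((\<lambda>z. Polygamma n z - (-1) ^ n * Polygamma n (1 - z)) has_field_derivative
      (Polygamma (Suc n) z - (-1) ^ Suc n * Polygamma (Suc n) (1 - z))) (at z)"
    by (rule derivative_eq_intros DERIV_chain2[OF has_field_derivative_Polygamma] refl | use np in simp)+
  moreover have "((\<lambda>z. (2 * of_real pi * \<i>) ^ Suc n * lip n (cis_2pi z) + (if n = 0 then of_real pi * \<i> else 0))
      has_field_derivative ((2 * of_real pi * \<i>) ^ Suc (Suc n) * lip (Suc n) (cis_2pi z))) (at z)"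
    using Suc.prems cis_2pi_eq_1_iff[of z]
    by (auto intro!: derivative_eq_intros DERIV_chain2[OF lip_deriv])
  hence "((\<lambda>z. Polygamma n z - (-1) ^ n * Polygamma n (1 - z)) 
      has_field_derivative ((2 * of_real pi * \<i>) ^ Suc (Suc n) * lip (Suc n) (cis_2pi z))) (at z)"
    by (rule has_field_derivative_transform_within_open[where S = "- \<int>"])
       (use Suc.prems Suc.IH in \<open>auto simp: closed_Ints open_Compl\<close>)
  ultimately show ?case using DERIV_unique by fastforce
qed

lemma summable_inverse_shift_power:
  fixes z :: complex
  assumes "m \<ge> 2"
  shows "summable (\<lambda>k. norm (inverse ((z + of_nat k) ^ m)))"
proof (rule summable_comparison_test_ev)
  show "summable (\<lambda>k. 2 ^ m * inverse (real k ^ m))"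
    using inverse_power_summable[OF assms] by (intro summable_mult) 
  show "\<forall>\<^sub>F k in sequentially. norm (norm (inverse ((z + of_nat k) ^ m))) \<le> 2 ^ m * inverse (real k ^ m)"
    using eventually_ge_at_top[of "nat \<lceil>2 * norm z\<rceil> + 1"]
  proof eventually_elim
    case (elim k)
    have k: "real k > 0" "real k \<ge> 2 * norm z" using elim by linarith+
    have "real k - norm z \<le> norm (z + of_nat k)" 
      using norm_diff_ineq[of "of_nat k" z] by (simp add: add.commute)
    hence "real k / 2 \<le> norm (z + of_nat k)" using k by linarith
    hence "(real k / 2) ^ m \<le> norm (z + of_nat k) ^ m" by (rule power_mono) simp
    hence "inverse (norm (z + of_nat k) ^ m) \<le> inverse ((real k / 2) ^ m)"
      by (rule le_imp_inverse_le) (intro zero_less_power, use k(1) in linarith)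
    also have "inverse ((real k / 2) ^ m) = 2 ^ m * inverse (real k ^ m)"
      by (simp add: power_divide) (simp add: divide_inverse)
    finally show ?case by (simp add: norm_inverse norm_power)
  qed
qed

text \<open>The terms with \<open>k \<ge> 0\<close> add up to a Polygamma value at \<open>z\<close>,
  those with \<open>k < 0\<close> to one at \<open>1 - z\<close>, and the reflection formula joins
  the two.\<close>

theorem lipschitz_formula:
  assumes z: "z \<notin> \<int>" and n: "n \<ge> 1"
  shows "((\<lambda>k::int. inverse ((z + of_int k) ^ Suc n)) has_sum
     ((- 2 * of_real pi * \<i>) ^ Suc n / fact n * lip n (cis_2pi z))) UNIV"
proof -
  let ?f = "\<lambda>k::int. inverse ((z + of_int k) ^ Suc n)"
  have z0: "z \<noteq> 0" "1 - z \<noteq> 0" using z Ints_0 Ints_1 by (metis, metis right_minus_eq)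
  have P: "((\<lambda>k. inverse ((y + of_nat k) ^ Suc n)) has_sum ((-1) ^ Suc n * Polygamma n y / fact n)) UNIV"
    if "y \<noteq> 0" for y :: complex
    by (rule norm_summable_imp_has_sum[OF summable_inverse_shift_power Polygamma_LIMSEQ[OF that]])
       (use n in linarith)+
  have 1: "((\<lambda>k. ?f (int k)) has_sum ((-1) ^ Suc n * Polygamma n z / fact n)) UNIV"
    using P[OF z0(1)] by (simp only: of_int_of_nat_eq)
  have eq: "?f (- int k - 1) = (-1) ^ Suc n * inverse ((1 - z + of_nat k) ^ Suc n)" for k
  proof -
    have "z + of_int (- int k - 1) = - (1 - z + of_nat k)" by simp
    hence "(z + of_int (- int k - 1)) ^ Suc n = (-1) ^ Suc n * (1 - z + of_nat k) ^ Suc n"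
      by (metis power_minus)
    thus ?thesis by (simp add: inverse_mult_distrib flip: power_inverse)
  qed
  have 2: "((\<lambda>k. ?f (- int k - 1)) has_sum ((-1) ^ Suc n * ((-1) ^ Suc n * Polygamma n (1 - z) / fact n))) UNIV"
    unfolding eq by (intro has_sum_cmult_right P z0)
  have inj: "inj (\<lambda>k. - int k - 1)" by (simp add: inj_on_def)
  have "(?f has_sum ((-1) ^ Suc n * Polygamma n z / fact n)) (range int)"
    using 1 by (subst has_sum_reindex) (simp_all only: o_def inj_on_of_nat)
  moreover have "(?f has_sum ((-1) ^ Suc n * ((-1) ^ Suc n * Polygamma n (1 - z) / fact n))) (range (\<lambda>k. - int k - 1))"
    using 2 has_sum_reindex[OF inj, of ?f] by (simp only: o_def)
  moreover have "range int \<inter> range (\<lambda>k. - int k - 1) = {}" by auto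
  moreover have "range int \<union> range (\<lambda>k. - int k - 1) = UNIV"
  proof safe
    fix x :: int assume "x \<notin> range (\<lambda>k. - int k - 1)"
    moreover have "x = - int (nat (- x - 1)) - 1" if "x < 0" using that by simp
    ultimately have "x \<ge> 0" by (metis not_le rangeI)
    thus "x \<in> range int" by (metis int_nat_eq rangeI)
  qed auto
  ultimately have "(?f has_sum ((-1) ^ Suc n * Polygamma n z / fact n + 
      (-1) ^ Suc n * ((-1) ^ Suc n * Polygamma n (1 - z) / fact n))) UNIV"
    using has_sum_Un_disjoint by metis
  also have "(-1) ^ Suc n * Polygamma n z / fact n + (-1) ^ Suc n * ((-1) ^ Suc n * Polygamma n (1 - z) / fact n)
     = (-1) ^ Suc n * (Polygamma n z - (-1) ^ n * Polygamma n (1 - z)) / fact n"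
    by (simp add: field_simps)
  also have "\<dots> = (-1) ^ Suc n * (2 * of_real pi * \<i>) ^ Suc n / fact n * lip n (cis_2pi z)"
    using Polygamma_reflection[OF z, of n] n by simp
  also have "(-1) ^ Suc n * (2 * of_real pi * \<i>) ^ Suc n = (- 2 * of_real pi * \<i>) ^ Suc n"
    by (simp flip: power_mult_distrib)
  finally show ?thesis .
qed

section \<open>Eisenstein series\<close>

lemma summable_on_int_powr:
  "(\<lambda>k::int. (1 + \<bar>real_of_int k\<bar>) powr (-3/2)) summable_on UNIV"
proof -
  let ?f = "\<lambda>k::int. (1 + \<bar>real_of_int k\<bar>) powr (-3/2)"
  have "summable (\<lambda>n. real n powr (-3/2))" by (subst summable_real_powr_iff) simp
  hence "summable (\<lambda>n. real (Suc n) powr (-3/2))" by (subst summable_Suc_iff)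
  hence s: "(\<lambda>n. (1 + real n) powr (-3/2)) summable_on UNIV"
    by (intro norm_summable_imp_summable_on) (simp add: add.commute)
  have "?f summable_on (range int)"
    using s by (subst summable_on_reindex) (auto simp: o_def)
  moreover have "?f summable_on (range (\<lambda>n. - int n))"
    using s by (subst summable_on_reindex) (auto simp: o_def inj_on_def)
  ultimately have "?f summable_on (range int \<union> range (\<lambda>n. - int n))" by (rule summable_on_union)
  also have "range int \<union> range (\<lambda>n. - int n) = UNIV"
  proof safe
    fix x :: int assume "x \<notin> range (\<lambda>n. - int n)"
    moreover have "x = - int (nat (- x))" if "x < 0" using that by simp
    ultimately have "x \<ge> 0" by (metis not_le rangeI)
    thus "x \<in> range int" by (metis int_nat_eq rangeI)
  qed auto
  finally show ?thesis .
qed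

lemma summable_on_times_nonneg:
  fixes p :: "'a \<Rightarrow> real" and q :: "'b \<Rightarrow> real"
  assumes "p summable_on A" "q summable_on B" "\<And>x. x \<in> A \<Longrightarrow> p x \<ge> 0" "\<And>y. y \<in> B \<Longrightarrow> q y \<ge> 0"
  shows "(\<lambda>(x, y). p x * q y) summable_on A \<times> B"
proof (rule summable_on_SigmaI)
  fix x assume "x \<in> A"
  show "((\<lambda>y. case (x, y) of (x, y) \<Rightarrow> p x * q y) has_sum (p x * infsum q B)) B"
    using assms(2) by (simp add: has_sum_cmult_right)
next
  show "(\<lambda>x. p x * infsum q B) summable_on A"
    using assms(1) by (rule summable_on_cmult_left)
qed (use assms in auto)

text \<open>Away from the origin, \<open>norm (m * \<tau> + n) ^ 2\<close> dominates
  \<open>(1 + abs m) * (1 + abs n)\<close> up to a constant. In weight 3 and above the terms are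
  thus bounded by products of two one-variable terms of exponent \<open>3 / 2\<close>.\<close>

lemma abs_summable_lattice:
  assumes t: "\<tau> \<in> upper_half_plane" and w: "w \<ge> 3"
  shows "(\<lambda>mn::int \<times> int. norm (case mn of (m, n) \<Rightarrow> inverse ((of_int m * \<tau> + of_int n) ^ w))) summable_on UNIV"
proof -
  have "Im \<tau> > 0" using t by (simp add: upper_half_plane_def)
  then obtain K where K: "K > 0"
    "\<And>c d :: int. real_of_int c ^ 2 + real_of_int d ^ 2 \<le> K * norm (of_int c * \<tau> + of_int d) ^ 2"
    using linear_form_lower_bound by blast
  \<comment> \<open>The maximum with 1 ensures \<open>M \<le> M ^ 2\<close>, which turns the bound
    into the square of \<open>M * N\<close>.\<close>
  define M where "M = max (3 * K) 1"
  define p :: "int \<Rightarrow> real" where "p = (\<lambda>k. (1 + \<bar>real_of_int k\<bar>) powr (-3/2))"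
  have pos: "p k \<ge> 0" for k by (simp add: p_def)
  have "(\<lambda>(m, n). p m * p n) summable_on (UNIV \<times> UNIV)"
    using summable_on_int_powr[folded p_def] pos by (intro summable_on_times_nonneg) auto
  hence s: "(\<lambda>mn. M ^ w * (case mn of (m, n) \<Rightarrow> p m * p n)) summable_on UNIV"
    by (intro summable_on_cmult_right) simp
  show ?thesis
  proof (rule Infinite_Sum.abs_summable_on_comparison_test'[OF s])
    fix mn :: "int \<times> int"
    obtain m n where mn: "mn = (m, n)" by force
    have "norm (inverse ((of_int m * \<tau> + of_int n) ^ w)) \<le> M ^ w * (p m * p n)"
    proof (cases "(m, n) = (0, 0)")
      case True
      thus ?thesis using w pos by (auto simp: power_0_left M_def)
    next
      case False
      define x y where "x = 1 + \<bar>real_of_int m\<bar>" "y = 1 + \<bar>real_of_int n\<bar>"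
      define N where "N = norm (of_int m * \<tau> + of_int n)"
      have xy: "x \<ge> 1" "y \<ge> 1" by (auto simp: x_y_def)
      have mn: "real_of_int m ^ 2 + real_of_int n ^ 2 \<ge> 1"
      proof -
        have "m ^ 2 + n ^ 2 > 0" using False by (auto simp: sum_power2_gt_zero_iff)
        hence "m ^ 2 + n ^ 2 \<ge> 1" by linarith
        hence "real_of_int (m ^ 2 + n ^ 2) \<ge> 1" by linarith
        thus ?thesis by simp
      qed
      have "2 * (x * y) \<le> x ^ 2 + y ^ 2" using zero_le_power2[of "x - y"] 
        by (simp add: power2_eq_square algebra_simps)
      moreover have "x ^ 2 \<le> 2 + 2 * real_of_int m ^ 2" "y ^ 2 \<le> 2 + 2 * real_of_int n ^ 2"
        using zero_le_power2[of "\<bar>real_of_int m\<bar> - 1"] zero_le_power2[of "\<bar>real_of_int n\<bar> - 1"]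
        by (simp_all add: x_y_def power2_eq_square algebra_simps)
      ultimately have "x * y \<le> 3 * (real_of_int m ^ 2 + real_of_int n ^ 2)" using mn by argo
      also have "\<dots> \<le> 3 * K * N ^ 2" using K(2)[of m n] by (simp add: N_def)
      also have "\<dots> \<le> M * N ^ 2" by (intro mult_right_mono) (auto simp: M_def)
      also have "\<dots> \<le> M ^ 2 * N ^ 2" using mult_left_mono[of 1 M M]
        by (intro mult_right_mono) (simp_all add: M_def power2_eq_square)
      finally have "x * y \<le> (M * N) ^ 2" by (simp add: power_mult_distrib)
      hence "sqrt (x * y) \<le> M * N" by (intro real_le_lsqrt) (auto simp: N_def M_def)
      hence le: "sqrt (x * y) ^ w \<le> (M * N) ^ w" using xy by (intro power_mono) auto
      have xy1: "x * y \<ge> 1" using xy mult_mono[of 1 x 1 y] by simp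
      have "sqrt (x * y) ^ 3 \<le> sqrt (x * y) ^ w" using xy1 w by (intro power_increasing) auto
      with le have "sqrt (x * y) ^ 3 \<le> (M * N) ^ w" by linarith
      also have "sqrt (x * y) ^ 3 = (x * y) powr (3/2)"
      proof -
        have "sqrt (x * y) ^ 3 = sqrt (x * y) powr real 3" using xy1 by (subst powr_realpow) auto
        also have "\<dots> = ((x * y) powr (1/2)) powr real 3" using xy1 by (subst powr_half_sqrt) auto
        finally show ?thesis by (simp add: powr_powr)
      qed
      finally have "inverse ((M * N) ^ w) \<le> inverse ((x * y) powr (3/2))"
        by (intro le_imp_inverse_le) (use xy in auto)
      also have "\<dots> = p m * p n" using xy
        by (simp add: p_def powr_mult powr_minus flip: x_y_def)
      finally have "M ^ w * inverse ((M * N) ^ w) \<le> M ^ w * (p m * p n)"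
        by (intro mult_left_mono) (auto simp: M_def)
      moreover have "M > 0" by (simp add: M_def)
      hence "M ^ w * inverse ((M * N) ^ w) = inverse (N ^ w)" by (simp add: power_mult_distrib)
      ultimately have "inverse (N ^ w) \<le> M ^ w * (p m * p n)" by simp
      thus ?thesis by (simp add: N_def norm_inverse norm_power)
    qed
    thus "norm (case mn of (m, n) \<Rightarrow> inverse ((of_int m * \<tau> + of_int n) ^ w)) \<le>
      M ^ w * (case mn of (m, n) \<Rightarrow> p m * p n)" by (simp add: mn)
  qed
qed

definition lattice_coset :: "nat \<Rightarrow> int \<times> int \<Rightarrow> (int \<times> int) set" where
  "lattice_coset Q u = {m. [m = fst u] (mod int Q)} \<times> {n. [n = snd u] (mod int Q)}"

text \<open>The normalising factor makes the Fourier coefficients cyclotomic. A possible lattice point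
  \<open>(0, 0)\<close> contributes \<open>inverse 0 = 0\<close>.\<close>

definition eis :: "nat \<Rightarrow> nat \<Rightarrow> int \<times> int \<Rightarrow> complex \<Rightarrow> complex" where
  "eis w Q u \<tau> = of_nat Q ^ w * fact (w - 1) / (- 2 * of_real pi * \<i>) ^ w *
     (\<Sum>\<^sub>\<infinity>(m, n)\<in>lattice_coset Q u. inverse ((of_int m * \<tau> + of_int n) ^ w))"

definition row_mult :: "int \<times> int \<Rightarrow> int ^ 2 ^ 2 \<Rightarrow> int \<times> int" where
  "row_mult u g = (fst u * g $ 1 $ 1 + snd u * g $ 2 $ 1, fst u * g $ 1 $ 2 + snd u * g $ 2 $ 2)"

lemma row_mult_mult: "row_mult (row_mult u g) h = row_mult u (g ** h)"
  by (simp add: row_mult_def matrix_mult_nth2 algebra_simps)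

lemma row_mult_one [simp]: "row_mult u (mat 1) = u"
  by (simp add: row_mult_def mat_def)

lemma SL2_inv_right: "g \<in> SL2Z \<Longrightarrow> g ** SL2_inv g = mat 1"
  by (simp add: vec_eq_iff forall_2 matrix_mult_nth2 SL2_inv_def SL2Z_iff mat_def algebra_simps)

lemma row_mult_lattice_coset:
  assumes "v \<in> lattice_coset Q u"
  shows "row_mult v g \<in> lattice_coset Q (row_mult u g)"
  using assms by (auto simp: lattice_coset_def row_mult_def intro!: cong_add cong_mult)

text \<open>Multiplying by \<open>jac g \<tau>\<close> carries the lattice point of row
  \<open>v\<close> at \<open>mob g \<tau>\<close> to that of row \<open>v g\<close> at \<tau>, and
  \<open>v \<mapsto> v g\<close> is a bijection between the two cosets of rows.\<close>

lemma eis_slash: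
  assumes g: "g \<in> SL2Z" and t: "\<tau> \<in> upper_half_plane"
  shows "slash w (eis w Q u) g \<tau> = eis w Q (row_mult u g) \<tau>"
proof -
  have j: "jac g \<tau> \<noteq> 0" using jac_nonzero g t by blast
  define h where "h = (\<lambda>\<tau> (m, n). inverse ((of_int m * \<tau> + of_int n :: complex) ^ w))"
  have eq: "inverse (jac g \<tau> ^ w) * h (mob g \<tau>) v = h \<tau> (row_mult v g)" for v
  proof -
    have "jac g \<tau> * (of_int (fst v) * mob g \<tau> + of_int (snd v)) =
       of_int (fst v) * (jac g \<tau> * mob g \<tau>) + of_int (snd v) * jac g \<tau>" by (simp add: algebra_simps)
    also have "jac g \<tau> * mob g \<tau> = of_int (g $ 1 $ 1) * \<tau> + of_int (g $ 1 $ 2)"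
      using j by (simp add: mob_def)
    finally have "jac g \<tau> * (of_int (fst v) * mob g \<tau> + of_int (snd v)) =
       of_int (fst (row_mult v g)) * \<tau> + of_int (snd (row_mult v g))"
      by (simp add: row_mult_def jac_def algebra_simps)
    thus ?thesis by (simp add: h_def case_prod_unfold flip: power_mult_distrib inverse_mult_distrib)
  qed
  have bij: "bij_betw (\<lambda>v. row_mult v g) (lattice_coset Q u) (lattice_coset Q (row_mult u g))"
    by (rule bij_betw_byWitness[where f' = "\<lambda>v. row_mult v (SL2_inv g)"])
       (use row_mult_lattice_coset[of _ Q u g] row_mult_lattice_coset[of _ Q "row_mult u g" "SL2_inv g"]
         in \<open>auto simp: row_mult_mult SL2_inv_left[OF g] SL2_inv_right[OF g]\<close>)
  have "inverse (jac g \<tau> ^ w) * (\<Sum>\<^sub>\<infinity>v\<in>lattice_coset Q u. h (mob g \<tau>) v) =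
     (\<Sum>\<^sub>\<infinity>v\<in>lattice_coset Q u. h \<tau> (row_mult v g))"
    unfolding eq[symmetric] by (rule infsum_cmult_right'[symmetric])
  also have "\<dots> = (\<Sum>\<^sub>\<infinity>v\<in>lattice_coset Q (row_mult u g). h \<tau> v)"
    by (rule infsum_reindex_bij_betw[OF bij])
  finally show ?thesis unfolding slash_eq eis_def h_def by simp
qed

section \<open>Fourier expansions of the Eisenstein series\<close>

lemma summable_power_times_power:
  fixes x :: real
  assumes "0 \<le> x" "x < 1"
  shows "(\<lambda>r. real r ^ p * x ^ r) summable_on {1..}"
proof -
  have "summable (\<lambda>r. complex_of_real (real (Suc r) ^ p * x ^ Suc r))"
    using sums_summable[OF lip_sums[of "of_real x" p]] assms by simp
  hence "summable (\<lambda>r. real (Suc r) ^ p * x ^ Suc r)" by (simp only: summable_complex_of_real)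
  hence "(\<lambda>r. real (Suc r) ^ p * x ^ Suc r) summable_on UNIV"
    using assms by (intro norm_summable_imp_summable_on) simp
  hence "(\<lambda>r. real r ^ p * x ^ r) summable_on (range Suc)"
    by (subst summable_on_reindex) (auto simp: o_def)
  moreover have "range Suc = {1..}" by (auto simp: image_iff) (metis Suc_le_D)
  ultimately show ?thesis by simp
qed

lemma has_sum_from_1:
  fixes f :: "nat \<Rightarrow> 'a :: banach"
  assumes "f summable_on {1..}" "(\<lambda>n. f (Suc n)) sums S"
  shows "(f has_sum S) {1..}"
proof -
  have r: "range Suc = {1..}" by (auto simp: image_iff) (metis Suc_le_D)
  have "(f has_sum infsum f {1..}) {1..}" using assms by simp
  hence h: "((\<lambda>n. f (Suc n)) has_sum infsum f {1..}) UNIV"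
    unfolding r[symmetric] by (subst (asm) has_sum_reindex) (auto simp: o_def)
  hence "S = infsum f {1..}" using assms(2) has_sum_imp_sums sums_unique2 by blast
  thus ?thesis using assms by simp
qed

text \<open>One absolutely convergent double series in \<open>r ^ p * y ^ r * q ^ (m * r)\<close>,
  summed in two ways: over \<open>r\<close> first it gives values of \<open>lip\<close>, along
  \<open>n = m * r\<close> a power series in \<open>q\<close>. In use, \<open>P\<close> is a
  congruence condition on \<open>m\<close>.\<close>

lemma Lambert_series:
  fixes q y :: complex and P :: "nat \<Rightarrow> bool" and p :: nat
  assumes q: "norm q < 1" and y: "norm y = 1"
  defines "T \<equiv> (\<lambda>n. if n = 0 then 0 else \<Sum>r | r dvd n. if P (n div r) then of_nat r ^ p * y ^ r else 0)"
  obtains S where "((\<lambda>m. if P m then lip p (y * q ^ m) else 0) has_sum S) {1..}" "(\<lambda>n. T n * q ^ n) sums S"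
proof -
  define f where "f = (\<lambda>m r. if P m then of_nat r ^ p * y ^ r * q ^ (m * r) else 0 :: complex)"
  have lim: "(f m has_sum (if P m then lip p (y * q ^ m) else 0)) {1..}" if m: "m \<ge> 1" for m
  proof (cases "P m")
    case True
    have n1: "norm (y * q ^ m) < 1" using q y m by (simp add: norm_mult norm_power power_less_one_iff)
    have eq: "f m r = of_nat r ^ p * (y * q ^ m) ^ r" for r using True
      by (simp add: f_def power_mult_distrib flip: power_mult)
    have "(\<lambda>r. norm (of_nat r ^ p * (y * q ^ m) ^ r)) summable_on {1..}"
      using summable_power_times_power[of "norm (y * q ^ m)" p] n1 by (simp add: norm_mult norm_power)
    hence "(\<lambda>r. of_nat r ^ p * (y * q ^ m) ^ r) summable_on {1..}" by (rule Infinite_Sum.abs_summable_summable)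
    hence "((\<lambda>r. of_nat r ^ p * (y * q ^ m) ^ r) has_sum lip p (y * q ^ m)) {1..}"
      by (rule has_sum_from_1) (rule lip_sums[OF n1])
    moreover have "f m = (\<lambda>r. of_nat r ^ p * (y * q ^ m) ^ r)" using eq by blast
    ultimately show ?thesis using True by simp
  next
    case False
    thus ?thesis by (simp add: f_def)
  qed
  have fs: "(\<lambda>(m, r). f m r) summable_on {1..} \<times> {1..}"
  proof (cases "q = 0")
    case True
    have "(\<lambda>(m, r). f m r) summable_on {1..} \<times> {1..} \<longleftrightarrow> (\<lambda>_. 0 :: complex) summable_on ({1..} \<times> {1..} :: (nat \<times> nat) set)"
      by (rule summable_on_cong) (use True in \<open>auto simp: f_def power_0_left\<close>)
    thus ?thesis by simp
  next
    case False
    have "(\<lambda>(m, r). norm q ^ m * (real r ^ p * norm q ^ r)) summable_on {1..} \<times> {1..}"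
      using summable_power_times_power[of "norm q" 0] summable_power_times_power[of "norm q" p] q
      by (intro summable_on_times_nonneg) auto
    hence s: "(\<lambda>mr. inverse (norm q) * (case mr of (m, r) \<Rightarrow> norm q ^ m * (real r ^ p * norm q ^ r))) summable_on {1..} \<times> {1..}"
      by (rule summable_on_cmult_right)
    have "(\<lambda>mr. norm (case mr of (m, r) \<Rightarrow> f m r)) summable_on {1..} \<times> {1..}"
    proof (rule Infinite_Sum.abs_summable_on_comparison_test'[OF s])
      fix mr :: "nat \<times> nat" assume "mr \<in> {1..} \<times> {1..}"
      then obtain m r where mr: "mr = (m, r)" "m \<ge> 1" "r \<ge> 1" by auto
      obtain m' r' where mr': "m = Suc m'" "r = Suc r'" using mr by (metis Suc_le_D One_nat_def)
      \<comment> \<open>That is \<open>(m - 1) * (r - 1) \<ge> 0\<close>. It dominates the double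
        series by a product of two single ones, at the cost of one factor
        \<open>inverse (norm q)\<close>.\<close>
      have "m + r \<le> Suc (m * r)" by (simp add: mr')
      hence "norm q ^ Suc (m * r) \<le> norm q ^ (m + r)" using q by (intro power_decreasing) auto
      hence "norm q ^ (m * r) \<le> inverse (norm q) * (norm q ^ m * norm q ^ r)"
        using False by (simp add: field_simps power_add)
      hence "real r ^ p * norm q ^ (m * r) \<le> real r ^ p * (inverse (norm q) * (norm q ^ m * norm q ^ r))"
        by (intro mult_left_mono) auto
      thus "norm (case mr of (m, r) \<Rightarrow> f m r) \<le>
          inverse (norm q) * (case mr of (m, r) \<Rightarrow> norm q ^ m * (real r ^ p * norm q ^ r))"
        using y by (simp add: mr f_def norm_mult norm_power mult_ac)
    qed
    thus ?thesis by (rule Infinite_Sum.abs_summable_summable)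
  qed
  define S where "S = infsum (\<lambda>(m, r). f m r) ({1..} \<times> {1..})"
  have S: "((\<lambda>(m, r). f m r) has_sum S) ({1..} \<times> {1..})" using fs by (simp add: S_def)
  have 1: "((\<lambda>m. if P m then lip p (y * q ^ m) else 0) has_sum S) {1..}"
    using has_sum_SigmaD[OF S, of "\<lambda>m. if P m then lip p (y * q ^ m) else 0"] lim by auto
  have "((\<lambda>(n, r). f (n div r) r) has_sum S) (Sigma {1..} (\<lambda>n. {r. r dvd n}))"
  proof -
    have "bij_betw (\<lambda>(n :: nat, r). (n div r, r)) (Sigma {1..} (\<lambda>n. {r. r dvd n})) ({1..} \<times> {1..})"
    proof (rule bij_betw_byWitness[where f' = "\<lambda>(m, r). (m * r, r)"])
      show "(\<lambda>(n :: nat, r). (n div r, r)) ` Sigma {1..} (\<lambda>n. {r. r dvd n}) \<subseteq> {1..} \<times> {1..}"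
        by (auto elim!: dvdE simp: Suc_le_eq)
    qed (auto simp: Suc_le_eq)
    from has_sum_reindex_bij_betw[OF this, of "\<lambda>(m, r). f m r"] S show ?thesis
      by (simp add: case_prod_unfold)
  qed
  moreover have "((\<lambda>r. case (n, r) of (n, r) \<Rightarrow> f (n div r) r) has_sum (T n * q ^ n)) {r. r dvd n}"
    if "n \<in> {1..}" for n
  proof -
    have fin: "finite {r. r dvd n}" using that by (intro finite_divisors_nat) auto
    have "(\<Sum>r | r dvd n. f (n div r) r) = T n * q ^ n"
      unfolding T_def f_def sum_distrib_right using that by (auto intro!: sum.cong simp: sum_distrib_right)
    thus ?thesis using has_sum_finite[OF fin, of "\<lambda>r. f (n div r) r"] by simp
  qed
  ultimately have "((\<lambda>n. T n * q ^ n) has_sum S) {1..}" by (rule has_sum_SigmaD)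
  moreover have "((\<lambda>n. T n * q ^ n) has_sum S) {1..} \<longleftrightarrow> ((\<lambda>n. T n * q ^ n) has_sum S) UNIV"
    by (rule has_sum_cong_neutral) (auto simp: T_def not_le)
  ultimately have "((\<lambda>n. T n * q ^ n) has_sum S) UNIV" by blast
  hence "(\<lambda>n. T n * q ^ n) sums S" by (rule has_sum_imp_sums)
  with 1 show ?thesis by (rule that)
qed


text \<open>Lipschitz' formula at \<open>- z\<close> has, after negation of the summation index, the
  terms of the formula at \<open>z\<close> up to the sign.\<close>

lemma lip_inverse:
  assumes z: "z \<notin> \<int>" and n: "n \<ge> 1"
  shows "lip n (inverse (cis_2pi z)) = (-1) ^ Suc n * lip n (cis_2pi z)"
proof -
  have z': "- z \<notin> \<int>" using z minus_in_Ints_iff by blast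
  define c where "c = (- 2 * of_real pi * \<i>) ^ Suc n / fact n"
  have c: "c \<noteq> 0" by (simp add: c_def)
  have eq: "inverse ((- z + of_int (- k)) ^ Suc n) = (-1) ^ Suc n * inverse ((z + of_int k) ^ Suc n)" for k :: int
  proof -
    have "- z + of_int (- k) = - (z + of_int k)" by simp
    hence "(- z + of_int (- k)) ^ Suc n = (-1) ^ Suc n * (z + of_int k) ^ Suc n" by (metis power_minus)
    thus ?thesis by (simp add: inverse_mult_distrib flip: power_inverse)
  qed
  have "((\<lambda>k::int. inverse ((- z + of_int k) ^ Suc n)) has_sum (c * lip n (cis_2pi (- z)))) UNIV"
    using lipschitz_formula[OF z' n] by (simp add: c_def)
  moreover have "bij_betw (uminus :: int \<Rightarrow> int) UNIV UNIV"
    by (rule bij_betw_byWitness[where f' = uminus]) auto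
  ultimately have "((\<lambda>k::int. inverse ((- z + of_int (- k)) ^ Suc n)) has_sum (c * lip n (cis_2pi (- z)))) UNIV"
    using has_sum_reindex_bij_betw[of uminus UNIV UNIV "\<lambda>k::int. inverse ((- z + of_int k) ^ Suc n)"] by blast
  hence "((\<lambda>k::int. (-1) ^ Suc n * inverse ((z + of_int k) ^ Suc n)) has_sum (c * lip n (cis_2pi (- z)))) UNIV"
    by (simp only: eq)
  moreover have "((\<lambda>k::int. (-1) ^ Suc n * inverse ((z + of_int k) ^ Suc n)) has_sum
      ((-1) ^ Suc n * (c * lip n (cis_2pi z)))) UNIV"
    using lipschitz_formula[OF z n] by (intro has_sum_cmult_right) (simp add: c_def)
  ultimately have "c * lip n (cis_2pi (- z)) = (-1) ^ Suc n * (c * lip n (cis_2pi z))"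
    by (rule has_sum_unique)
  hence "c * lip n (cis_2pi (- z)) = c * ((-1) ^ Suc n * lip n (cis_2pi z))" by (simp only: mult_ac)
  hence "lip n (cis_2pi (- z)) = (-1) ^ Suc n * lip n (cis_2pi z)" using c by (simp only: mult_cancel_left) simp
  thus ?thesis by (simp add: exp_minus)
qed

text \<open>Lipschitz' formula applied to each row of the lattice: the row \<open>m = 0\<close>
  yields the constant term, and the rows with \<open>m > 0\<close> and \<open>m < 0\<close> yield
  the two divisor sums.\<close>

definition eis_fps :: "nat \<Rightarrow> nat \<Rightarrow> int \<times> int \<Rightarrow> complex fps" where
  "eis_fps w Q u = Abs_fps (\<lambda>n.
     if n = 0 then (if int Q dvd fst u then lip (w - 1) (zeta Q powi snd u) else 0)
     else (\<Sum>r | r dvd n. if [int (n div r) = fst u] (mod int Q) then of_nat r ^ (w - 1) * (zeta Q powi snd u) ^ r else 0) +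
       (-1) ^ w * (\<Sum>r | r dvd n. if [int (n div r) = - fst u] (mod int Q) then of_nat r ^ (w - 1) * (zeta Q powi - snd u) ^ r else 0))"

lemma norm_zeta [simp]: "norm (zeta Q) = 1"
  by (simp add: zeta_def norm_exp_eq_Re)

lemma lattice_point_not_int:
  assumes t: "\<tau> \<in> upper_half_plane" and Q: "Q > 0" and "m \<noteq> 0 \<or> \<not> int Q dvd b"
  shows "(of_int m * \<tau> + of_int b) / of_nat Q \<notin> \<int>"
proof
  assume "(of_int m * \<tau> + of_int b) / of_nat Q \<in> \<int>"
  then obtain k where k: "(of_int m * \<tau> + of_int b) / of_nat Q = of_int k" by (rule Ints_cases)
  hence e: "of_int m * \<tau> + of_int b = (of_int (k * int Q) :: complex)" using Q by (simp add: field_simps)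
  hence "Im (of_int m * \<tau> + of_int b) = 0" by (simp del: of_int_mult)
  hence "m = 0" using t by (simp add: upper_half_plane_def)
  with e have "b = k * int Q" by (simp del: of_int_mult)
  thus False using assms \<open>m = 0\<close> by simp
qed

lemma inner_lattice_sum:
  assumes t: "\<tau> \<in> upper_half_plane" and Q: "Q > 0" and w: "w \<ge> 3" and mb: "m \<noteq> 0 \<or> \<not> int Q dvd b"
  shows "((\<lambda>n. of_nat Q ^ w * fact (w - 1) / (- 2 * of_real pi * \<i>) ^ w * inverse ((of_int m * \<tau> + of_int n) ^ w))
     has_sum (lip (w - 1) (cis_2pi ((of_int m * \<tau> + of_int b) / of_nat Q)))) {n. [n = b] (mod int Q)}"
proof -
  define z where "z = (of_int m * \<tau> + of_int b) / of_nat Q"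
  define c where "c = (- 2 * of_real pi * \<i>) ^ w"
  have c: "c \<noteq> 0" by (simp add: c_def)
  have z: "z \<notin> \<int>" unfolding z_def by (rule lattice_point_not_int[OF t Q mb])
  have Sw: "Suc (w - 1) = w" "w - 1 \<ge> 1" using w by auto
  have "((\<lambda>k::int. fact (w - 1) / c * inverse ((z + of_int k) ^ w)) has_sum
     (fact (w - 1) / c * (c / fact (w - 1) * lip (w - 1) (cis_2pi z)))) UNIV"
    using lipschitz_formula[OF z Sw(2)] unfolding Sw c_def by (intro has_sum_cmult_right)
  hence "((\<lambda>k::int. fact (w - 1) / c * inverse ((z + of_int k) ^ w)) has_sum (lip (w - 1) (cis_2pi z))) UNIV"
    using c by simp
  also have "(\<lambda>k::int. fact (w - 1) / c * inverse ((z + of_int k) ^ w)) =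
     (\<lambda>k. of_nat Q ^ w * fact (w - 1) / c * inverse ((of_int m * \<tau> + of_int (b + int Q * k)) ^ w))"
  proof
    fix k :: int
    have "of_int m * \<tau> + of_int (b + int Q * k) = of_nat Q * (z + of_int k)"
      using Q by (simp add: z_def field_simps)
    thus "fact (w - 1) / c * inverse ((z + of_int k) ^ w) =
      of_nat Q ^ w * fact (w - 1) / c * inverse ((of_int m * \<tau> + of_int (b + int Q * k)) ^ w)"
      using Q by (simp add: power_mult_distrib)
  qed
  finally have "((\<lambda>k. of_nat Q ^ w * fact (w - 1) / c * inverse ((of_int m * \<tau> + of_int (b + int Q * k)) ^ w))
    has_sum (lip (w - 1) (cis_2pi z))) UNIV" .
  also have "?this \<longleftrightarrow> ((\<lambda>n. of_nat Q ^ w * fact (w - 1) / c * inverse ((of_int m * \<tau> + of_int n) ^ w))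
     has_sum (lip (w - 1) (cis_2pi z))) {n. [n = b] (mod int Q)}"
  proof (rule has_sum_reindex_bij_betw)
    show "bij_betw (\<lambda>k. b + int Q * k) UNIV {n. [n = b] (mod int Q)}"
      by (rule bij_betw_byWitness[where f' = "\<lambda>n. (n - b) div int Q"])
         (use Q in \<open>auto simp: cong_iff_dvd_diff\<close>)
  qed
  finally show ?thesis by (simp add: z_def c_def)
qed

text \<open>The lattice sum is taken row by row. For \<open>m < 0\<close> the argument of
  \<open>lip\<close> lies outside the unit disc, and \<open>lip_inverse\<close> brings it inside at
  the cost of \<open>(-1) ^ w\<close>. The hypothesis on \<open>u\<close> keeps the origin out of
  the coset, so that Lipschitz' formula also applies to the row \<open>m = 0\<close>.\<close>

lemma fexp_eis:
  assumes Q: "Q > 0" and w: "w \<ge> 3" and u: "\<not> (int Q dvd fst u \<and> int Q dvd snd u)"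
  shows "fexp Q (eis w Q u) (eis_fps w Q u)"
  unfolding fexp_iff
proof safe
  fix \<tau> assume t: "\<tau> \<in> upper_half_plane"
  obtain a b where ab: "u = (a, b)" by force
  define q where "q = qpar Q \<tau>"
  define y y' where "y = zeta Q powi b" "y' = zeta Q powi (- b)"
  define p where "p = w - 1"
  define c where "c = (of_nat Q ^ w * fact (w - 1) / (- 2 * of_real pi * \<i>) ^ w :: complex)"
  have p: "Suc p = w" "p \<ge> 1" using w by (auto simp: p_def)
  have q: "norm q < 1" using norm_qpar_less_1[OF Q t] by (simp add: q_def)
  have y: "norm y = 1" "norm y' = 1" by (simp_all add: y_y'_def norm_power_int)
  have cis: "cis_2pi ((of_int m * \<tau> + of_int b) / of_nat Q) = y * q powi m" for m
    by (simp add: y_y'_def q_def qpar_def zeta_def exp_power_int ring_distribs add_divide_distrib mult_ac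
         flip: exp_add) (simp add: add.commute)
  let ?h = "\<lambda>mn::int \<times> int. c * (case mn of (m, n) \<Rightarrow> inverse ((of_int m * \<tau> + of_int n) ^ w))"
  have "(\<lambda>mn::int \<times> int. case mn of (m, n) \<Rightarrow> inverse ((of_int m * \<tau> + of_int n) ^ w)) summable_on lattice_coset Q u"
    using Infinite_Sum.abs_summable_summable[OF abs_summable_lattice[OF t w]] summable_on_subset_banach by blast
  hence tot: "(?h has_sum eis w Q u \<tau>) (lattice_coset Q u)"
    unfolding eis_def c_def by (intro has_sum_cmult_right has_sum_infsum) 
  have tot': "((\<lambda>m. lip p (y * q powi m)) has_sum eis w Q u \<tau>) {m. [m = a] (mod int Q)}"
  proof (rule has_sum_SigmaD)
    show "(?h has_sum eis w Q u \<tau>) (Sigma {m. [m = a] (mod int Q)} (\<lambda>_. {n. [n = b] (mod int Q)}))"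
      using tot by (simp add: lattice_coset_def ab)
    fix m assume "m \<in> {m. [m = a] (mod int Q)}"
    hence "m \<noteq> 0 \<or> \<not> int Q dvd b" using u by (auto simp: ab) (metis cong_0_iff cong_sym)
    from inner_lattice_sum[OF t Q w this]
    show "((\<lambda>n. ?h (m, n)) has_sum lip p (y * q powi m)) {n. [n = b] (mod int Q)}"
      by (simp only: cis p_def c_def prod.case)
  qed
  define G where "G m = (if [m = a] (mod int Q) then lip p (y * q powi m) else 0)" for m
  have "((\<lambda>m. lip p (y * q powi m)) has_sum eis w Q u \<tau>) {m. [m = a] (mod int Q)} \<longleftrightarrow>
      (G has_sum eis w Q u \<tau>) UNIV"
    by (rule has_sum_cong_neutral) (auto simp: G_def)
  with tot' have G: "(G has_sum eis w Q u \<tau>) UNIV" by blast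
  obtain S1 where S1: "((\<lambda>m. if [int m = a] (mod int Q) then lip p (y * q ^ m) else 0) has_sum S1) {1..}"
    "(\<lambda>n. (if n = 0 then 0 else \<Sum>r | r dvd n. if [int (n div r) = a] (mod int Q) then of_nat r ^ p * y ^ r else 0) * q ^ n) sums S1"
    by (rule Lambert_series[OF q y(1), of "\<lambda>m. [int m = a] (mod int Q)" p])
  obtain S2 where S2: "((\<lambda>m. if [int m = - a] (mod int Q) then lip p (y' * q ^ m) else 0) has_sum S2) {1..}"
    "(\<lambda>n. (if n = 0 then 0 else \<Sum>r | r dvd n. if [int (n div r) = - a] (mod int Q) then of_nat r ^ p * y' ^ r else 0) * q ^ n) sums S2"
    by (rule Lambert_series[OF q y(2), of "\<lambda>m. [int m = - a] (mod int Q)" p])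
  have G1: "(G has_sum S1) (int ` {1..})"
  proof -
    have "((G \<circ> int) has_sum S1) {1..}" using S1(1) by (simp add: o_def G_def cong: if_cong)
    thus ?thesis by (subst has_sum_reindex) auto
  qed
  have G2: "(G has_sum ((-1) ^ w * S2)) ((\<lambda>m. - int m) ` {1..})"
  proof -
    have "(G \<circ> (\<lambda>m. - int m)) m = (-1) ^ w * (if [int m = - a] (mod int Q) then lip p (y' * q ^ m) else 0)"
      if m: "m \<in> {1..}" for m
    proof -
      have "[- int m = a] (mod int Q) \<longleftrightarrow> [int m = - a] (mod int Q)"
        using cong_minus_minus_iff[of "int m" "- a" "int Q"] by simp
      moreover have "lip p (y * q powi (- int m)) = (-1) ^ w * lip p (y' * q ^ m)"
      proof -
        define z where "z = (of_int (int m) * \<tau> + of_int (- b)) / of_nat Q"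
        have "z \<notin> \<int>" unfolding z_def by (rule lattice_point_not_int[OF t Q]) (use m in auto)
        note li = lip_inverse[OF this p(2), unfolded p(1)]
        have "cis_2pi z = y' * q ^ m"
          by (simp add: z_def y_y'_def q_def qpar_def zeta_def exp_power_int ring_distribs diff_divide_distrib mult_ac
              exp_diff exp_minus divide_inverse flip: exp_of_nat_mult)
        moreover have "inverse (y' * q ^ m) = y * q powi (- int m)"
          by (simp add: y_y'_def power_int_minus)
        ultimately show ?thesis using li by simp
      qed
      ultimately show ?thesis by (simp add: G_def)
    qed
    hence "((G \<circ> (\<lambda>m. - int m)) has_sum ((-1) ^ w * S2)) {1..} \<longleftrightarrow>
      ((\<lambda>m. (-1) ^ w * (if [int m = - a] (mod int Q) then lip p (y' * q ^ m) else 0)) has_sum ((-1) ^ w * S2)) {1..}"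
      by (intro has_sum_cong) blast
    moreover have "((\<lambda>m. (-1) ^ w * (if [int m = - a] (mod int Q) then lip p (y' * q ^ m) else 0)) has_sum ((-1) ^ w * S2)) {1..}"
      by (rule has_sum_cmult_right[OF S2(1)])
    ultimately have "((G \<circ> (\<lambda>m. - int m)) has_sum ((-1) ^ w * S2)) {1..}" by blast
    thus ?thesis by (subst has_sum_reindex) (auto simp: inj_on_def)
  qed
  have "(G has_sum (G 0 + S1)) ({0} \<union> int ` {1..})"
    by (rule has_sum_Un_disjoint[OF has_sum_finite[of "{0}", simplified] G1]) auto
  hence "(G has_sum (G 0 + S1 + (-1) ^ w * S2)) (({0} \<union> int ` {1..}) \<union> (\<lambda>m. - int m) ` {1..})"
    by (rule has_sum_Un_disjoint[OF _ G2]) auto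
  also have "({0} \<union> int ` {1..}) \<union> (\<lambda>m. - int m) ` {1..} = UNIV"
  proof -
    have "x \<in> ({0} \<union> int ` {1..}) \<union> (\<lambda>m. - int m) ` {1..}" for x :: int
    proof (cases x "0 :: int" rule: linorder_cases)
      case less
      hence "x = - int (nat (- x))" "nat (- x) \<in> {1..}" by auto
      thus ?thesis by blast
    next
      case greater
      hence "x = int (nat x)" "nat x \<in> {1..}" by auto
      thus ?thesis by blast
    qed auto
    thus ?thesis by blast
  qed
  finally have E: "eis w Q u \<tau> = G 0 + S1 + (-1) ^ w * S2" using G has_sum_unique by blast
  have "(\<lambda>n. if n = 0 then G 0 else 0) sums G 0" using sums_single[of 0 "\<lambda>_. G 0"] by simp
  from sums_add[OF sums_add[OF this S1(2)] sums_mult[OF S2(2), of "(-1) ^ w"]]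
  have "(\<lambda>n. (if n = 0 then G 0 else 0) + (if n = 0 then 0 else \<Sum>r | r dvd n. if [int (n div r) = a] (mod int Q) then of_nat r ^ p * y ^ r else 0) * q ^ n
     + (-1) ^ w * ((if n = 0 then 0 else \<Sum>r | r dvd n. if [int (n div r) = - a] (mod int Q) then of_nat r ^ p * y' ^ r else 0) * q ^ n))
     sums eis w Q u \<tau>" (is "?s sums _") by (simp only: E)
  also have "?s = (\<lambda>n. fps_nth (eis_fps w Q u) n * q ^ n)"
    by (auto simp: fun_eq_iff eis_fps_def ab G_def y_y'_def p_def ring_distribs mult.assoc cong_sym_eq[of 0] cong_0_iff
        cong: if_cong)
  finally show "(\<lambda>n. fps_nth (eis_fps w Q u) n * qpar Q \<tau> ^ n) sums eis w Q u \<tau>" by (simp add: q_def)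
qed

section \<open>Subfields of the complex numbers\<close>

text \<open>A working form of subfields as plain sets; by the convention
  \<open>inverse 0 = 0\<close>, closure under \<open>inverse\<close> needs no exception.\<close>

definition csubfield :: "complex set \<Rightarrow> bool" where
  "csubfield E \<longleftrightarrow> 1 \<in> E \<and> (\<forall>x\<in>E. \<forall>y\<in>E. x - y \<in> E \<and> x * y \<in> E) \<and> (\<forall>x\<in>E. inverse x \<in> E)"

lemma csubfield_UNIV: "csubfield UNIV" by (simp add: csubfield_def)

lemma csubfield_Rats: "csubfield \<rat>" by (simp add: csubfield_def)

context
  fixes E assumes E: "csubfield E"
begin

lemma csubfield_0: "0 \<in> E" and csubfield_1: "1 \<in> E"
  using E unfolding csubfield_def by (metis diff_self)+

lemma csubfield_diff: "x \<in> E \<Longrightarrow> y \<in> E \<Longrightarrow> x - y \<in> E"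
  and csubfield_mult: "x \<in> E \<Longrightarrow> y \<in> E \<Longrightarrow> x * y \<in> E"
  and csubfield_inverse: "x \<in> E \<Longrightarrow> inverse x \<in> E"
  using E by (auto simp: csubfield_def)

lemma csubfield_uminus: "x \<in> E \<Longrightarrow> - x \<in> E"
  using csubfield_diff[OF csubfield_0, of x] by simp

lemma csubfield_add: "x \<in> E \<Longrightarrow> y \<in> E \<Longrightarrow> x + y \<in> E"
  using csubfield_diff[of x "- y"] csubfield_uminus by simp

lemma csubfield_divide: "x \<in> E \<Longrightarrow> y \<in> E \<Longrightarrow> x / y \<in> E"
  by (simp add: divide_inverse csubfield_mult csubfield_inverse)

lemma csubfield_power: "x \<in> E \<Longrightarrow> x ^ n \<in> E"
  by (induction n) (auto intro: csubfield_1 csubfield_mult)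

lemma csubfield_powi: "x \<in> E \<Longrightarrow> x powi n \<in> E"
  by (simp add: power_int_def csubfield_power csubfield_inverse)

lemma csubfield_sum: "(\<And>i. i \<in> I \<Longrightarrow> f i \<in> E) \<Longrightarrow> sum f I \<in> E"
  by (induction I rule: infinite_finite_induct) (auto intro: csubfield_0 csubfield_add)

lemma csubfield_of_nat: "of_nat n \<in> E"
  by (induction n) (auto intro: csubfield_0 csubfield_1 csubfield_add)

lemma csubfield_of_int: "of_int n \<in> E"
  by (cases n) (auto intro!: csubfield_of_nat csubfield_uminus simp del: of_nat_Suc)

lemma csubfield_poly: "(\<And>i. Polynomial.coeff p i \<in> E) \<Longrightarrow> x \<in> E \<Longrightarrow> poly p x \<in> E"
  unfolding poly_altdef by (intro csubfield_sum csubfield_mult csubfield_power)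

end

text \<open>Integrality keeps the values of \<open>lip\<close> in the field of the argument and lets
  embeddings pass through \<open>lip\<close>.\<close>

lemma coeff_eulerian_poly: "Polynomial.coeff (eulerian_poly n) i \<in> \<int>"
proof (induction n arbitrary: i)
  case 0
  show ?case by (auto simp: coeff_pCons split: nat.split)
next
  case (Suc n)
  have "Polynomial.coeff ([:1, -1:] * pderiv (eulerian_poly n) + of_nat (Suc n) * eulerian_poly n) i \<in> \<int>" for i
    using Suc.IH by (auto simp: of_nat_poly coeff_pCons coeff_pderiv simp del: of_nat_Suc split: nat.split
      intro!: Ints_add Ints_diff Ints_mult)
  thus ?case by (auto simp: coeff_pCons simp del: of_nat_Suc split: nat.split)
qed

lemma csubfield_lip:
  assumes "csubfield E" "x \<in> E"
  shows "lip n x \<in> E"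
proof -
  have "Polynomial.coeff (eulerian_poly n) i \<in> E" for i
    using coeff_eulerian_poly[of n i] csubfield_of_int[OF assms(1)] by (auto elim!: Ints_cases)
  thus ?thesis unfolding lip_def
    using assms by (intro csubfield_divide csubfield_power csubfield_diff csubfield_poly csubfield_1)
qed

lemma csubfield_eis_fps:
  assumes E: "csubfield E" and "zeta Q \<in> E"
  shows "fps_nth (eis_fps w Q u) n \<in> E"
  using assms
  by (auto simp: eis_fps_def intro!: csubfield_lip csubfield_add csubfield_mult csubfield_power csubfield_sum
      csubfield_uminus csubfield_powi csubfield_of_nat csubfield_0 csubfield_1)

section \<open>Rows modulo the level\<close>

definition residue_row :: "nat \<Rightarrow> int \<times> int \<Rightarrow> int \<times> int" where
  "residue_row Q u = (fst u mod int Q, snd u mod int Q)"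

text \<open>Bottom rows of unimodular matrices modulo \<open>Q\<close>, reduced to
  \<open>{0..<Q}\<close>: these index the cosets of \<Gamma>1(Q) in the modular group.\<close>

definition unimod_rows :: "nat \<Rightarrow> (int \<times> int) set" where
  "unimod_rows Q = (\<lambda>g. residue_row Q (row_mult (0, 1) g)) ` SL2Z"

lemma residue_row_eq_iff:
  "residue_row Q u = residue_row Q v \<longleftrightarrow> [fst u = fst v] (mod int Q) \<and> [snd u = snd v] (mod int Q)"
  by (simp add: residue_row_def cong_def)

lemma residue_row_mult: "residue_row Q (row_mult (residue_row Q u) g) = residue_row Q (row_mult u g)"
  unfolding residue_row_eq_iff
  by (auto simp: row_mult_def residue_row_def intro!: cong_add cong_mult)

lemma residue_row_idem: "u \<in> unimod_rows Q \<Longrightarrow> residue_row Q u = u"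
  by (auto simp: unimod_rows_def residue_row_def)

lemma unimod_rows_mult:
  assumes "u \<in> unimod_rows Q" "g \<in> SL2Z"
  shows "residue_row Q (row_mult u g) \<in> unimod_rows Q"
  using assms SL2Z_mult by (auto simp: unimod_rows_def residue_row_mult row_mult_mult)

lemma bij_unimod_rows:
  assumes g: "g \<in> SL2Z"
  shows "bij_betw (\<lambda>u. residue_row Q (row_mult u g)) (unimod_rows Q) (unimod_rows Q)"
  by (rule bij_betw_byWitness[where f' = "\<lambda>u. residue_row Q (row_mult u (SL2_inv g))"])
     (use g SL2_inv_in[OF g] in \<open>auto simp: residue_row_mult row_mult_mult SL2_inv_left SL2_inv_right
        residue_row_idem intro: unimod_rows_mult\<close>)

lemma finite_unimod_rows:
  assumes "Q > 0"
  shows "finite (unimod_rows Q)"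
  by (rule finite_subset[of _ "{0..int Q} \<times> {0..int Q}"])
     (use assms in \<open>auto simp: unimod_rows_def residue_row_def less_imp_le\<close>)

lemma eis_residue_row: "eis w Q (residue_row Q u) = eis w Q u"
  by (simp add: eis_def lattice_coset_def residue_row_def cong_def fun_eq_iff)

lemma unimod_rows_not_zero:
  assumes "Q > 1" "u \<in> unimod_rows Q"
  shows "\<not> (int Q dvd fst u \<and> int Q dvd snd u)"
proof
  assume a: "int Q dvd fst u \<and> int Q dvd snd u"
  obtain g where g: "g \<in> SL2Z" "u = (g $ 2 $ 1 mod int Q, g $ 2 $ 2 mod int Q)"
    using assms(2) by (auto simp: unimod_rows_def residue_row_def row_mult_def)
  with a have "int Q dvd g $ 2 $ 1" "int Q dvd g $ 2 $ 2" by (simp_all add: dvd_mod_iff)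
  hence "int Q dvd g $ 1 $ 1 * g $ 2 $ 2 - g $ 1 $ 2 * g $ 2 $ 1" by simp
  thus False using g(1) assms(1) by (simp add: SL2Z_iff)
qed

section \<open>Traces to level one and the level-one Eisenstein series\<close>

lemma unimod_rows_2: "unimod_rows 2 = {(0, 1), (1, 0), (1, 1)}"
proof
  show "unimod_rows 2 \<subseteq> {(0, 1), (1, 0), (1, 1)}"
  proof
    fix u assume u: "u \<in> unimod_rows 2"
    obtain a b where ab: "u = (a, b)" by force
    have "a = a mod 2" "b = b mod 2" using residue_row_idem[OF u] by (simp_all add: ab residue_row_def)
    hence "a \<in> {0, 1}" "b \<in> {0, 1}" by auto
    moreover have "\<not> (a = 0 \<and> b = 0)" using unimod_rows_not_zero[OF _ u] by (auto simp: ab)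
    ultimately show "u \<in> {(0, 1), (1, 0), (1, 1)}" by (auto simp: ab)
  qed
  have "residue_row 2 (row_mult (0, 1) (mat22 a b c d)) \<in> unimod_rows 2" if "a * d - b * c = 1" for a b c d
    using that by (auto simp: unimod_rows_def mat22_SL2Z_iff)
  from this[of 1 1 0 0] this[of 0 0 "-1" 1] this[of 1 1 0 1]
  show "{(0, 1), (1, 0), (1, 1)} \<subseteq> unimod_rows 2" by (simp add: residue_row_def row_mult_def)
qed

text \<open>A trace: right multiplication by \<open>g\<close> only permutes the rows, hence the
  summands.\<close>

lemma level_one_sum_unimod_rows:
  assumes Q: "Q > 0" and F: "\<And>v g \<tau>. v \<in> unimod_rows Q \<Longrightarrow> g \<in> SL2Z \<Longrightarrow> \<tau> \<in> upper_half_plane \<Longrightarrow>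
     slash k (F v) g \<tau> = F (residue_row Q (row_mult v g)) \<tau>"
  shows "level_one k (\<lambda>\<tau>. \<Sum>v\<in>unimod_rows Q. F v \<tau>)"
  unfolding level_one_def
proof safe
  fix g \<tau> assume g: "g \<in> SL2Z" and t: "\<tau> \<in> upper_half_plane"
  have "slash k (\<lambda>\<tau>. \<Sum>v\<in>unimod_rows Q. F v \<tau>) g \<tau> = (\<Sum>v\<in>unimod_rows Q. slash k (F v) g \<tau>)"
    by (simp add: slash_eq sum_distrib_left)
  also have "\<dots> = (\<Sum>v\<in>unimod_rows Q. F (residue_row Q (row_mult v g)) \<tau>)"
    using F g t by (intro sum.cong) auto
  also have "\<dots> = (\<Sum>v\<in>unimod_rows Q. F v \<tau>)"
    by (rule sum.reindex_bij_betw[OF bij_unimod_rows[OF g]])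
  finally show "slash k (\<lambda>\<tau>. \<Sum>v\<in>unimod_rows Q. F v \<tau>) g \<tau> = (\<Sum>v\<in>unimod_rows Q. F v \<tau>)" .
qed

lemma level_one_periodic:
  assumes "level_one k F" "\<tau> \<in> upper_half_plane"
  shows "F (\<tau> + 1) = F \<tau>"
proof -
  have "slash k F (mat22 1 1 0 1) \<tau> = F \<tau>"
    using assms by (auto simp: level_one_def mat22_SL2Z_iff)
  thus ?thesis by (simp add: slash_eq jac_def mob_def)
qed

text \<open>Summing over level 2 gives a multiple of the Eisenstein series of level one; the constant
  term is then a value of \<open>lip\<close> at \<open>-1\<close> and no zeta value is needed.\<close>

definition eis_one :: "nat \<Rightarrow> complex \<Rightarrow> complex" where
  "eis_one w \<tau> = (\<Sum>v\<in>unimod_rows 2. eis w 2 v \<tau>)"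

definition eis_one_fps :: "nat \<Rightarrow> complex fps" where
  "eis_one_fps w = Abs_fps (\<lambda>n. fps_nth (\<Sum>v\<in>unimod_rows 2. eis_fps w 2 v) (2 * n))"

lemma level_one_eis_one: "level_one w (eis_one w)"
  unfolding eis_one_def [abs_def]
  by (rule level_one_sum_unimod_rows) (simp_all add: eis_slash eis_residue_row)

lemma fexp_eis_one:
  assumes "w \<ge> 3"
  shows "fexp 1 (eis_one w) (eis_one_fps w)"
  unfolding eis_one_fps_def
proof (rule fexp_descend)
  show "fexp 2 (eis_one w) (\<Sum>v\<in>unimod_rows 2. eis_fps w 2 v)"
    unfolding eis_one_def [abs_def]
    by (intro fexp_sum fexp_eis assms unimod_rows_not_zero) auto
qed (use level_one_periodic[OF level_one_eis_one] in auto)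

lemma zeta_2: "zeta 2 = -1"
  by (simp add: zeta_def exp_pi_i)

lemma eis_one_fps_Rats: "fps_nth (eis_one_fps w) n \<in> \<rat>"
  by (auto simp: eis_one_fps_def fps_sum_nth zeta_2
      intro!: csubfield_sum[OF csubfield_Rats] csubfield_eis_fps[OF csubfield_Rats])

lemma eis_one_fps_nth:
  assumes w: "w > 0" "even w"
  shows "fps_nth (eis_one_fps w) 0 = lip (w - 1) (- 1)" "fps_nth (eis_one_fps w) 1 = 4 * 2 ^ (w - 1) - 2"
proof -
  have D: "{r. r dvd 2} = {1, 2 :: nat}"
    using prime_nat_iff[of 2] by auto
  show "fps_nth (eis_one_fps w) 0 = lip (w - 1) (- 1)"
    by (simp add: eis_one_fps_def fps_sum_nth unimod_rows_2 eis_fps_def zeta_2)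
  show "fps_nth (eis_one_fps w) 1 = 4 * 2 ^ (w - 1) - 2"
    using w by (simp add: eis_one_fps_def fps_sum_nth unimod_rows_2 eis_fps_def zeta_2 D cong_def)
qed

lemma level_one_mult:
  assumes "level_one k F" "level_one l G"
  shows "level_one (k + l) (\<lambda>\<tau>. F \<tau> * G \<tau>)"
  using assms by (simp add: level_one_def slash_times)

lemma level_one_one: "level_one 0 (\<lambda>_. c)"
  by (simp add: level_one_def slash_eq)

lemma level_one_power:
  assumes "level_one k F"
  shows "level_one (n * k) (\<lambda>\<tau>. F \<tau> ^ n)"
  using level_one_one[of 1] level_one_mult[OF assms] by (induction n) auto

lemma level_one_add: "level_one k F \<Longrightarrow> level_one k G \<Longrightarrow> level_one k (\<lambda>\<tau>. F \<tau> + G \<tau>)"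
  by (simp add: level_one_def slash_plus)

lemma level_one_cmult: "level_one k F \<Longrightarrow> level_one k (\<lambda>\<tau>. c * F \<tau>)"
  by (simp add: level_one_def slash_cmult)

lemma level_one_sum:
  assumes "\<And>i. i \<in> I \<Longrightarrow> level_one k (F i)"
  shows "level_one k (\<lambda>\<tau>. \<Sum>i\<in>I. F i \<tau>)"
proof -
  have "level_one k (\<lambda>_. 0)" by (simp add: level_one_def slash_eq)
  thus ?thesis using assms by (induction I rule: infinite_finite_induct) (auto intro: level_one_add)
qed

section \<open>Forms of level one as quotients\<close>

text \<open>A nonzero multiple of the discriminant. The constant terms of \<open>eis_one 4\<close>
  and \<open>eis_one 6\<close> are \<open>1 / 8\<close> and \<open>- 1 / 4\<close>, so both summands
  have constant term \<open>1 / 8192\<close> and the difference vanishes at the cusp.\<close>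

definition cusp12 :: "complex \<Rightarrow> complex" where
  "cusp12 \<tau> = eis_one 4 \<tau> ^ 3 / 16 - eis_one 6 \<tau> ^ 2 / 512"

definition cusp12_fps :: "complex fps" where
  "cusp12_fps = fps_const (1 / 16) * eis_one_fps 4 ^ 3 + fps_const (- 1 / 512) * eis_one_fps 6 ^ 2"

lemma fexp_cusp12: "fexp 1 cusp12 cusp12_fps"
proof -
  have "fexp 1 (\<lambda>\<tau>. (1 / 16) * eis_one 4 \<tau> ^ 3 + (- 1 / 512) * eis_one 6 \<tau> ^ 2) cusp12_fps"
    unfolding cusp12_fps_def by (intro fexp_add fexp_cmult fexp_power fexp_eis_one) auto
  thus ?thesis by (simp add: cusp12_def [abs_def])
qed

lemma level_one_cusp12: "level_one 12 cusp12"
proof -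
  have "level_one 12 (\<lambda>\<tau>. (1 / 16) * eis_one 4 \<tau> ^ 3 + (- 1 / 512) * eis_one 6 \<tau> ^ 2)"
    using level_one_power[OF level_one_eis_one[of 4], of 3] level_one_power[OF level_one_eis_one[of 6], of 2]
    by (intro level_one_add level_one_cmult) simp_all
  thus ?thesis by (simp add: cusp12_def [abs_def])
qed

lemma eis_one_fps_values:
  "fps_nth (eis_one_fps 4) 0 = 1 / 8" "fps_nth (eis_one_fps 4) (Suc 0) = 30"
  "fps_nth (eis_one_fps 6) 0 = - 1 / 4" "fps_nth (eis_one_fps 6) (Suc 0) = 126"
  using eis_one_fps_nth[of 4] eis_one_fps_nth[of 6] lip_values by simp_all

lemma cusp12_fps_nth: "fps_nth cusp12_fps 0 = 0" "fps_nth cusp12_fps 1 \<noteq> 0"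
  unfolding cusp12_fps_def fps_add_nth fps_mult_left_const_nth
  by (simp_all only: power2_eq_square power3_eq_cube fps_mult_nth_0 fps_mult_nth_1 One_nat_def)
     (simp_all add: eis_one_fps_values)

text \<open>\<open>cusp12\<close> has a simple zero at the cusp, so these monomials have distinct leading exponents.\<close>

lemma monomials_independent:
  assumes "(\<Sum>j\<le>m. fps_const (y j) * (cusp12_fps ^ j * (eis_one_fps 4 ^ 3) ^ (m - j))) = 0" "j \<le> m"
  shows "y j = 0"
proof (rule ccontr)
  assume "y j \<noteq> 0"
  define i where "i = (LEAST i. y i \<noteq> 0)"
  have i: "y i \<noteq> 0" "i \<le> j" "\<And>l. l < i \<Longrightarrow> y l = 0"
    using LeastI[of "\<lambda>i. y i \<noteq> 0", OF \<open>y j \<noteq> 0\<close>] Least_le[of "\<lambda>i. y i \<noteq> 0", OF \<open>y j \<noteq> 0\<close>]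
      not_less_Least[of _ "\<lambda>i. y i \<noteq> 0"] unfolding i_def by blast+
  define t where "t = fps_shift 1 cusp12_fps"
  have t: "cusp12_fps = fps_X * t"
    using cusp12_fps_nth(1) by (intro fps_ext) (auto simp: t_def split: nat.split)
  have t0: "fps_nth t 0 \<noteq> 0" using cusp12_fps_nth(2) by (simp add: t_def)
  have Y0: "fps_nth (eis_one_fps 4) 0 \<noteq> 0" by (simp add: eis_one_fps_values)
  have "fps_nth (fps_const (y l) * (cusp12_fps ^ l * (eis_one_fps 4 ^ 3) ^ (m - l))) i =
      (if l = i then y i * (fps_nth t 0 ^ i * (fps_nth (eis_one_fps 4) 0 ^ 3) ^ (m - i)) else 0)" for l
    using i(3)[of l] 
    by (cases l i rule: linorder_cases)
       (simp_all add: t power_mult_distrib mult.assoc fps_X_power_mult_nth fps_nth_power_0)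
  hence "fps_nth (\<Sum>l\<le>m. fps_const (y l) * (cusp12_fps ^ l * (eis_one_fps 4 ^ 3) ^ (m - l))) i =
     (\<Sum>l\<le>m. if l = i then y i * (fps_nth t 0 ^ i * (fps_nth (eis_one_fps 4) 0 ^ 3) ^ (m - i)) else 0)"
    by (simp only: fps_sum_nth)
  also have "\<dots> = y i * (fps_nth t 0 ^ i * (fps_nth (eis_one_fps 4) 0 ^ 3) ^ (m - i))"
    using i(2) assms(2) by simp
  finally show False using assms(1) i(1) t0 Y0 by simp
qed

lemma homogeneous_system_solution:
  fixes a :: "nat \<Rightarrow> 'j \<Rightarrow> complex"
  assumes "finite J" "card J > n"
  obtains x where "\<exists>j\<in>J. x j \<noteq> 0" "\<And>i. i < n \<Longrightarrow> (\<Sum>j\<in>J. a i j * x j) = 0"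
  using assms
proof (induction n arbitrary: a J thesis)
  case 0
  then obtain j where "j \<in> J" by fastforce
  thus ?case using 0(1)[of "\<lambda>_. 1"] by auto
next
  case (Suc n)
  show ?case
  proof (cases "\<forall>j\<in>J. a n j = 0")
    case True
    obtain x where x: "\<exists>j\<in>J. x j \<noteq> 0" "\<And>i. i < n \<Longrightarrow> (\<Sum>j\<in>J. a i j * x j) = 0"
      using Suc.IH[of J a] Suc.prems by auto
    show ?thesis
      by (rule Suc.prems(1)[OF x(1)]) (use x(2) True in \<open>auto simp: less_Suc_eq\<close>)
  next
    case False
    then obtain p where p: "p \<in> J" "a n p \<noteq> 0" by auto
    define J' where "J' = J - {p}"
    have J': "finite J'" "card J' > n" using Suc.prems p by (auto simp: J'_def)
    \<comment> \<open>Gaussian elimination: equation \<open>n\<close> is solved for the unknown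
      \<open>p\<close>, which is then substituted into the others.\<close>
    define b where "b i j = a i j - a i p * a n j / a n p" for i j
    obtain x where x: "\<exists>j\<in>J'. x j \<noteq> 0" "\<And>i. i < n \<Longrightarrow> (\<Sum>j\<in>J'. b i j * x j) = 0"
      using Suc.IH[of J' b] J' by auto
    define x' where "x' j = (if j = p then - (\<Sum>j\<in>J'. a n j * x j) / a n p else x j)" for j
    have split: "(\<Sum>j\<in>J. a i j * x' j) = a i p * x' p + (\<Sum>j\<in>J'. a i j * x j)" for i
    proof -
      have "(\<Sum>j\<in>J. a i j * x' j) = a i p * x' p + (\<Sum>j\<in>J'. a i j * x' j)"
        using Suc.prems p by (simp add: J'_def sum.remove)
      also have "(\<Sum>j\<in>J'. a i j * x' j) = (\<Sum>j\<in>J'. a i j * x j)"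
        by (rule sum.cong) (auto simp: J'_def x'_def)
      finally show ?thesis .
    qed
    show ?thesis
    proof (rule Suc.prems(1))
      show "\<exists>j\<in>J. x' j \<noteq> 0" using x(1) by (auto simp: J'_def x'_def)
      fix i assume "i < Suc n"
      show "(\<Sum>j\<in>J. a i j * x' j) = 0"
      proof (cases "i = n")
        case True
        thus ?thesis unfolding split using p by (simp add: x'_def)
      next
        case False
        hence "(\<Sum>j\<in>J'. b i j * x j) = 0" using x(2) \<open>i < Suc n\<close> by simp
        hence "(\<Sum>j\<in>J'. a i j * x j) = a i p * (\<Sum>j\<in>J'. a n j * x j) / a n p"
          by (simp add: b_def algebra_simps sum_subtractf sum_distrib_left sum_divide_distrib)
        thus ?thesis unfolding split by (simp add: x'_def)
      qed
    qed
  qed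
qed


text \<open>A ring graded by weight, with scalars from \<open>E\<close>. The series
  \<open>eis_one\<close> are generators of their own because they are assembled at level 2, and
  \<open>Q\<close> need not be even.\<close>

inductive modring :: "complex set \<Rightarrow> nat \<Rightarrow> nat \<Rightarrow> (complex \<Rightarrow> complex) \<Rightarrow> bool" for E Q where
  level_one: "w = 4 \<or> w = 6 \<Longrightarrow> modring E Q w (eis_one w)"
| eis: "\<not> (int Q dvd fst u \<and> int Q dvd snd u) \<Longrightarrow> modring E Q 3 (eis 3 Q u)"
| const: "c \<in> E \<Longrightarrow> modring E Q 0 (\<lambda>_. c)"
| zero: "modring E Q w (\<lambda>_. 0)"
| add: "modring E Q w F \<Longrightarrow> modring E Q w G \<Longrightarrow> modring E Q w (\<lambda>\<tau>. F \<tau> + G \<tau>)"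
| mult: "modring E Q v F \<Longrightarrow> modring E Q w G \<Longrightarrow> modring E Q (v + w) (\<lambda>\<tau>. F \<tau> * G \<tau>)"

lemma modring_cmult: "c \<in> E \<Longrightarrow> modring E Q w F \<Longrightarrow> modring E Q w (\<lambda>\<tau>. c * F \<tau>)"
  using modring.mult[OF modring.const] by fastforce

lemma modring_sum: "(\<And>i. i \<in> I \<Longrightarrow> modring E Q w (F i)) \<Longrightarrow> modring E Q w (\<lambda>\<tau>. \<Sum>i\<in>I. F i \<tau>)"
  by (induction I rule: infinite_finite_induct) (auto intro: modring.zero modring.add)

lemma modring_prod:
  assumes "csubfield E" "\<And>i. i \<in> I \<Longrightarrow> modring E Q (w i) (F i)"
  shows "modring E Q (\<Sum>i\<in>I. w i) (\<lambda>\<tau>. \<Prod>i\<in>I. F i \<tau>)"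
  using assms csubfield_1[OF assms(1)]
  by (induction I rule: infinite_finite_induct) (auto intro: modring.const modring.mult)

lemma modring_power:
  assumes "csubfield E" "modring E Q w F"
  shows "modring E Q (n * w) (\<lambda>\<tau>. F \<tau> ^ n)"
  using modring_prod[of E "{..<n}" Q "\<lambda>_. w" "\<lambda>_. F"] assms by simp

lemma modring_cusp12: "csubfield E \<Longrightarrow> modring E Q 12 cusp12"
proof -
  assume E: "csubfield E"
  have q: "1 / 16 \<in> E" "- 1 / 512 \<in> E"
    using csubfield_divide[OF E csubfield_1[OF E] csubfield_of_nat[OF E, of 16]]
      csubfield_divide[OF E csubfield_of_int[OF E, of "- 1"] csubfield_of_nat[OF E, of 512]] by simp_all
  have "modring E Q 12 (\<lambda>\<tau>. (1 / 16) * eis_one 4 \<tau> ^ 3 + (- 1 / 512) * eis_one 6 \<tau> ^ 2)"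
    using modring_power[OF E modring.level_one[of 4], of Q 3] modring_power[OF E modring.level_one[of 6], of Q 2] q
    by (intro modring.add modring_cmult) simp_all
  thus ?thesis by (simp add: cusp12_def [abs_def])
qed

text \<open>Pade approximation: \<open>b\<close> and \<open>a\<close> have \<open>3 * w + 2\<close> undetermined coefficients in total, while
  \<open>b * c - a\<close>, of weight \<open>24 * w\<close>, vanishes as soon as \<open>3 * w + 1\<close> of its Fourier coefficients do.\<close>

lemma level_one_ratio_12:
  assumes c: "level_one (12 * w) c" "fexp 1 c \<gamma>"
  obtains b a \<beta> where "modring UNIV Q (12 * w) b" "modring UNIV Q (24 * w) a"
    "\<And>\<tau>. \<tau> \<in> upper_half_plane \<Longrightarrow> b \<tau> * c \<tau> = a \<tau>" "fexp 1 b \<beta>" "\<beta> \<noteq> 0"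
proof -
  define Y where "Y = (\<lambda>\<tau>. eis_one 4 \<tau> ^ 3)"
  define y where "y = eis_one_fps 4 ^ 3"
  have Y: "level_one 12 Y" "fexp 1 Y y" "modring UNIV Q 12 Y"
    using level_one_power[OF level_one_eis_one, of 3 4] modring_power[OF csubfield_UNIV modring.level_one[of 4], of Q 3]
      fexp_power[OF _ fexp_eis_one[of 4], of 3]
    by (auto simp: Y_def y_def)
  define mon where "mon = (\<lambda>m j \<tau>. cusp12 \<tau> ^ j * Y \<tau> ^ (m - j))"
  define mons where "mons = (\<lambda>m j. cusp12_fps ^ j * y ^ (m - j))"
  have mon: "level_one (12 * m) (mon m j)" "fexp 1 (mon m j) (mons m j)" "modring UNIV Q (12 * m) (mon m j)"
    if "j \<le> m" for m j
  proof -
    have e: "j * 12 + (m - j) * 12 = 12 * m" using that by simp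
    show "level_one (12 * m) (mon m j)"
      using level_one_mult[OF level_one_power[OF level_one_cusp12, of j] level_one_power[OF Y(1), of "m - j"]]
      unfolding e mon_def .
    show "fexp 1 (mon m j) (mons m j)"
      unfolding mon_def mons_def by (intro fexp_mult fexp_power fexp_cusp12 Y) auto
    show "modring UNIV Q (12 * m) (mon m j)"
      using modring.mult[OF modring_power[OF csubfield_UNIV modring_cusp12[OF csubfield_UNIV], of Q j]
          modring_power[OF csubfield_UNIV Y(3), of "m - j"]]
      unfolding e mon_def .
  qed
  define n where "n = 3 * w + 1"
  define J where "J = Inl ` {..w} \<union> Inr ` {..2 * w}"
  have "card J = card (Inl ` {..w} :: (nat + nat) set) + card (Inr ` {..2 * w} :: (nat + nat) set)"
    unfolding J_def by (rule card_Un_disjoint) auto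
  hence J: "finite J" "card J > n" by (simp_all add: card_image J_def n_def)
  define \<beta> where "\<beta> = (\<lambda>j. case j of Inl j \<Rightarrow> mons w j * \<gamma> | Inr j \<Rightarrow> - mons (2 * w) j)"
  obtain x where x: "\<exists>j\<in>J. x j \<noteq> 0" "\<And>i. i < n \<Longrightarrow> (\<Sum>j\<in>J. fps_nth (\<beta> j) i * x j) = 0"
    by (rule homogeneous_system_solution[OF J, of "\<lambda>i j. fps_nth (\<beta> j) i"]) blast
  define b where "b = (\<lambda>\<tau>. \<Sum>j\<le>w. x (Inl j) * mon w j \<tau>)"
  define a where "a = (\<lambda>\<tau>. \<Sum>j\<le>2 * w. x (Inr j) * mon (2 * w) j \<tau>)"
  define bs where "bs = (\<Sum>j\<le>w. fps_const (x (Inl j)) * mons w j)"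
  define as where "as = (\<Sum>j\<le>2 * w. fps_const (x (Inr j)) * mons (2 * w) j)"
  have b: "level_one (12 * w) b" "fexp 1 b bs" "modring UNIV Q (12 * w) b"
    unfolding b_def bs_def using mon
    by (auto intro!: level_one_sum level_one_cmult fexp_sum fexp_cmult modring_sum modring_cmult)
  have a: "level_one (24 * w) a" "fexp 1 a as" "modring UNIV Q (24 * w) a"
    unfolding a_def as_def using mon[of _ "2 * w"]
    by (auto intro!: level_one_sum level_one_cmult fexp_sum fexp_cmult modring_sum modring_cmult)
  define d where "d = (\<lambda>\<tau>. b \<tau> * c \<tau> + (- 1) * a \<tau>)"
  have d: "level_one (24 * w) d" "fexp 1 d (bs * \<gamma> + fps_const (- 1) * as)"
  proof -
    have "12 * w + 12 * w = 24 * w" by simp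
    from level_one_mult[OF b(1) c(1), unfolded this]
    show "level_one (24 * w) d" unfolding d_def by (intro level_one_add level_one_cmult a)
    show "fexp 1 d (bs * \<gamma> + fps_const (- 1) * as)"
      unfolding d_def by (intro fexp_add fexp_mult fexp_cmult a b c) simp
  qed
  have coeff: "fps_nth (bs * \<gamma> + fps_const (- 1) * as) i = (\<Sum>j\<in>J. fps_nth (\<beta> j) i * x j)" for i
  proof -
    have "bs * \<gamma> + fps_const (- 1) * as = (\<Sum>j\<in>J. fps_const (x j) * \<beta> j)"
      unfolding J_def bs_def as_def
      by (subst sum.union_disjoint)
         (auto simp: sum.reindex \<beta>_def sum_distrib_right sum_negf mult.assoc simp flip: fps_const_neg)
    thus ?thesis by (simp add: fps_sum_nth mult.commute)
  qed
  have d0: "d \<tau> = 0" if "\<tau> \<in> upper_half_plane" for \<tau>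
  proof (rule level_one_vanishing[OF d])
    show "24 * w \<le> 8 * n" "n > 0" by (simp_all add: n_def)
    show "fps_nth (bs * \<gamma> + fps_const (- 1) * as) i = 0" if "i < n" for i
      unfolding coeff using x(2) that by blast
  qed (fact that)
  have eq: "b \<tau> * c \<tau> = a \<tau>" if "\<tau> \<in> upper_half_plane" for \<tau>
    using d0[OF that] by (simp add: d_def)
  \<comment> \<open>A zero denominator forces a zero numerator; independence of the monomials then
    makes every unknown vanish, against the choice of \<open>x\<close>.\<close>
  have "bs \<noteq> 0"
  proof
    assume bs0: "bs = 0"
    have z: "fexp 1 (\<lambda>_. 0) 0" using fexp_const[of 1 0] by simp
    have b0: "b \<tau> = 0" if "\<tau> \<in> upper_half_plane" for \<tau>
      using fexp_eqD[OF b(2) _ that, unfolded bs0, OF z] .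
    hence a0: "a \<tau> = 0" if "\<tau> \<in> upper_half_plane" for \<tau> using that eq[OF that] by simp
    have "x (Inl j) = 0" if "j \<le> w" for j
      using monomials_independent[where m = w and y = "\<lambda>j. x (Inl j)" and j = j] that bs0 by (simp add: bs_def mons_def y_def)
    moreover have "fexp 1 a 0" using fexp_cong[of a "\<lambda>_. 0" 1 0] a0 z by blast
    hence "as = 0" using fexp_unique[OF _ a(2)] by simp
    hence "x (Inr j) = 0" if "j \<le> 2 * w" for j
      using monomials_independent[where m = "2 * w" and y = "\<lambda>j. x (Inr j)" and j = j] that by (simp add: as_def mons_def y_def)
    ultimately show False using x(1) by (auto simp: J_def)
  qed
  with that b a(3) eq show ?thesis by blast
qed

lemma level_one_odd_weight:
  assumes "level_one W c" "odd W" "\<tau> \<in> upper_half_plane"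
  shows "c \<tau> = 0"
proof -
  have "slash W c (mat22 (- 1) 0 0 (- 1)) \<tau> = c \<tau>"
    using assms by (auto simp: level_one_def mat22_SL2Z_iff)
  thus ?thesis using assms(2) by (simp add: slash_eq jac_def mob_def)
qed

text \<open>In odd weight the matrix -1 forces \<open>c = 0\<close>. A form of weight
  \<open>2 * w\<close> is raised to weight \<open>12 * w\<close> by the factor
  \<open>(eis_one 4 * eis_one 6) ^ w\<close> of weight \<open>10 * w\<close>, which afterwards joins
  the denominator.\<close>

lemma level_one_ratio:
  assumes c: "level_one W c" "fexp 1 c \<gamma>"
  obtains W' b a \<beta> where "modring UNIV Q W' b" "modring UNIV Q (W' + W) a"
    "\<And>\<tau>. \<tau> \<in> upper_half_plane \<Longrightarrow> b \<tau> * c \<tau> = a \<tau>" "fexp 1 b \<beta>" "\<beta> \<noteq> 0"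
proof (cases "odd W")
  case True
  thus ?thesis using that[of 0 "\<lambda>_. 1" "\<lambda>_. 0" "fps_const 1"] level_one_odd_weight[OF c(1) True]
    by (auto intro: modring.const modring.zero fexp_const simp del: fps_const_1_eq_1)
next
  case False
  then obtain w where w: "W = 2 * w" by (auto elim: evenE)
  define e where "e = (\<lambda>\<tau>. (eis_one 4 \<tau> * eis_one 6 \<tau>) ^ w)"
  have e10: "4 + 6 = (10 :: nat)" by simp
  have e: "level_one (w * 10) e" "fexp 1 e ((eis_one_fps 4 * eis_one_fps 6) ^ w)" "modring UNIV Q (w * 10) e"
    using level_one_power[OF level_one_mult[OF level_one_eis_one[of 4] level_one_eis_one[of 6]], of w]
      modring_power[OF csubfield_UNIV modring.mult[OF modring.level_one[of 4] modring.level_one[of 6]], of Q w]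
      fexp_power[OF _ fexp_mult[OF _ fexp_eis_one[of 4] fexp_eis_one[of 6]], of w]
    by (auto simp: e_def)
  have "eis_one_fps 4 \<noteq> 0" "eis_one_fps 6 \<noteq> 0"
    using eis_one_fps_values by (metis div_by_1 fps_zero_nth divide_eq_0_iff zero_neq_one zero_neq_numeral neg_equal_0_iff_equal)+
  hence e_fps: "(eis_one_fps 4 * eis_one_fps 6) ^ w \<noteq> 0" by simp
  have "level_one (12 * w) (\<lambda>\<tau>. c \<tau> * e \<tau>)"
    using level_one_mult[OF c(1) e(1)] by (simp add: w)
  moreover have "fexp 1 (\<lambda>\<tau>. c \<tau> * e \<tau>) (\<gamma> * (eis_one_fps 4 * eis_one_fps 6) ^ w)"
    by (intro fexp_mult c e) auto
  ultimately obtain b a \<beta> where ba: "modring UNIV Q (12 * w) b" "modring UNIV Q (24 * w) a"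
    "\<And>\<tau>. \<tau> \<in> upper_half_plane \<Longrightarrow> b \<tau> * (c \<tau> * e \<tau>) = a \<tau>" "fexp 1 b \<beta>" "\<beta> \<noteq> 0"
    by (rule level_one_ratio_12[where w = w and Q = Q]) blast
  have "modring UNIV Q (12 * w + w * 10) (\<lambda>\<tau>. b \<tau> * e \<tau>)" by (rule modring.mult[OF ba(1) e(3)])
  moreover have "fexp 1 (\<lambda>\<tau>. b \<tau> * e \<tau>) (\<beta> * (eis_one_fps 4 * eis_one_fps 6) ^ w)"
    using ba(4) e(2) by (intro fexp_mult) auto
  moreover have "\<beta> * (eis_one_fps 4 * eis_one_fps 6) ^ w \<noteq> 0" using ba(5) e_fps by simp
  ultimately show ?thesis
    using that[of "12 * w + w * 10" "\<lambda>\<tau>. b \<tau> * e \<tau>" a] ba(2,3) by (simp add: w mult_ac)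
qed

section \<open>Galois action on the ring of Eisenstein series\<close>

text \<open>Values outside \<open>E\<close> are left free. When \<open>E\<close> is a field,
  injectivity on it is automatic, see \<open>emb_eq_0_iff\<close>.\<close>

definition field_embedding :: "complex set \<Rightarrow> (complex \<Rightarrow> complex) \<Rightarrow> bool" where
  "field_embedding E s \<longleftrightarrow> s 1 = 1 \<and> (\<forall>x\<in>E. \<forall>y\<in>E. s (x + y) = s x + s y \<and> s (x * y) = s x * s y)"

definition coeffs_in :: "complex set \<Rightarrow> complex fps \<Rightarrow> bool" where
  "coeffs_in E a \<longleftrightarrow> (\<forall>n. fps_nth a n \<in> E)"

definition map_fps :: "(complex \<Rightarrow> complex) \<Rightarrow> complex fps \<Rightarrow> complex fps" where
  "map_fps s a = Abs_fps (\<lambda>n. s (fps_nth a n))"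

lemma map_fps_nth [simp]: "fps_nth (map_fps s a) n = s (fps_nth a n)"
  by (simp add: map_fps_def)

lemma field_embedding_id: "field_embedding E (\<lambda>x. x)"
  by (simp add: field_embedding_def)

context
  fixes E s assumes E: "csubfield E" and s: "field_embedding E s"
begin

lemma emb_1: "s 1 = 1"
  and emb_add: "x \<in> E \<Longrightarrow> y \<in> E \<Longrightarrow> s (x + y) = s x + s y"
  and emb_mult: "x \<in> E \<Longrightarrow> y \<in> E \<Longrightarrow> s (x * y) = s x * s y"
  using s by (auto simp: field_embedding_def)

lemma emb_0: "s 0 = 0"
  using emb_add[OF csubfield_0[OF E] csubfield_0[OF E]] by simp

lemma emb_uminus: "x \<in> E \<Longrightarrow> s (- x) = - s x"
  using emb_add[of x "- x"] csubfield_uminus[OF E, of x] emb_0 by (simp add: eq_neg_iff_add_eq_0 add.commute)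

lemma emb_diff: "x \<in> E \<Longrightarrow> y \<in> E \<Longrightarrow> s (x - y) = s x - s y"
  using emb_add[of x "- y"] csubfield_uminus[OF E, of y] emb_uminus by simp

lemma emb_power: "x \<in> E \<Longrightarrow> s (x ^ n) = s x ^ n"
  by (induction n) (auto simp: emb_1 emb_mult csubfield_power[OF E])

lemma emb_sum: "(\<And>i. i \<in> I \<Longrightarrow> f i \<in> E) \<Longrightarrow> s (sum f I) = (\<Sum>i\<in>I. s (f i))"
  by (induction I rule: infinite_finite_induct) (auto simp: emb_0 emb_add csubfield_sum[OF E])

lemma emb_inverse: 
  assumes x: "x \<in> E" shows "s (inverse x) = inverse (s x)"
proof (cases "x = 0")
  case False
  hence "s x * s (inverse x) = 1" using emb_mult[OF x csubfield_inverse[OF E x]] emb_1 by simp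
  thus ?thesis by (metis inverse_unique)
qed (simp add: emb_0)

lemma emb_eq_0_iff: 
  assumes x: "x \<in> E" shows "s x = 0 \<longleftrightarrow> x = 0"
proof (cases "x = 0")
  case False
  hence "s x * s (inverse x) = 1" using emb_mult[OF x csubfield_inverse[OF E x]] emb_1 by simp
  thus ?thesis using False by auto
qed (simp add: emb_0)

lemma emb_powi: "x \<in> E \<Longrightarrow> s (x powi n) = s x powi n"
  by (simp add: power_int_def emb_power emb_inverse csubfield_inverse[OF E])

lemma emb_of_nat: "s (of_nat n) = of_nat n"
  by (induction n) (auto simp: emb_0 emb_1 emb_add csubfield_of_nat[OF E] csubfield_1[OF E])

lemma emb_of_int: "s (of_int n) = of_int n"
proof (cases n)
  case (nonneg m)
  thus ?thesis by (simp add: emb_of_nat)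
next
  case (neg m)
  have "of_int n = - (of_nat (Suc m) :: complex)" unfolding neg by simp
  thus ?thesis using emb_uminus[OF csubfield_of_nat[OF E], of "Suc m"] emb_of_nat[of "Suc m"] by simp
qed

lemma Rats_in: "x \<in> \<rat> \<Longrightarrow> x \<in> E"
  using Rats_cases'[of x] csubfield_divide[OF E csubfield_of_int[OF E] csubfield_of_int[OF E]] by metis

lemma emb_Rats: "x \<in> \<rat> \<Longrightarrow> s x = x"
  using Rats_cases'[of x] by (metis divide_inverse emb_mult emb_inverse emb_of_int csubfield_of_int[OF E] csubfield_inverse[OF E])

lemma emb_lip: 
  assumes x: "x \<in> E" shows "s (lip n x) = lip n (s x)"
proof -
  let ?p = "eulerian_poly n"
  have c: "Polynomial.coeff ?p i \<in> E" "s (Polynomial.coeff ?p i) = Polynomial.coeff ?p i" for i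
    using coeff_eulerian_poly[of n i] by (auto elim!: Ints_cases simp: emb_of_int csubfield_of_int[OF E])
  have p: "poly ?p x \<in> E" by (rule csubfield_poly[OF E c(1) x])
  have "s (poly ?p x) = poly ?p (s x)"
    unfolding poly_altdef using x c
    by (subst emb_sum) (auto simp: emb_mult emb_power csubfield_mult[OF E] csubfield_power[OF E])
  thus ?thesis unfolding lip_def divide_inverse using x p
    by (simp add: emb_mult emb_inverse emb_power emb_diff emb_1 csubfield_inverse[OF E] csubfield_power[OF E]
        csubfield_diff[OF E] csubfield_1[OF E] csubfield_mult[OF E] del: power_Suc)
qed

lemma map_fps_add: "coeffs_in E a \<Longrightarrow> coeffs_in E b \<Longrightarrow> map_fps s (a + b) = map_fps s a + map_fps s b"
  by (auto simp: fps_eq_iff coeffs_in_def emb_add)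

lemma map_fps_mult: "coeffs_in E a \<Longrightarrow> coeffs_in E b \<Longrightarrow> map_fps s (a * b) = map_fps s a * map_fps s b"
  by (auto simp: fps_eq_iff coeffs_in_def fps_mult_nth emb_sum emb_mult csubfield_mult[OF E] intro!: sum.cong)

lemma coeffs_in_add: "coeffs_in E a \<Longrightarrow> coeffs_in E b \<Longrightarrow> coeffs_in E (a + b)"
  by (auto simp: coeffs_in_def csubfield_add[OF E])

lemma coeffs_in_mult: "coeffs_in E a \<Longrightarrow> coeffs_in E b \<Longrightarrow> coeffs_in E (a * b)"
  by (auto simp: coeffs_in_def fps_mult_nth csubfield_mult[OF E] intro!: csubfield_sum[OF E])

lemma coeffs_in_const: "c \<in> E \<Longrightarrow> coeffs_in E (fps_const c)"
  by (auto simp: coeffs_in_def csubfield_0[OF E])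

lemma map_fps_const: "map_fps s (fps_const c) = fps_const (s c)"
  by (auto simp: fps_eq_iff emb_0)

lemma map_fps_eq_0_iff: "coeffs_in E a \<Longrightarrow> map_fps s a = 0 \<longleftrightarrow> a = 0"
  by (auto simp: fps_eq_iff coeffs_in_def emb_eq_0_iff)

text \<open>The coefficients are integer polynomials in powers of \<open>zeta Q\<close>, or a value
  of \<open>lip\<close> at such a power, so \<open>s\<close> is felt only in the exponent
  \<open>snd u\<close>, which gets multiplied by \<open>l\<close>.\<close>

lemma map_fps_eis_fps:
  assumes "zeta Q \<in> E" "s (zeta Q) = zeta Q powi l"
  shows "map_fps s (eis_fps w Q u) = eis_fps w Q (fst u, l * snd u)"
proof -
  have z: "s (zeta Q powi n) = zeta Q powi (l * n)" for n
    using assms by (simp add: emb_powi power_int_mult)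
  have z': "s (inverse (zeta Q powi n)) = inverse (zeta Q powi (l * n))" for n
    using z[of "- n"] by (simp add: power_int_minus)
  note closed = csubfield_mult[OF E] csubfield_power[OF E] csubfield_powi[OF E] csubfield_inverse[OF E]
    csubfield_of_nat[OF E] csubfield_0[OF E] csubfield_uminus[OF E] csubfield_1[OF E] csubfield_sum[OF E]
  have t: "s (of_nat r ^ p * (zeta Q powi n) ^ r) = of_nat r ^ p * (zeta Q powi (l * n)) ^ r" for r p n
    using assms(1) by (simp add: emb_mult emb_power emb_of_nat z closed)
  have S: "s (\<Sum>r | r dvd k. if P r then of_nat r ^ p * (zeta Q powi n) ^ r else 0) = 
      (\<Sum>r | r dvd k. if P r then of_nat r ^ p * (zeta Q powi (l * n)) ^ r else 0)" for k P p n
    using assms(1) by (subst emb_sum) (auto simp: t emb_0 closed intro!: sum.cong)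
  have c1: "(\<Sum>r | r dvd k. if P r then of_nat r ^ p * (zeta Q powi n) ^ r else 0) \<in> E" for k P p n
    using assms(1) by (auto intro!: closed)
  have m1: "s ((- 1) ^ w) = (- 1) ^ w" using emb_of_int[of "(- 1) ^ w"] by simp
  have c2: "(- 1) ^ w \<in> E" by (intro closed)
  have l: "s (lip p (zeta Q powi snd u)) = lip p (zeta Q powi (l * snd u))" for p
    using assms(1) by (simp add: emb_lip closed z)
  show ?thesis
    using S[where p = "w - 1" and n = "snd u"] S[where p = "w - 1" and n = "- snd u"]
    by (auto simp: fps_eq_iff eis_fps_def emb_0 emb_add emb_mult c1 c2 m1 l closed cong: if_cong)
qed

end

text \<open>\<open>h\<close> is congruent to \<open>diag(1, l)\<inverse> g diag(1, l)\<close>, written without inverting \<open>l\<close>.\<close>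

definition twisted :: "nat \<Rightarrow> int \<Rightarrow> int ^ 2 ^ 2 \<Rightarrow> int ^ 2 ^ 2 \<Rightarrow> bool" where
  "twisted Q l g h \<longleftrightarrow> [h $ 1 $ 1 = g $ 1 $ 1] (mod int Q) \<and> [h $ 1 $ 2 = l * g $ 1 $ 2] (mod int Q) \<and>
     [l * h $ 2 $ 1 = g $ 2 $ 1] (mod int Q) \<and> [h $ 2 $ 2 = g $ 2 $ 2] (mod int Q)"

lemma row_mult_nonzero:
  assumes g: "g \<in> SL2Z" and u: "\<not> (int Q dvd fst u \<and> int Q dvd snd u)"
  shows "\<not> (int Q dvd fst (row_mult u g) \<and> int Q dvd snd (row_mult u g))"
proof
  assume a: "int Q dvd fst (row_mult u g) \<and> int Q dvd snd (row_mult u g)"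
  have "u = row_mult (row_mult u g) (SL2_inv g)" by (simp add: row_mult_mult SL2_inv_right[OF g])
  also have "int Q dvd fst \<dots> \<and> int Q dvd snd \<dots>"
    using a unfolding row_mult_def[of "row_mult u g"] by (simp add: dvd_add)
  finally show False using u by blast
qed

text \<open>The conjugate form \<open>H'\<close> is chosen before \<open>g\<close> and
  \<open>h\<close>; this is what allows a relation found at the identity to be moved to any
  \<open>g\<close>. The content lies in the generators: \<open>eis_one\<close> has rational
  coefficients, and \<open>eis 3 Q u\<close> is sent to the series of the row
  \<open>(fst u, l * snd u)\<close>.\<close>

lemma modring_twist:
  assumes E: "csubfield E" and s: "field_embedding E s" and z: "zeta Q \<in> E" "s (zeta Q) = zeta Q powi l"
    and Q: "Q > 1" and l: "coprime l (int Q)" and H: "modring E Q W H"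
  shows "\<exists>H'. \<forall>g\<in>SL2Z. \<forall>h\<in>SL2Z. twisted Q l g h \<longrightarrow>
     (\<exists>a. coeffs_in E a \<and> fexp Q (slash W H g) a \<and> fexp Q (slash W H' h) (map_fps s a))"
  using H
proof induction
  case (level_one w)
  define a where "a = stretch_fps Q (eis_one_fps w)"
  have a: "fps_nth a n \<in> \<rat>" for n by (simp add: a_def stretch_fps_def eis_one_fps_Rats)
  have f: "fexp Q (slash w (eis_one w) g) a" if "g \<in> SL2Z" for g
  proof -
    have "fexp (Q * 1) (eis_one w) a" unfolding a_def 
      by (rule fexp_ascend) (use Q level_one in \<open>auto intro: fexp_eis_one[unfolded One_nat_def]\<close>)
    thus ?thesis using fexp_cong[of "slash w (eis_one w) g" "eis_one w" Q a] level_one_eis_one[of w] that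
      by (simp add: level_one_def)
  qed
  have "coeffs_in E a" "map_fps s a = a"
    using a by (auto simp: coeffs_in_def fps_eq_iff Rats_in[OF E s] emb_Rats[OF E s])
  thus ?case using f by metis
next
  case (eis u)
  have "fexp Q (slash 3 (eis 3 Q u) g) (eis_fps 3 Q (row_mult u g)) \<and>
      fexp Q (slash 3 (eis 3 Q (fst u, l * snd u)) h) (map_fps s (eis_fps 3 Q (row_mult u g)))"
    if gh: "g \<in> SL2Z" "h \<in> SL2Z" "twisted Q l g h" for g h
  proof
    have sl: "fexp Q (slash 3 (eis 3 Q v) k) a \<longleftrightarrow> fexp Q (eis 3 Q (row_mult v k)) a" if "k \<in> SL2Z" for k v a
      by (rule fexp_cong) (rule eis_slash[OF that])
    have nz: "\<not> (int Q dvd fst (row_mult u g) \<and> int Q dvd snd (row_mult u g))"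
      by (rule row_mult_nonzero[OF gh(1) eis])
    show "fexp Q (slash 3 (eis 3 Q u) g) (eis_fps 3 Q (row_mult u g))"
      unfolding sl[OF gh(1)] by (rule fexp_eis) (use Q nz in auto)
    define v where "v = (fst (row_mult u g), l * snd (row_mult u g))"
    have nz': "\<not> (int Q dvd fst v \<and> int Q dvd snd v)"
      using nz l by (simp add: v_def coprime_dvd_mult_right_iff coprime_commute)
    \<comment> \<open>\<open>twisted\<close> expresses the congruence of \<open>diag(1, l) h\<close>
      and \<open>g diag(1, l)\<close> modulo \<open>Q\<close>; here both act on the row
      \<open>u\<close>.\<close>
    have "residue_row Q (row_mult (fst u, l * snd u) h) = residue_row Q v"
      unfolding residue_row_eq_iff
    proof
      have "[fst u * h $ 1 $ 1 + snd u * (l * h $ 2 $ 1) = fst u * g $ 1 $ 1 + snd u * g $ 2 $ 1] (mod int Q)"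
        using gh(3) by (intro cong_add cong_mult) (auto simp: twisted_def)
      thus "[fst (row_mult (fst u, l * snd u) h) = fst v] (mod int Q)"
        by (simp add: v_def row_mult_def mult_ac)
      have "[fst u * h $ 1 $ 2 + (l * snd u) * h $ 2 $ 2 = fst u * (l * g $ 1 $ 2) + (l * snd u) * g $ 2 $ 2] (mod int Q)"
        using gh(3) by (intro cong_add cong_mult) (auto simp: twisted_def)
      thus "[snd (row_mult (fst u, l * snd u) h) = snd v] (mod int Q)"
        by (simp add: v_def row_mult_def algebra_simps)
    qed
    hence e: "eis 3 Q (row_mult (fst u, l * snd u) h) = eis 3 Q v" by (metis eis_residue_row)
    have "fexp Q (eis 3 Q v) (eis_fps 3 Q v)" by (rule fexp_eis) (use Q nz' in auto)
    thus "fexp Q (slash 3 (eis 3 Q (fst u, l * snd u)) h) (map_fps s (eis_fps 3 Q (row_mult u g)))"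
      unfolding sl[OF gh(2)] e map_fps_eis_fps[OF E s z] v_def .
  qed
  moreover have "coeffs_in E (eis_fps 3 Q v)" for v
    using csubfield_eis_fps[OF E z(1)] by (auto simp: coeffs_in_def)
  ultimately show ?case by blast
next
  case (const c)
  have "slash 0 (\<lambda>_. d) g = (\<lambda>_. d)" for d g by (simp add: slash_eq fun_eq_iff)
  thus ?case using fexp_const[of Q] map_fps_const[OF E s, of c] coeffs_in_const[OF E s const]
    by (intro exI[of _ "\<lambda>_. s c"]) (metis (no_types))
next
  case (zero w)
  have "slash w (\<lambda>_. 0) g = (\<lambda>_. 0)" for g by (simp add: slash_eq fun_eq_iff)
  thus ?case using fexp_const[of Q 0] map_fps_const[OF E s, of 0] coeffs_in_const[OF E s csubfield_0[OF E]] emb_0[OF E s]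
    by (intro exI[of _ "\<lambda>_. 0"]) (metis (no_types))
next
  case (add w F G)
  then obtain F' G' where
    F: "\<And>g h. g \<in> SL2Z \<Longrightarrow> h \<in> SL2Z \<Longrightarrow> twisted Q l g h \<Longrightarrow>
      \<exists>a. coeffs_in E a \<and> fexp Q (slash w F g) a \<and> fexp Q (slash w F' h) (map_fps s a)" and
    G: "\<And>g h. g \<in> SL2Z \<Longrightarrow> h \<in> SL2Z \<Longrightarrow> twisted Q l g h \<Longrightarrow>
      \<exists>a. coeffs_in E a \<and> fexp Q (slash w G g) a \<and> fexp Q (slash w G' h) (map_fps s a)" by blast
  show ?case
  proof (rule exI[of _ "\<lambda>\<tau>. F' \<tau> + G' \<tau>"], intro ballI impI)
    fix g h assume gh: "g \<in> SL2Z" "h \<in> SL2Z" "twisted Q l g h"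
    obtain a where a: "coeffs_in E a" "fexp Q (slash w F g) a" "fexp Q (slash w F' h) (map_fps s a)" using F[OF gh] by blast
    obtain b where b: "coeffs_in E b" "fexp Q (slash w G g) b" "fexp Q (slash w G' h) (map_fps s b)" using G[OF gh] by blast
    have e: "slash w (\<lambda>\<tau>. F \<tau> + G \<tau>) g = (\<lambda>\<tau>. slash w F g \<tau> + slash w G g \<tau>)" for F G g
      by (rule ext) (rule slash_plus)
    show "\<exists>a. coeffs_in E a \<and> fexp Q (slash w (\<lambda>\<tau>. F \<tau> + G \<tau>) g) a \<and>
       fexp Q (slash w (\<lambda>\<tau>. F' \<tau> + G' \<tau>) h) (map_fps s a)"
      by (rule exI[of _ "a + b"]) (unfold e map_fps_add[OF E s a(1) b(1)],
       intro conjI coeffs_in_add[OF E s] fexp_add a b)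
  qed
next
  case (mult v F w G)
  then obtain F' G' where
    F: "\<And>g h. g \<in> SL2Z \<Longrightarrow> h \<in> SL2Z \<Longrightarrow> twisted Q l g h \<Longrightarrow>
      \<exists>a. coeffs_in E a \<and> fexp Q (slash v F g) a \<and> fexp Q (slash v F' h) (map_fps s a)" and
    G: "\<And>g h. g \<in> SL2Z \<Longrightarrow> h \<in> SL2Z \<Longrightarrow> twisted Q l g h \<Longrightarrow>
      \<exists>a. coeffs_in E a \<and> fexp Q (slash w G g) a \<and> fexp Q (slash w G' h) (map_fps s a)" by blast
  show ?case
  proof (rule exI[of _ "\<lambda>\<tau>. F' \<tau> * G' \<tau>"], intro ballI impI)
    fix g h assume gh: "g \<in> SL2Z" "h \<in> SL2Z" "twisted Q l g h"
    obtain a where a: "coeffs_in E a" "fexp Q (slash v F g) a" "fexp Q (slash v F' h) (map_fps s a)" using F[OF gh] by blast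
    obtain b where b: "coeffs_in E b" "fexp Q (slash w G g) b" "fexp Q (slash w G' h) (map_fps s b)" using G[OF gh] by blast
    have e: "slash (v + w) (\<lambda>\<tau>. F \<tau> * G \<tau>) g = (\<lambda>\<tau>. slash v F g \<tau> * slash w G g \<tau>)" for F G g
      by (rule ext) (rule slash_times)
    have Q0: "Q > 0" using Q by simp
    show "\<exists>a. coeffs_in E a \<and> fexp Q (slash (v + w) (\<lambda>\<tau>. F \<tau> * G \<tau>) g) a \<and>
       fexp Q (slash (v + w) (\<lambda>\<tau>. F' \<tau> * G' \<tau>) h) (map_fps s a)"
      by (rule exI[of _ "a * b"])
         (unfold e map_fps_mult[OF E s a(1) b(1)], intro conjI coeffs_in_mult[OF E s] fexp_mult Q0 a b)
  qed
qed

text \<open>The case of the identity embedding with \<open>l = 1\<close>, for which \<open>g\<close>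
  is a twist of itself.\<close>

lemma modring_fexp:
  assumes E: "csubfield E" and z: "zeta Q \<in> E" and Q: "Q > 1" and H: "modring E Q W H" and g: "g \<in> SL2Z"
  obtains a where "coeffs_in E a" "fexp Q (slash W H g) a"
proof -
  obtain H' where "\<forall>g\<in>SL2Z. \<forall>h\<in>SL2Z. twisted Q 1 g h \<longrightarrow>
     (\<exists>a. coeffs_in E a \<and> fexp Q (slash W H g) a \<and> fexp Q (slash W H' h) (map_fps (\<lambda>x. x) a))"
    using modring_twist[OF E field_embedding_id z _ Q _ H, of 1] by auto
  moreover have "twisted Q 1 g g" by (simp add: twisted_def)
  ultimately show ?thesis using that g by blast
qed

section \<open>An algebraic relation for modular forms\<close>

text \<open>Each term \<open>(t + k) ^ (-3)\<close> is strictly decreasing in \<open>t \<in> (0, 1)\<close>, hence so is their sum.\<close>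

lemma lip_2_cis_neq:
  fixes t t' :: real
  assumes t: "0 < t" "t < t'" "t' < 1"
  shows "lip 2 (cis_2pi (of_real t)) \<noteq> lip 2 (cis_2pi (of_real t'))"
proof
  assume eq: "lip 2 (cis_2pi (of_real t)) = lip 2 (cis_2pi (of_real t'))"
  have not_int: "complex_of_real x \<notin> \<int>" if "0 < x" "x < 1" for x :: real
  proof
    assume "complex_of_real x \<in> \<int>"
    then obtain k :: int where "complex_of_real x = of_int k" by (rule Ints_cases)
    hence "x = of_int k" by (metis of_real_of_int_eq of_real_eq_iff)
    thus False using that by simp
  qed
  define c where "c = (- 2 * of_real pi * \<i>) ^ Suc 2 / fact 2"
  define g where "g k = inverse ((t + of_int k) ^ 3) - inverse ((t' + of_int k) ^ 3)" for k :: int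
  have h: "((\<lambda>k::int. inverse ((of_real x + of_int k) ^ Suc 2)) has_sum (c * lip 2 (cis_2pi (of_real x)))) UNIV"
    if "0 < x" "x < 1" for x :: real
    unfolding c_def by (rule lipschitz_formula[OF not_int[OF that]]) simp
  have "((\<lambda>k::int. inverse ((of_real t + of_int k) ^ Suc 2) + (- 1) * inverse ((of_real t' + of_int k) ^ Suc 2))
     has_sum (c * lip 2 (cis_2pi (of_real t)) + (- 1) * (c * lip 2 (cis_2pi (of_real t'))))) UNIV"
    using t by (intro has_sum_add has_sum_cmult_right h) auto
  also have "c * lip 2 (cis_2pi (of_real t)) + (- 1) * (c * lip 2 (cis_2pi (of_real t'))) = of_real 0"
    by (simp add: eq)
  also have "(\<lambda>k::int. inverse ((of_real t + of_int k) ^ Suc 2) + (- 1) * inverse ((of_real t' + of_int k) ^ Suc 2))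
     = (\<lambda>k. complex_of_real (g k))"
    by (simp add: g_def numeral_3_eq_3 numeral_2_eq_2)
  finally have "(g has_sum 0) UNIV" by (simp only: has_sum_of_real_iff)
  moreover have pos: "g k > 0" for k
  proof (cases "k \<ge> 0")
    case True
    have "(t + of_int k) ^ 3 < (t' + of_int k) ^ 3" using t True by (intro power_strict_mono) auto
    thus ?thesis using t True by (simp add: g_def less_imp_inverse_less)
  next
    case False
    hence k: "real_of_int k \<le> - 1" by linarith
    have "(- (t' + of_int k)) ^ 3 < (- (t + of_int k)) ^ 3" using t k by (intro power_strict_mono) auto
    hence "inverse ((- (t + of_int k)) ^ 3) < inverse ((- (t' + of_int k)) ^ 3)"
      by (rule less_imp_inverse_less) (use t k in auto)
    hence "- inverse ((t + of_int k) ^ 3) < - inverse ((t' + of_int k) ^ 3)"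
    proof -
      have "(- x) ^ 3 = - (x ^ 3)" for x :: real by (simp add: power3_eq_cube)
      with \<open>inverse ((- (t + of_int k)) ^ 3) < _\<close> show ?thesis by (simp only: inverse_minus_eq)
    qed
    thus ?thesis by (simp add: g_def)
  qed
  ultimately have "g 0 = 0"
    by (intro nonneg_has_sum_le_0D[where f = g and A = UNIV and a = 0]) (auto intro: less_imp_le)
  with pos[of 0] show False by simp
qed

lemma zeta_powi_eq_cis: "zeta Q powi b = cis_2pi (of_real (of_int b / of_nat Q))"
  by (simp add: zeta_def exp_power_int mult_ac)

text \<open>Constant terms differ. If \<open>fst u = 0\<close>, they are \<open>lip 2\<close> at two
  distinct points of \<open>(0, 1)\<close>, where strict monotonicity applies. Otherwise that of
  \<open>u\<close> is 0, while \<open>lip 2\<close> does not vanish at \<open>1 / Q\<close>: being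
  odd under \<open>t \<mapsto> 1 - t\<close>, it would vanish at \<open>1 - 1 / Q\<close> too, a
  different point since \<open>Q \<ge> 3\<close>.\<close>

lemma eis_fps_3_neq:
  assumes Q: "Q \<ge> 3" and u: "u \<in> unimod_rows Q" "u \<noteq> (0, 1)"
  shows "eis_fps 3 Q (0, 1) \<noteq> eis_fps 3 Q u"
proof
  assume "eis_fps 3 Q (0, 1) = eis_fps 3 Q u"
  hence eq: "lip 2 (zeta Q powi 1) = (if int Q dvd fst u then lip 2 (zeta Q powi snd u) else 0)"
    by (auto simp: eis_fps_def fps_eq_iff dest!: spec[of _ 0])
  have r: "0 \<le> fst u" "fst u < int Q" "0 \<le> snd u" "snd u < int Q"
    using residue_row_idem[OF u(1)] Q pos_mod_bound[of "int Q"] pos_mod_sign[of "int Q"] unfolding residue_row_def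
    by (metis fst_conv snd_conv of_nat_0_less_iff less_le_trans zero_less_numeral)+
  show False
  proof (cases "fst u = 0")
    case True
    have "snd u \<noteq> 0" using unimod_rows_not_zero[OF _ u(1)] Q True by auto
    moreover have "snd u \<noteq> 1" using u(2) True by (metis prod.collapse)
    ultimately have "real_of_int 1 / real Q < real_of_int (snd u) / real Q" "real_of_int (snd u) / real Q < 1"
      using r Q by (auto simp: divide_simps)
    hence "lip 2 (zeta Q powi 1) \<noteq> lip 2 (zeta Q powi snd u)"
      unfolding zeta_powi_eq_cis using Q by (intro lip_2_cis_neq) auto
    thus False using eq True by simp
  next
    case False
    hence "\<not> int Q dvd fst u" using r zdvd_imp_le[of "int Q" "fst u"] by auto
    hence z: "lip 2 (zeta Q powi 1) = 0" using eq by simp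
    define t where "t = 1 / real Q"
    have t: "0 < t" "t < 1 - t" "1 - t < 1" using Q by (auto simp: t_def divide_simps)
    have z': "lip 2 (cis_2pi (of_real t)) = 0" using z unfolding zeta_powi_eq_cis t_def by simp
    have ni: "complex_of_real t \<notin> \<int>"
    proof
      assume "complex_of_real t \<in> \<int>"
      then obtain k :: int where "complex_of_real t = of_int k" by (rule Ints_cases)
      hence "t = of_int k" by (metis of_real_of_int_eq of_real_eq_iff)
      thus False using t by simp
    qed
    have "cis_2pi (of_real (1 - t)) = inverse (cis_2pi (of_real t))"
      using exp_two_pi_i by (simp add: ring_distribs exp_diff divide_inverse)
    hence "lip 2 (cis_2pi (of_real (1 - t))) = 0"
      using lip_inverse[OF ni, of 2] z' by simp
    with z' lip_2_cis_neq[OF t] show False by simp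
  qed
qed

lemma slash_power: "slash (n * w) (\<lambda>\<tau>. F \<tau> ^ n) g \<tau> = slash w F g \<tau> ^ n"
  by (simp add: slash_eq power_mult_distrib power_inverse mult.commute[of n] flip: power_mult)

text \<open>With \<open>v\<close> ranging over the cosets of \<open>\<Gamma>\<^sub>1(Q)\<close>, the traces \<open>\<Sum>v. F v * P v ^ i\<close> have level one,
  and Lagrange interpolation recovers \<open>f = F (0, 1)\<close> from them.\<close>

lemma modular_relation:
  assumes Q: "Q \<ge> 3" and f: "\<And>g. g \<in> SL2Z \<Longrightarrow> \<exists>a. fexp Q (slash k f g) a"
    and inv: "\<And>g h \<tau>. g \<in> SL2Z \<Longrightarrow> h \<in> SL2Z \<Longrightarrow> \<tau> \<in> upper_half_plane \<Longrightarrow>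
      residue_row Q (row_mult (0, 1) g) = residue_row Q (row_mult (0, 1) h) \<Longrightarrow> slash k f g \<tau> = slash k f h \<tau>"
  obtains W A B \<alpha> where "modring UNIV Q W A" "modring UNIV Q (W + k) B"
    "\<And>\<tau>. \<tau> \<in> upper_half_plane \<Longrightarrow> A \<tau> * f \<tau> = B \<tau>" "fexp Q A \<alpha>" "\<alpha> \<noteq> 0"
proof -
  have Q0: "Q > 0" "Q > 1" using Q by auto
  define V where "V = unimod_rows Q"
  define rep where "rep v = (SOME g. g \<in> SL2Z \<and> residue_row Q (row_mult (0, 1) g) = v)" for v
  have rep: "rep v \<in> SL2Z" "residue_row Q (row_mult (0, 1) (rep v)) = v" if "v \<in> V" for v
  proof -
    have "\<exists>g. g \<in> SL2Z \<and> residue_row Q (row_mult (0, 1) g) = v"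
      using that by (auto simp: V_def unimod_rows_def)
    thus "rep v \<in> SL2Z" "residue_row Q (row_mult (0, 1) (rep v)) = v"
      unfolding rep_def by (metis (mono_tags, lifting) someI_ex)+
  qed
  define F where "F v = slash k f (rep v)" for v
  define P where "P = eis 3 Q"
  have F_slash: "slash k (F v) g \<tau> = F (residue_row Q (row_mult v g)) \<tau>"
    if "v \<in> V" "g \<in> SL2Z" "\<tau> \<in> upper_half_plane" for v g \<tau>
  proof -
    define v' where "v' = residue_row Q (row_mult v g)"
    have v': "v' \<in> V" using unimod_rows_mult that by (simp add: V_def v'_def)
    have "slash k (F v) g \<tau> = slash k f (rep v ** g) \<tau>"
      unfolding F_def using slash_mult rep(1) that by metis
    also have "\<dots> = slash k f (rep v') \<tau>"
    proof (rule inv)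
      have "residue_row Q (row_mult (0, 1) (rep v ** g)) =
        residue_row Q (row_mult (residue_row Q (row_mult (0, 1) (rep v))) g)"
        by (simp add: residue_row_mult row_mult_mult)
      thus "residue_row Q (row_mult (0, 1) (rep v ** g)) = residue_row Q (row_mult (0, 1) (rep v'))"
        using rep(2) that(1) v' by (simp add: v'_def)
    qed (use rep(1) that v' SL2Z_mult in auto)
    finally show ?thesis by (simp add: F_def v'_def)
  qed
  have P_slash: "slash 3 (P v) g \<tau> = P (residue_row Q (row_mult v g)) \<tau>"
    if "g \<in> SL2Z" "\<tau> \<in> upper_half_plane" for v g \<tau>
    using eis_slash[OF that] by (simp add: P_def eis_residue_row)
  have fin: "finite V" unfolding V_def by (rule finite_unimod_rows[OF Q0(1)])
  have P_exp: "fexp Q (P v) (eis_fps 3 Q v)" if "v \<in> V" for v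
    unfolding P_def by (rule fexp_eis) (use that unimod_rows_not_zero[OF Q0(2)] Q0 in \<open>auto simp: V_def\<close>)
  define c where "c i = (\<lambda>\<tau>. \<Sum>v\<in>V. F v \<tau> * P v \<tau> ^ i)" for i
  have c: "\<exists>\<gamma>. level_one (k + i * 3) (c i) \<and> fexp 1 (c i) \<gamma>" for i
  proof -
    have l: "level_one (k + i * 3) (c i)"
      unfolding c_def V_def
      by (rule level_one_sum_unimod_rows[OF Q0(1)])
         (simp add: slash_times slash_power F_slash[unfolded V_def] P_slash)
    have "\<forall>v\<in>V. \<exists>a. fexp Q (F v) a" using f rep(1) by (auto simp: F_def)
    then obtain \<phi> where "\<And>v. v \<in> V \<Longrightarrow> fexp Q (F v) (\<phi> v)" by metis
    hence "fexp Q (c i) (\<Sum>v\<in>V. \<phi> v * eis_fps 3 Q v ^ i)"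
      unfolding c_def by (intro fexp_sum fexp_mult fexp_power P_exp Q0) auto
    from fexp_descend[OF Q0(1) this] level_one_periodic[OF l] l show ?thesis by blast
  qed
  have "\<exists>W b a \<beta>. modring UNIV Q W b \<and> modring UNIV Q (W + (k + i * 3)) a \<and>
     (\<forall>\<tau>\<in>upper_half_plane. b \<tau> * c i \<tau> = a \<tau>) \<and> fexp 1 b \<beta> \<and> \<beta> \<noteq> 0" for i
  proof -
    obtain \<gamma> where "level_one (k + i * 3) (c i)" "fexp 1 (c i) \<gamma>" using c by blast
    then obtain W b a \<beta> where "modring UNIV Q W b" "modring UNIV Q (W + (k + i * 3)) a"
      "\<And>\<tau>. \<tau> \<in> upper_half_plane \<Longrightarrow> b \<tau> * c i \<tau> = a \<tau>" "fexp 1 b \<beta>" "\<beta> \<noteq> 0"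
      by (rule level_one_ratio[where Q = Q]) blast
    thus ?thesis by blast
  qed
  then obtain w b a \<beta> where ba: "\<And>i. modring UNIV Q (w i) (b i)" "\<And>i. modring UNIV Q (w i + (k + i * 3)) (a i)"
    "\<And>i \<tau>. \<tau> \<in> upper_half_plane \<Longrightarrow> b i \<tau> * c i \<tau> = a i \<tau>" "\<And>i. fexp 1 (b i) (\<beta> i)" "\<And>i. \<beta> i \<noteq> 0"
    by metis
  define v1 where "v1 = (0 :: int, 1 :: int)"
  have v1: "v1 \<in> V"
  proof -
    have "residue_row Q (row_mult (0, 1) (mat 1)) = v1" using Q by (simp add: v1_def residue_row_def)
    thus ?thesis using SL2Z_one unfolding V_def unimod_rows_def by (metis image_eqI)
  qed
  have Fv1: "F v1 \<tau> = f \<tau>" if "\<tau> \<in> upper_half_plane" for \<tau>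
  proof -
    have "slash k f (rep v1) \<tau> = slash k f (mat 1) \<tau>"
      by (rule inv) (use rep[OF v1] SL2Z_one that Q in \<open>auto simp: residue_row_def v1_def\<close>)
    thus ?thesis by (simp add: F_def)
  qed
  define U where "U = V - {v1}"
  define n where "n = card U"
  have U: "finite U" "V = insert v1 U" "v1 \<notin> U" using fin v1 by (auto simp: U_def)
  define D where "D = (\<lambda>\<tau>. \<Prod>u\<in>U. P v1 \<tau> + (- 1) * P u \<tau>)"
  \<comment> \<open>The polynomial with roots \<open>P u\<close> for \<open>u \<in> U\<close> kills
    every row except \<open>v1\<close>. Expanding it at \<open>P v\<close> and summing against
    \<open>F v\<close> turns the sum over rows into a combination of the traces
    \<open>c\<close>.\<close>
  have interp: "f \<tau> * D \<tau> = (\<Sum>S\<in>Pow U. (\<Prod>u\<in>S. (- 1) * P u \<tau>) * c (n - card S) \<tau>)"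
    if t: "\<tau> \<in> upper_half_plane" for \<tau>
  proof -
    have expand: "(\<Prod>u\<in>U. (- 1) * P u \<tau> + P v \<tau>) = (\<Sum>S\<in>Pow U. (\<Prod>u\<in>S. (- 1) * P u \<tau>) * P v \<tau> ^ (n - card S))" for v
      unfolding prod_add[OF U(1)]
      by (rule sum.cong) (use U(1) in \<open>auto simp: n_def card_Diff_subset finite_subset\<close>)
    have "(\<Sum>v\<in>V. F v \<tau> * (\<Prod>u\<in>U. (- 1) * P u \<tau> + P v \<tau>)) = F v1 \<tau> * (\<Prod>u\<in>U. (- 1) * P u \<tau> + P v1 \<tau>)"
    proof -
      have "(\<Prod>u\<in>U. (- 1) * P u \<tau> + P v \<tau>) = 0" if "v \<in> U" for v
        using U(1) that by (intro prod_zero) auto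
      hence "(\<Sum>v\<in>U. F v \<tau> * (\<Prod>u\<in>U. (- 1) * P u \<tau> + P v \<tau>)) = 0"
        by (intro sum.neutral ballI) (simp only: mult_zero_right)
      thus ?thesis unfolding U(2) sum.insert[OF U(1,3)] by (simp only: add_0_right)
    qed
    hence "f \<tau> * D \<tau> = (\<Sum>v\<in>V. F v \<tau> * (\<Prod>u\<in>U. (- 1) * P u \<tau> + P v \<tau>))"
      by (simp add: D_def Fv1[OF t] add.commute)
    also have "\<dots> = (\<Sum>v\<in>V. \<Sum>S\<in>Pow U. (\<Prod>u\<in>S. (- 1) * P u \<tau>) * (F v \<tau> * P v \<tau> ^ (n - card S)))"
      unfolding expand by (simp add: sum_distrib_left mult_ac)
    also have "\<dots> = (\<Sum>S\<in>Pow U. \<Sum>v\<in>V. (\<Prod>u\<in>S. (- 1) * P u \<tau>) * (F v \<tau> * P v \<tau> ^ (n - card S)))"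
      by (rule sum.swap)
    also have "\<dots> = (\<Sum>S\<in>Pow U. (\<Prod>u\<in>S. (- 1) * P u \<tau>) * c (n - card S) \<tau>)"
      by (simp add: c_def sum_distrib_left)
    finally show ?thesis .
  qed
  \<comment> \<open>The product of all \<open>b i\<close> clears the denominators of all traces at
    once; in \<open>B\<close> each summand loses the factor that its own trace uses up.\<close>
  define A where "A = (\<lambda>\<tau>. (\<Prod>i\<in>{..n}. b i \<tau>) * D \<tau>)"
  define B where "B = (\<lambda>\<tau>. \<Sum>S\<in>Pow U. (\<Prod>u\<in>S. (- 1) * P u \<tau>) * (a (n - card S) \<tau> * (\<Prod>i\<in>{..n} - {n - card S}. b i \<tau>)))"
  define W where "W = (\<Sum>i\<in>{..n}. w i) + (\<Sum>u\<in>U. 3)"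
  have P_mod: "modring UNIV Q 3 (P v)" if "v \<in> V" for v
    unfolding P_def by (rule modring.eis) (use that unimod_rows_not_zero[OF Q0(2)] in \<open>auto simp: V_def\<close>)
  have "modring UNIV Q W A" unfolding A_def D_def W_def using U(2) v1
    by (intro modring.mult modring_prod ba csubfield_UNIV modring.add modring_cmult P_mod) auto
  moreover have "modring UNIV Q (W + k) B" unfolding B_def
  proof (rule modring_sum)
    fix S assume S: "S \<in> Pow U"
    define i where "i = n - card S"
    have "card S \<le> n" using S U(1) by (auto simp: n_def card_mono)
    hence i: "i \<le> n" "card S + i = n" by (auto simp: i_def)
    have wt: "(\<Sum>u\<in>S. 3) + ((w i + (k + i * 3)) + (\<Sum>j\<in>{..n} - {i}. w j)) = W + k"
      using i sum.remove[of "{..n}" i w] by (simp add: W_def n_def[symmetric])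
    have M: "modring UNIV Q ((\<Sum>u\<in>S. 3) + ((w i + (k + i * 3)) + (\<Sum>j\<in>{..n} - {i}. w j)))
      (\<lambda>\<tau>. (\<Prod>u\<in>S. (- 1) * P u \<tau>) * (a i \<tau> * (\<Prod>i\<in>{..n} - {i}. b i \<tau>)))"
      using S U(2) by (intro modring.mult modring_prod ba csubfield_UNIV modring_cmult P_mod) auto
    from M[unfolded wt] show "modring UNIV Q (W + k)
        (\<lambda>\<tau>. (\<Prod>u\<in>S. (- 1) * P u \<tau>) * (a (n - card S) \<tau> * (\<Prod>i\<in>{..n} - {n - card S}. b i \<tau>)))"
      unfolding i_def .
  qed
  moreover have "A \<tau> * f \<tau> = B \<tau>" if t: "\<tau> \<in> upper_half_plane" for \<tau>
  proof -
    have "A \<tau> * f \<tau> = (\<Prod>i\<in>{..n}. b i \<tau>) * (f \<tau> * D \<tau>)" by (simp add: A_def mult_ac)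
    also have "\<dots> = (\<Sum>S\<in>Pow U. (\<Prod>i\<in>{..n}. b i \<tau>) * ((\<Prod>u\<in>S. (- 1) * P u \<tau>) * c (n - card S) \<tau>))"
      unfolding interp[OF t] by (rule sum_distrib_left)
    also have "\<dots> = B \<tau>" unfolding B_def
    proof (rule sum.cong[OF refl])
      fix S assume S: "S \<in> Pow U"
      define i where "i = n - card S"
      have "(\<Prod>i\<in>{..n}. b i \<tau>) = b i \<tau> * (\<Prod>j\<in>{..n} - {i}. b j \<tau>)"
        by (rule prod.remove) (auto simp: i_def)
      hence "(\<Prod>i\<in>{..n}. b i \<tau>) * ((\<Prod>u\<in>S. (- 1) * P u \<tau>) * c i \<tau>) =
         (\<Prod>u\<in>S. (- 1) * P u \<tau>) * ((b i \<tau> * c i \<tau>) * (\<Prod>j\<in>{..n} - {i}. b j \<tau>))"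
        by (simp only: mult_ac)
      thus "(\<Prod>i\<in>{..n}. b i \<tau>) * ((\<Prod>u\<in>S. (- 1) * P u \<tau>) * c (n - card S) \<tau>) =
         (\<Prod>u\<in>S. (- 1) * P u \<tau>) * (a (n - card S) \<tau> * (\<Prod>i\<in>{..n} - {n - card S}. b i \<tau>))"
        using ba(3)[OF t] by (simp only: i_def)
    qed
    finally show ?thesis .
  qed
  moreover define \<alpha> where "\<alpha> = (\<Prod>i\<in>{..n}. stretch_fps Q (\<beta> i)) * (\<Prod>u\<in>U. eis_fps 3 Q v1 + fps_const (- 1) * eis_fps 3 Q u)"
  have "fexp Q A \<alpha>"
  proof -
    have "fexp Q (b i) (stretch_fps Q (\<beta> i))" for i using fexp_ascend[OF Q0(1) ba(4)[of i]] by simp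
    thus ?thesis unfolding A_def D_def \<alpha>_def using U(2) v1
      by (intro fexp_mult fexp_prod fexp_add fexp_cmult P_exp Q0) auto
  qed
  moreover have "\<alpha> \<noteq> 0"
  proof -
    have "stretch_fps Q (\<beta> i) \<noteq> 0" for i
    proof
      assume z: "stretch_fps Q (\<beta> i) = 0"
      have "fps_nth (\<beta> i) n = fps_nth (stretch_fps Q (\<beta> i)) (Q * n)" for n using Q0 by (simp add: stretch_fps_def)
      hence "\<beta> i = 0" using z by (simp add: fps_eq_iff)
      thus False using ba(5) by blast
    qed
    moreover have "eis_fps 3 Q v1 + fps_const (- 1) * eis_fps 3 Q u \<noteq> 0" if "u \<in> U" for u
      using eis_fps_3_neq[OF Q, of u] that by (auto simp: U_def V_def v1_def simp flip: fps_const_neg)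
    ultimately show ?thesis using U(1) by (simp add: \<alpha>_def)
  qed
  ultimately show ?thesis by (rule that)
qed


section \<open>Descent of the relation to a smaller field\<close>

text \<open>Complex scalars enter only through constants, so they can be collected in front. Index
  sets are encoded in \<open>nat\<close> so that one index type serves the whole induction.\<close>

lemma modring_UNIV_span:
  assumes E: "csubfield E" and H: "modring UNIV Q W H"
  shows "\<exists>I x h. finite (I :: nat set) \<and> (\<forall>i\<in>I. modring E Q W (h i)) \<and> (\<forall>\<tau>. H \<tau> = (\<Sum>i\<in>I. x i * h i \<tau>))"
  using H
proof induction
  case (level_one w)
  thus ?case using modring.level_one[of w E Q]
    by (intro exI[of _ "{0}"] exI[of _ "\<lambda>_. 1"] exI[of _ "\<lambda>_. eis_one w"]) auto
next
  case (eis u)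
  thus ?case using modring.eis[of Q u E]
    by (intro exI[of _ "{0}"] exI[of _ "\<lambda>_. 1"] exI[of _ "\<lambda>_. eis 3 Q u"]) auto
next
  case (const c)
  show ?case using modring.const[OF csubfield_1[OF E], of Q]
    by (intro exI[of _ "{0}"] exI[of _ "\<lambda>_. c"] exI[of _ "\<lambda>_ _. 1"]) auto
next
  case (zero w)
  show ?case by (intro exI[of _ "{}"]) auto
next
  case (add w F G)
  obtain I x h where F: "finite (I :: nat set)" "\<And>i. i \<in> I \<Longrightarrow> modring E Q w (h i)"
     "\<And>\<tau>. F \<tau> = (\<Sum>i\<in>I. x i * h i \<tau>)" using add.IH(1) by blast
  obtain J y k where G: "finite (J :: nat set)" "\<And>j. j \<in> J \<Longrightarrow> modring E Q w (k j)"
     "\<And>\<tau>. G \<tau> = (\<Sum>j\<in>J. y j * k j \<tau>)" using add.IH(2) by blast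
  define z where "z = (\<lambda>n. case sum_decode n of Inl i \<Rightarrow> x i | Inr j \<Rightarrow> y j)"
  define l where "l = (\<lambda>n. case sum_decode n of Inl i \<Rightarrow> h i | Inr j \<Rightarrow> k j)"
  have "(\<Sum>n\<in>sum_encode ` (I <+> J). z n * l n \<tau>) = F \<tau> + G \<tau>" for \<tau>
    using F G by (subst sum.reindex) (auto simp: z_def l_def inj_sum_encode sum.Plus o_def)
  moreover have "modring E Q w (l n)" if "n \<in> sum_encode ` (I <+> J)" for n
    using that F(2) G(2) by (auto simp: l_def)
  moreover have "finite (sum_encode ` (I <+> J))" using F G by auto
  ultimately show ?case by (intro exI[of _ "sum_encode ` (I <+> J)"] exI[of _ z] exI[of _ l]) auto
next
  case (mult v F w G)
  obtain I x h where F: "finite (I :: nat set)" "\<And>i. i \<in> I \<Longrightarrow> modring E Q v (h i)"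
     "\<And>\<tau>. F \<tau> = (\<Sum>i\<in>I. x i * h i \<tau>)" using mult.IH(1) by blast
  obtain J y k where G: "finite (J :: nat set)" "\<And>j. j \<in> J \<Longrightarrow> modring E Q w (k j)"
     "\<And>\<tau>. G \<tau> = (\<Sum>j\<in>J. y j * k j \<tau>)" using mult.IH(2) by blast
  define z where "z = (\<lambda>n. case prod_decode n of (i, j) \<Rightarrow> x i * y j)"
  define l where "l = (\<lambda>n. case prod_decode n of (i, j) \<Rightarrow> \<lambda>\<tau>. h i \<tau> * k j \<tau>)"
  have "(\<Sum>n\<in>prod_encode ` (I \<times> J). z n * l n \<tau>) = F \<tau> * G \<tau>" for \<tau>
  proof -
    have "(\<Sum>n\<in>prod_encode ` (I \<times> J). z n * l n \<tau>) = (\<Sum>p\<in>I \<times> J. (case p of (i, j) \<Rightarrow> (x i * h i \<tau>) * (y j * k j \<tau>)))"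
      by (subst sum.reindex) (auto simp: z_def l_def inj_prod_encode mult_ac intro!: sum.cong)
    thus ?thesis by (simp add: F(3) G(3) sum_product sum.cartesian_product)
  qed
  moreover have "modring E Q (v + w) (l n)" if "n \<in> prod_encode ` (I \<times> J)" for n
    using that F(2) G(2) by (auto simp: l_def intro!: modring.mult)
  moreover have "finite (prod_encode ` (I \<times> J))" using F G by auto
  ultimately show ?case by (intro exI[of _ "prod_encode ` (I \<times> J)"] exI[of _ z] exI[of _ l]) auto
qed

definition independent_over :: "complex set \<Rightarrow> 'i set \<Rightarrow> ('i \<Rightarrow> complex) \<Rightarrow> bool" where
  "independent_over E J y \<longleftrightarrow>
     (\<forall>c. (\<forall>j\<in>J. c j \<in> E) \<and> (\<Sum>j\<in>J. c j * y j) = 0 \<longrightarrow> (\<forall>j\<in>J. c j = 0))"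

lemma independent_overD:
  "independent_over E J y \<Longrightarrow> (\<And>j. j \<in> J \<Longrightarrow> c j \<in> E) \<Longrightarrow> (\<Sum>j\<in>J. c j * y j) = 0 \<Longrightarrow> j \<in> J \<Longrightarrow> c j = 0"
  unfolding independent_over_def by blast

text \<open>A basis, taken from the family itself, of the \<open>E\<close>-space spanned by the
  scalars \<open>y\<close>, with coordinates \<open>e\<close>. An identity with such scalars then
  splits into identities over \<open>E\<close>.\<close>

lemma independent_subfamily:
  fixes y :: "'i \<Rightarrow> complex"
  assumes E: "csubfield E" and "finite I"
  shows "\<exists>J e. J \<subseteq> I \<and> independent_over E J y \<and>
     (\<forall>i\<in>I. (\<forall>j\<in>J. e i j \<in> E) \<and> y i = (\<Sum>j\<in>J. e i j * y j))"
  using assms(2)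
proof (induction I rule: finite_induct)
  case empty
  show ?case by (auto simp: independent_over_def)
next
  case (insert i I)
  then obtain J e where J: "J \<subseteq> I" "independent_over E J y"
    and e: "\<forall>i\<in>I. (\<forall>j\<in>J. e i j \<in> E) \<and> y i = (\<Sum>j\<in>J. e i j * y j)" by (elim exE conjE)
  have finJ: "finite J" "i \<notin> J" using J(1) insert by (auto intro: finite_subset)
  show ?case
  proof (cases "\<exists>d. (\<forall>j\<in>J. d j \<in> E) \<and> y i = (\<Sum>j\<in>J. d j * y j)")
    case True
    then obtain d where d: "\<And>j. j \<in> J \<Longrightarrow> d j \<in> E" "y i = (\<Sum>j\<in>J. d j * y j)" by blast
    show ?thesis
      by (rule exI[of _ J], rule exI[of _ "e(i := d)"]) (use J e d insert in \<open>auto\<close>)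
  next
    case False
    define e' where "e' = (\<lambda>i' j. if i' = i then (if j = i then 1 else 0) else if j = i then 0 else e i' j)"
    have e': "(\<forall>j\<in>insert i J. e' i' j \<in> E) \<and> y i' = (\<Sum>j\<in>insert i J. e' i' j * y j)" if "i' \<in> insert i I" for i'
    proof (cases "i' = i")
      case True
      have "(\<Sum>j\<in>J. e' i j * y j) = 0" using finJ by (intro sum.neutral) (auto simp: e'_def)
      thus ?thesis using True finJ csubfield_0[OF E] csubfield_1[OF E] by (auto simp: e'_def)
    next
      case False
      have "(\<Sum>j\<in>J. e' i' j * y j) = (\<Sum>j\<in>J. e i' j * y j)"
        using finJ False by (intro sum.cong) (auto simp: e'_def)
      thus ?thesis using False that finJ e csubfield_0[OF E] by (auto simp: e'_def)
    qed
    have ind: "independent_over E (insert i J) y"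
      unfolding independent_over_def
    proof (intro allI impI, elim conjE)
      fix c assume c: "\<forall>j\<in>insert i J. c j \<in> E" "(\<Sum>j\<in>insert i J. c j * y j) = 0"
      have s: "c i * y i + (\<Sum>j\<in>J. c j * y j) = 0" using c(2) finJ by simp
      have "c i = 0"
      proof (rule ccontr)
        assume ci: "c i \<noteq> 0"
        hence "y i = - (\<Sum>j\<in>J. c j * y j) / c i" using s by (simp add: field_simps add_eq_0_iff)
        also have "\<dots> = (\<Sum>j\<in>J. - c j / c i * y j)" by (simp add: sum_divide_distrib sum_negf)
        finally have "y i = (\<Sum>j\<in>J. - c j / c i * y j)" .
        moreover have "\<forall>j\<in>J. - c j / c i \<in> E"
          using c(1) by (auto intro!: csubfield_divide[OF E] csubfield_uminus[OF E])
        ultimately have "\<exists>d. (\<forall>j\<in>J. d j \<in> E) \<and> y i = (\<Sum>j\<in>J. d j * y j)"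
          by (intro exI[of _ "\<lambda>j. - c j / c i"] conjI)
        thus False using False by contradiction
      qed
      moreover have "(\<Sum>j\<in>J. c j * y j) = 0" using s \<open>c i = 0\<close> by simp
      hence "c j = 0" if "j \<in> J" for j
        by (rule independent_overD[OF J(2), rotated]) (use c(1) that in blast)+
      ultimately show "\<forall>j\<in>insert i J. c j = 0" by blast
    qed
    show ?thesis
    proof (rule exI[of _ "insert i J"], rule exI[of _ e'], intro conjI)
      show "insert i J \<subseteq> insert i I" using J(1) by (rule insert_mono)
      show "independent_over E (insert i J) y" by (rule ind)
      show "\<forall>i'\<in>insert i I. (\<forall>j\<in>insert i J. e' i' j \<in> E) \<and> y i' = (\<Sum>j\<in>insert i J. e' i' j * y j)"
        using e' by (rule ballI)
    qed
  qed
qed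

text \<open>The coefficients of \<open>b\<close> are solved for one after another, dividing each
  time by the lowest nonzero coefficient of \<open>a\<close>.\<close>

lemma coeffs_in_quotient:
  assumes E: "csubfield E" and a: "coeffs_in E a" "a \<noteq> 0" and ab: "coeffs_in E (a * b)"
  shows "coeffs_in E b"
proof -
  define m where "m = subdegree a"
  have am: "fps_nth a m \<noteq> 0" using a(2) by (simp add: m_def)
  have a0: "fps_nth a i = 0" if "i < m" for i 
    using nth_less_subdegree_zero that unfolding m_def by blast
  have "fps_nth b n \<in> E" for n
  proof (induction n rule: less_induct)
    case (less n)
    have "fps_nth (a * b) (m + n) = (\<Sum>i\<in>{0..m + n}. fps_nth a i * fps_nth b (m + n - i))"
      by (simp add: fps_mult_nth)
    also have "\<dots> = (\<Sum>i\<in>{m..m + n}. fps_nth a i * fps_nth b (m + n - i))"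
      by (rule sum.mono_neutral_right) (auto simp: a0)
    also have "\<dots> = fps_nth a m * fps_nth b n + (\<Sum>i\<in>{m<..m + n}. fps_nth a i * fps_nth b (m + n - i))"
      by (subst sum.head) auto
    finally have "fps_nth b n = (fps_nth (a * b) (m + n) - (\<Sum>i\<in>{m<..m + n}. fps_nth a i * fps_nth b (m + n - i))) / fps_nth a m"
      using am by simp
    moreover have "(\<Sum>i\<in>{m<..m + n}. fps_nth a i * fps_nth b (m + n - i)) \<in> E"
      using a(1) less by (intro csubfield_sum[OF E] csubfield_mult[OF E]) (auto simp: coeffs_in_def)
    ultimately show ?case using a(1) ab
      by (auto simp: coeffs_in_def intro!: csubfield_divide[OF E] csubfield_diff[OF E])
  qed
  thus ?thesis by (simp add: coeffs_in_def)
qed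

lemma fexp_slash_one: "fexp Q (slash k F (mat 1)) a \<longleftrightarrow> fexp Q F a"
  by simp

text \<open>The equation \<open>A * f = B\<close> is linear in the coefficients of \<open>A\<close> and \<open>B\<close>, so a solution over the
  complex numbers yields one over the field of the Fourier coefficients.\<close>

lemma modular_relation_over:
  assumes E: "csubfield E" and z: "zeta Q \<in> E" and Q: "Q > 1"
    and \<phi>: "fexp Q f \<phi>" "coeffs_in E \<phi>"
    and AB: "modring UNIV Q W A" "modring UNIV Q W' B" "\<And>\<tau>. \<tau> \<in> upper_half_plane \<Longrightarrow> A \<tau> * f \<tau> = B \<tau>"
      "fexp Q A \<alpha>" "\<alpha> \<noteq> 0"
  obtains A' B' \<alpha>' where "modring E Q W A'" "modring E Q W' B'"
    "\<And>\<tau>. \<tau> \<in> upper_half_plane \<Longrightarrow> A' \<tau> * f \<tau> = B' \<tau>" "fexp Q A' \<alpha>'" "\<alpha>' \<noteq> 0"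
proof -
  have Q0: "Q > 0" using Q by simp
  obtain I x h where A: "finite (I :: nat set)" "\<And>i. i \<in> I \<Longrightarrow> modring E Q W (h i)" "\<And>\<tau>. A \<tau> = (\<Sum>i\<in>I. x i * h i \<tau>)"
    using modring_UNIV_span[OF E AB(1)] by blast
  obtain I' x' h' where B: "finite (I' :: nat set)" "\<And>i. i \<in> I' \<Longrightarrow> modring E Q W' (h' i)" "\<And>\<tau>. B \<tau> = (\<Sum>i\<in>I'. x' i * h' i \<tau>)"
    using modring_UNIV_span[OF E AB(2)] by blast
  define y where "y = (\<lambda>i. case i of Inl i \<Rightarrow> x i | Inr i \<Rightarrow> x' i)"
  have "finite (I <+> I')" using A B by simp
  from independent_subfamily[OF E this, of y] obtain J e where J1: "J \<subseteq> I <+> I'" "independent_over E J y"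
    "\<forall>i\<in>I <+> I'. (\<forall>j\<in>J. e i j \<in> E) \<and> y i = (\<Sum>j\<in>J. e i j * y j)" by (elim exE conjE)
  note J = J1(1) independent_overD[OF J1(2)]
  have J3: "e i j \<in> E" if "i \<in> I <+> I'" "j \<in> J" for i j using J1(3) that by blast
  have J4: "y i = (\<Sum>j\<in>J. e i j * y j)" if "i \<in> I <+> I'" for i using J1(3) that by blast
  have finJ: "finite J" using J(1) A(1) B(1) by (auto intro: finite_subset)
  define A1 where "A1 j = (\<lambda>\<tau>. \<Sum>i\<in>I. e (Inl i) j * h i \<tau>)" for j
  define B1 where "B1 j = (\<lambda>\<tau>. \<Sum>i\<in>I'. e (Inr i) j * h' i \<tau>)" for j
  have A1: "modring E Q W (A1 j)" and B1: "modring E Q W' (B1 j)" if "j \<in> J" for j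
    unfolding A1_def B1_def using A(2) B(2) that by (auto intro!: modring_sum modring_cmult J3)
  have A_eq: "A \<tau> = (\<Sum>j\<in>J. y j * A1 j \<tau>)" for \<tau>
  proof -
    have "A \<tau> = (\<Sum>i\<in>I. y (Inl i) * h i \<tau>)" by (simp add: A(3) y_def)
    also have "\<dots> = (\<Sum>i\<in>I. \<Sum>j\<in>J. y j * (e (Inl i) j * h i \<tau>))"
      by (intro sum.cong refl) (subst J4, auto simp: sum_distrib_left sum_distrib_right mult_ac)
    also have "\<dots> = (\<Sum>j\<in>J. y j * A1 j \<tau>)" by (subst sum.swap) (simp add: A1_def sum_distrib_left)
    finally show ?thesis .
  qed
  have B_eq: "B \<tau> = (\<Sum>j\<in>J. y j * B1 j \<tau>)" for \<tau>
  proof -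
    have "B \<tau> = (\<Sum>i\<in>I'. y (Inr i) * h' i \<tau>)" by (simp add: B(3) y_def)
    also have "\<dots> = (\<Sum>i\<in>I'. \<Sum>j\<in>J. y j * (e (Inr i) j * h' i \<tau>))"
      by (intro sum.cong refl) (subst J4, auto simp: sum_distrib_left sum_distrib_right mult_ac)
    also have "\<dots> = (\<Sum>j\<in>J. y j * B1 j \<tau>)" by (subst sum.swap) (simp add: B1_def sum_distrib_left)
    finally show ?thesis .
  qed
  have "\<exists>a. coeffs_in E a \<and> fexp Q H a" if "modring E Q w H" for w H
    using modring_fexp[OF E z Q that SL2Z_one] unfolding fexp_slash_one by blast
  hence "\<forall>j\<in>J. \<exists>a. coeffs_in E a \<and> fexp Q (A1 j) a" "\<forall>j\<in>J. \<exists>a. coeffs_in E a \<and> fexp Q (B1 j) a"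
    using A1 B1 by blast+
  then obtain a b where a: "\<And>j. j \<in> J \<Longrightarrow> coeffs_in E (a j)" "\<And>j. j \<in> J \<Longrightarrow> fexp Q (A1 j) (a j)"
    and b: "\<And>j. j \<in> J \<Longrightarrow> coeffs_in E (b j)" "\<And>j. j \<in> J \<Longrightarrow> fexp Q (B1 j) (b j)" by metis
  have "fexp Q A (\<Sum>j\<in>J. fps_const (y j) * a j)"
    unfolding A_eq [abs_def] by (intro fexp_sum fexp_cmult a)
  hence \<alpha>: "\<alpha> = (\<Sum>j\<in>J. fps_const (y j) * a j)" using AB(4) fexp_unique[OF Q0] by blast
  have "fexp Q B (\<Sum>j\<in>J. fps_const (y j) * b j)"
    unfolding B_eq [abs_def] by (intro fexp_sum fexp_cmult b)
  moreover have "fexp Q B (\<alpha> * \<phi>)"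
    using fexp_mult[OF Q0 AB(4) \<phi>(1)] fexp_cong[of "\<lambda>\<tau>. A \<tau> * f \<tau>" B] AB(3) by blast
  ultimately have "\<alpha> * \<phi> = (\<Sum>j\<in>J. fps_const (y j) * b j)" using fexp_unique[OF Q0] by blast
  hence rel: "(\<Sum>j\<in>J. fps_const (y j) * (a j * \<phi> - b j)) = 0"
    by (simp add: \<alpha> sum_distrib_right right_diff_distrib sum_subtractf mult.assoc)
  \<comment> \<open>All coefficients of \<open>a j * \<phi> - b j\<close> lie in \<open>E\<close>,
    so independence of the \<open>y j\<close> splits the single relation \<open>rel\<close> into one
    relation for each \<open>j\<close>.\<close>
  have eq: "a j * \<phi> = b j" if "j \<in> J" for j
  proof (rule fps_ext)
    fix n
    have "(\<Sum>j\<in>J. fps_nth (a j * \<phi> - b j) n * y j) = fps_nth (\<Sum>j\<in>J. fps_const (y j) * (a j * \<phi> - b j)) n"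
      by (simp add: fps_sum_nth mult.commute)
    also have "\<dots> = 0" by (simp add: rel)
    finally have s: "(\<Sum>j\<in>J. fps_nth (a j * \<phi> - b j) n * y j) = 0" .
    have "fps_nth (a j * \<phi> - b j) n \<in> E" if "j \<in> J" for j
      using coeffs_in_mult[OF E field_embedding_id a(1)[OF that] \<phi>(2)] b(1)[OF that]
      by (auto simp: coeffs_in_def intro!: csubfield_diff[OF E])
    from J(2)[OF this s that] show "fps_nth (a j * \<phi>) n = fps_nth (b j) n" by simp
  qed
  have "\<exists>j\<in>J. a j \<noteq> 0"
  proof (rule ccontr)
    assume "\<not> ?thesis"
    hence "\<alpha> = 0" unfolding \<alpha> by (intro sum.neutral) auto
    thus False using AB(5) by contradiction
  qed
  then obtain j where j: "j \<in> J" "a j \<noteq> 0" by blast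
  have "A1 j \<tau> * f \<tau> = B1 j \<tau>" if "\<tau> \<in> upper_half_plane" for \<tau>
    using fexp_eqD[OF fexp_mult[OF Q0 a(2)[OF j(1)] \<phi>(1), unfolded eq[OF j(1)]] b(2)[OF j(1)] that] .
  with that[OF A1[OF j(1)] B1[OF j(1)] _ a(2)[OF j(1)] j(2)] show ?thesis by blast
qed

text \<open>At the identity, \<open>s\<close> turns \<open>A * f = B\<close> into
  \<open>A' * f = B'\<close>, because it fixes the expansion of \<open>f\<close>. The latter slashed
  by \<open>h\<close> is compared with the image under \<open>s\<close> of the former slashed by
  \<open>g\<close>; cancelling the nonzero series \<open>map_fps s a\<close> leaves the
  claim.\<close>

theorem galois_action_on_expansions:
  assumes E: "csubfield E" and s: "field_embedding E s" and z: "zeta Q \<in> E" "s (zeta Q) = zeta Q powi l"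
    and Q: "Q \<ge> 3" and l: "coprime l (int Q)"
    and f: "\<And>g. g \<in> SL2Z \<Longrightarrow> \<exists>a. fexp Q (slash k f g) a"
    and inv: "\<And>g h \<tau>. g \<in> SL2Z \<Longrightarrow> h \<in> SL2Z \<Longrightarrow> \<tau> \<in> upper_half_plane \<Longrightarrow>
      residue_row Q (row_mult (0, 1) g) = residue_row Q (row_mult (0, 1) h) \<Longrightarrow> slash k f g \<tau> = slash k f h \<tau>"
    and \<phi>: "fexp Q f \<phi>" "coeffs_in E \<phi>" "map_fps s \<phi> = \<phi>"
    and gh: "g \<in> SL2Z" "h \<in> SL2Z" "twisted Q l g h"
  shows "\<exists>a. coeffs_in E a \<and> fexp Q (slash k f g) a \<and> fexp Q (slash k f h) (map_fps s a)"
proof -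
  have Q1: "Q > 1" "Q > 0" using Q by auto
  obtain W A0 B0 \<alpha>0 where AB0: "modring UNIV Q W A0" "modring UNIV Q (W + k) B0"
    "\<And>\<tau>. \<tau> \<in> upper_half_plane \<Longrightarrow> A0 \<tau> * f \<tau> = B0 \<tau>" "fexp Q A0 \<alpha>0" "\<alpha>0 \<noteq> 0"
    using modular_relation[OF Q f inv] by blast
  obtain A B \<alpha> where AB: "modring E Q W A" "modring E Q (W + k) B"
    "\<And>\<tau>. \<tau> \<in> upper_half_plane \<Longrightarrow> A \<tau> * f \<tau> = B \<tau>" "fexp Q A \<alpha>" "\<alpha> \<noteq> 0"
    using modular_relation_over[OF E z(1) Q1(1) \<phi>(1,2) AB0] by blast
  have slash_rel: "slash W A g \<tau> * slash k f g \<tau> = slash (W + k) B g \<tau>"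
    if "g \<in> SL2Z" "\<tau> \<in> upper_half_plane" "\<And>\<tau>. \<tau> \<in> upper_half_plane \<Longrightarrow> A \<tau> * f \<tau> = B \<tau>" for A B g \<tau>
    unfolding slash_times[symmetric] by (rule slash_cong) (use that in auto)
  obtain A' where A': "\<And>g h. g \<in> SL2Z \<Longrightarrow> h \<in> SL2Z \<Longrightarrow> twisted Q l g h \<Longrightarrow>
     (\<exists>a. coeffs_in E a \<and> fexp Q (slash W A g) a \<and> fexp Q (slash W A' h) (map_fps s a))"
    using modring_twist[OF E s z Q1(1) l AB(1)] by blast
  obtain B' where B': "\<And>g h. g \<in> SL2Z \<Longrightarrow> h \<in> SL2Z \<Longrightarrow> twisted Q l g h \<Longrightarrow>
     (\<exists>a. coeffs_in E a \<and> fexp Q (slash (W + k) B g) a \<and> fexp Q (slash (W + k) B' h) (map_fps s a))"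
    using modring_twist[OF E s z Q1(1) l AB(2)] by blast
  have tw1: "twisted Q l (mat 1) (mat 1)" by (simp add: twisted_def mat_def)
  obtain a1 where a1: "coeffs_in E a1" "fexp Q A a1" "fexp Q A' (map_fps s a1)"
    using A'[OF SL2Z_one SL2Z_one tw1] by auto
  obtain b1 where b1: "coeffs_in E b1" "fexp Q B b1" "fexp Q B' (map_fps s b1)"
    using B'[OF SL2Z_one SL2Z_one tw1] by auto
  have "fexp Q B (a1 * \<phi>)"
    using fexp_mult[OF Q1(2) a1(2) \<phi>(1)] fexp_cong[of "\<lambda>\<tau>. A \<tau> * f \<tau>" B] AB(3) by blast
  hence "a1 * \<phi> = b1" using b1(2) fexp_unique[OF Q1(2)] by blast
  hence "map_fps s a1 * \<phi> = map_fps s b1" using map_fps_mult[OF E s a1(1) \<phi>(2)] \<phi>(3) by simp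
  hence rel': "A' \<tau> * f \<tau> = B' \<tau>" if "\<tau> \<in> upper_half_plane" for \<tau>
    using fexp_eqD[OF fexp_mult[OF Q1(2) a1(3) \<phi>(1)] _ that] b1(3) by simp
  obtain a where a: "coeffs_in E a" "fexp Q (slash W A g) a" "fexp Q (slash W A' h) (map_fps s a)"
    using A'[OF gh] by blast
  obtain b where b: "coeffs_in E b" "fexp Q (slash (W + k) B g) b" "fexp Q (slash (W + k) B' h) (map_fps s b)"
    using B'[OF gh] by blast
  obtain \<psi> where \<psi>: "fexp Q (slash k f g) \<psi>" using f gh by blast
  obtain \<psi>' where \<psi>': "fexp Q (slash k f h) \<psi>'" using f gh by blast
  have "fexp Q (slash (W + k) B g) (a * \<psi>)"
    using fexp_mult[OF Q1(2) a(2) \<psi>] slash_rel[OF gh(1) _ AB(3)]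
      fexp_cong[of "\<lambda>\<tau>. slash W A g \<tau> * slash k f g \<tau>" "slash (W + k) B g"] by blast
  hence ab: "a * \<psi> = b" using b(2) fexp_unique[OF Q1(2)] by blast
  have "fexp Q (slash (W + k) B' h) (map_fps s a * \<psi>')"
    using fexp_mult[OF Q1(2) a(3) \<psi>'] slash_rel[OF gh(2) _ rel']
      fexp_cong[of "\<lambda>\<tau>. slash W A' h \<tau> * slash k f h \<tau>" "slash (W + k) B' h"] by blast
  hence ab': "map_fps s a * \<psi>' = map_fps s b" using b(3) fexp_unique[OF Q1(2)] by blast
  \<comment> \<open>If the expansion of \<open>A\<close> slashed by \<open>g\<close> were zero,
    slashing back by the inverse matrix would give \<open>A = 0\<close>.\<close>
  have a0: "a \<noteq> 0"
  proof
    assume "a = 0"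
    have "A \<tau> = 0" if t: "\<tau> \<in> upper_half_plane" for \<tau>
    proof -
      let ?i = "SL2_inv g"
      have i: "?i \<in> SL2Z" by (rule SL2_inv_in[OF gh(1)])
      have "fexp Q (\<lambda>_. 0) 0" using fexp_const[of Q 0] by simp
      hence "slash W A g \<sigma> = 0" if "\<sigma> \<in> upper_half_plane" for \<sigma>
        using fexp_eqD[OF a(2)[unfolded \<open>a = 0\<close>] _ that] by blast
      moreover have "A \<tau> = slash W (slash W A g) ?i \<tau>"
        using slash_mult[OF gh(1) i t, of W A] SL2_inv_right[OF gh(1)] by simp
      ultimately show ?thesis using mob_upper[OF i t] by (simp add: slash_eq)
    qed
    hence "fexp Q A 0" using fexp_cong[of A "\<lambda>_. 0" Q 0] fexp_const[of Q 0] by simp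
    thus False using AB(4,5) fexp_unique[OF Q1(2)] by blast
  qed
  have \<psi>E: "coeffs_in E \<psi>" by (rule coeffs_in_quotient[OF E a(1) a0]) (simp add: ab b(1))
  have "map_fps s a * map_fps s \<psi> = map_fps s b" using map_fps_mult[OF E s a(1) \<psi>E] by (simp add: ab)
  with ab' have "map_fps s a * \<psi>' = map_fps s a * map_fps s \<psi>" by simp
  moreover have "map_fps s a \<noteq> 0" using map_fps_eq_0_iff[OF E s a(1)] a0 by simp
  ultimately have "\<psi>' = map_fps s \<psi>" by simp
  thus ?thesis using \<psi> \<psi>' \<psi>E by blast
qed

section \<open>Embeddings of cyclotomic extensions\<close>

lemma complex_field_ops:
  "\<one>\<^bsub>complex_field\<^esub> = (1 :: complex)" "\<zero>\<^bsub>complex_field\<^esub> = (0 :: complex)"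
  "x \<otimes>\<^bsub>complex_field\<^esub> y = (x * y :: complex)" "x \<oplus>\<^bsub>complex_field\<^esub> y = (x + y :: complex)"
  "\<ominus>\<^bsub>complex_field\<^esub> x = (- x :: complex)"
  "x \<noteq> 0 \<Longrightarrow> inv\<^bsub>complex_field\<^esub> x = inverse (x :: complex)"
proof -
  interpret field complex_field by (rule field_from_type_algebra)
  show ops: "\<one>\<^bsub>complex_field\<^esub> = (1 :: complex)" "\<zero>\<^bsub>complex_field\<^esub> = (0 :: complex)"
    "x \<otimes>\<^bsub>complex_field\<^esub> y = (x * y :: complex)" "x \<oplus>\<^bsub>complex_field\<^esub> y = (x + y :: complex)" for x y
    by (simp_all add: ring_of_type_algebra_def)
  have carrier: "carrier complex_field = (UNIV :: complex set)" by (simp add: ring_of_type_algebra_def)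
  show "\<ominus>\<^bsub>complex_field\<^esub> x = (- x :: complex)"
    using minus_equality[of "- x" x] by (simp add: ops carrier)
  show "x \<noteq> 0 \<Longrightarrow> inv\<^bsub>complex_field\<^esub> x = inverse (x :: complex)"
    using comm_inv_char[of x "inverse x"] by (simp add: ops carrier)
qed

lemma csubfield_generate_field: "csubfield (generate_field complex_field H)"
proof -
  let ?F = "generate_field complex_field H"
  have add: "x + y \<in> ?F" and mult: "x * y \<in> ?F" if "x \<in> ?F" "y \<in> ?F" for x y
    using generate_field.eng_add[OF that] generate_field.eng_mult[OF that] by (simp_all add: complex_field_ops)
  have um: "- x \<in> ?F" if "x \<in> ?F" for x
    using generate_field.a_inv[OF that] by (simp add: complex_field_ops)
  have one: "1 \<in> ?F" using generate_field.one[of complex_field H] by (simp add: complex_field_ops)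
  have zero: "0 \<in> ?F" using add[OF one um[OF one]] by simp
  have "inverse x \<in> ?F" if "x \<in> ?F" for x
    using generate_field.m_inv[OF that] zero by (cases "x = 0") (simp_all add: complex_field_ops)
  moreover have "x - y \<in> ?F" if "x \<in> ?F" "y \<in> ?F" for x y
    using add[OF that(1) um[OF that(2)]] by simp
  ultimately show ?thesis using one mult by (simp add: csubfield_def)
qed

lemma generate_field_least:
  assumes S: "csubfield S" and H: "H \<subseteq> S"
  shows "generate_field complex_field H \<subseteq> S"
proof
  fix x assume "x \<in> generate_field complex_field H"
  thus "x \<in> S"
    by induction (use H in \<open>auto simp: complex_field_ops csubfield_1[OF S] csubfield_add[OF S]
      csubfield_mult[OF S] csubfield_uminus[OF S] csubfield_inverse[OF S]\<close>)
qed

lemma csubfield_adjoin: "csubfield (adjoin F x)"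
  and adjoin_subset: "F \<subseteq> adjoin F x"
  and adjoin_mem: "x \<in> adjoin F x"
  and adjoin_least: "csubfield S \<Longrightarrow> F \<subseteq> S \<Longrightarrow> x \<in> S \<Longrightarrow> adjoin F x \<subseteq> S"
  unfolding adjoin_def
  by (auto simp: csubfield_generate_field intro: generate_field.incl dest: generate_field_least[of S "insert x F", THEN subsetD])

section \<open>Polynomials over a subfield and extension of embeddings\<close>

definition poly_over :: "complex set \<Rightarrow> complex poly \<Rightarrow> bool" where
  "poly_over L p \<longleftrightarrow> (\<forall>i. Polynomial.coeff p i \<in> L)"

text \<open>The ring \<open>L[x]\<close>. For \<open>x\<close> algebraic over \<open>L\<close> it is
  a field, and its elements come as polynomial values, on which an embedding can be
  prescribed.\<close>

definition poly_values :: "complex set \<Rightarrow> complex \<Rightarrow> complex set" where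
  "poly_values L x = {poly p x |p. poly_over L p}"

lemma unity_poly_nonzero: 
  assumes "n > 0" shows "(Polynomial.monom 1 n - 1 :: complex poly) \<noteq> 0"
proof
  assume "(Polynomial.monom 1 n - 1 :: complex poly) = 0"
  hence "Polynomial.coeff (Polynomial.monom 1 n - 1 :: complex poly) 0 = 0" by simp
  thus False using assms by simp
qed

context
  fixes L assumes L: "csubfield L"
begin

lemma poly_over_0: "poly_over L 0" and poly_over_1: "poly_over L 1"
  by (auto simp: poly_over_def csubfield_0[OF L] csubfield_1[OF L])

lemma poly_over_const: "c \<in> L \<Longrightarrow> poly_over L [:c:]"
  by (auto simp: poly_over_def coeff_pCons csubfield_0[OF L] split: nat.split)

lemma poly_over_monom: "c \<in> L \<Longrightarrow> poly_over L (Polynomial.monom c n)"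
  by (auto simp: poly_over_def csubfield_0[OF L])

lemma poly_over_add: "poly_over L p \<Longrightarrow> poly_over L q \<Longrightarrow> poly_over L (p + q)"
  by (auto simp: poly_over_def csubfield_add[OF L])

lemma poly_over_diff: "poly_over L p \<Longrightarrow> poly_over L q \<Longrightarrow> poly_over L (p - q)"
  by (auto simp: poly_over_def csubfield_diff[OF L])

lemma poly_over_mult: "poly_over L p \<Longrightarrow> poly_over L q \<Longrightarrow> poly_over L (p * q)"
  by (auto simp: poly_over_def coeff_mult csubfield_mult[OF L] intro!: csubfield_sum[OF L])

text \<open>Long division, followed step by step so that quotient and remainder stay over
  \<open>L\<close>.\<close>

lemma poly_over_division:
  assumes "poly_over L a" "poly_over L m" "m \<noteq> 0"
  shows "\<exists>q r. poly_over L q \<and> poly_over L r \<and> a = q * m + r \<and> (r = 0 \<or> Polynomial.degree r < Polynomial.degree m)"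
  using assms(1)
proof (induction "Polynomial.degree a" arbitrary: a rule: less_induct)
  case less
  show ?case
  proof (cases "a = 0 \<or> Polynomial.degree a < Polynomial.degree m")
    case True
    thus ?thesis using less.prems poly_over_0 by (intro exI[of _ 0] exI[of _ a]) auto
  next
    case False
    define t where "t = Polynomial.monom (Polynomial.lead_coeff a / Polynomial.lead_coeff m) (Polynomial.degree a - Polynomial.degree m)"
    have t: "poly_over L t" unfolding t_def
      using less.prems assms(2) by (intro poly_over_monom csubfield_divide[OF L]) (auto simp: poly_over_def)
    define a' where "a' = a - t * m"
    have a': "poly_over L a'" unfolding a'_def by (intro poly_over_diff poly_over_mult t less.prems assms)
    have lc: "Polynomial.coeff (t * m) (Polynomial.degree a) = Polynomial.lead_coeff a"
      using False assms(3) by (auto simp: t_def coeff_monom_mult)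
    have dt: "Polynomial.degree (t * m) \<le> Polynomial.degree a"
      using degree_mult_le[of t m] degree_monom_le[of "Polynomial.lead_coeff a / Polynomial.lead_coeff m" "Polynomial.degree a - Polynomial.degree m"] False
      unfolding t_def by linarith
    have "Polynomial.degree a' \<le> Polynomial.degree a" unfolding a'_def using dt by (simp add: degree_diff_le)
    moreover have "Polynomial.coeff a' (Polynomial.degree a) = 0" using lc by (simp add: a'_def)
    ultimately have "a' = 0 \<or> Polynomial.degree a' < Polynomial.degree a"
      by (metis leading_coeff_0_iff le_neq_implies_less)
    thus ?thesis
    proof
      assume "a' = 0"
      thus ?thesis using t poly_over_0 by (intro exI[of _ t] exI[of _ 0]) (auto simp: a'_def)
    next
      assume "Polynomial.degree a' < Polynomial.degree a"
      from less.hyps[OF this a'] obtain q r where qr: "poly_over L q" "poly_over L r" "a' = q * m + r"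
        "r = 0 \<or> Polynomial.degree r < Polynomial.degree m" by blast
      have "a = (q + t) * m + r" using qr(3) by (simp add: a'_def algebra_simps)
      thus ?thesis using qr t by (intro exI[of _ "q + t"] exI[of _ r]) (auto intro: poly_over_add)
    qed
  qed
qed

lemma minimal_poly_exists:
  assumes p: "poly_over L p" "p \<noteq> 0" "poly p x = 0"
  obtains m where "poly_over L m" "m \<noteq> 0" "poly m x = 0"
    "\<And>q. poly_over L q \<Longrightarrow> poly q x = 0 \<Longrightarrow> \<exists>c. poly_over L c \<and> q = c * m"
    "\<And>q. poly_over L q \<Longrightarrow> poly q x = 0 \<Longrightarrow> Polynomial.degree q < Polynomial.degree m \<Longrightarrow> q = 0"
proof -
  obtain m where m: "poly_over L m \<and> m \<noteq> 0 \<and> poly m x = 0"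
    "\<And>q. poly_over L q \<and> q \<noteq> 0 \<and> poly q x = 0 \<Longrightarrow> Polynomial.degree m \<le> Polynomial.degree q"
    using ex_has_least_nat[of "\<lambda>q. poly_over L q \<and> q \<noteq> 0 \<and> poly q x = 0" p Polynomial.degree] p by blast
  have min: "q = 0" if "poly_over L q" "poly q x = 0" "Polynomial.degree q < Polynomial.degree m" for q
    using m(2)[of q] that by auto
  have "\<exists>c. poly_over L c \<and> q = c * m" if q: "poly_over L q" "poly q x = 0" for q
  proof -
    obtain c r where cr: "poly_over L c" "poly_over L r" "q = c * m + r" "r = 0 \<or> Polynomial.degree r < Polynomial.degree m"
      using poly_over_division[OF q(1)] m(1) by blast
    have "poly r x = 0" using q(2) m(1) by (simp add: cr(3))
    hence "r = 0" using min cr by blast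
    thus ?thesis using cr by auto
  qed
  with that m(1) min show ?thesis by blast
qed

lemma poly_values_superset: "L \<subseteq> poly_values L x" "x \<in> poly_values L x"
proof
  fix c assume "c \<in> L"
  thus "c \<in> poly_values L x" using poly_over_const[of c] by (force simp: poly_values_def)
next
  have "poly_over L (Polynomial.monom 1 1)" by (rule poly_over_monom[OF csubfield_1[OF L]])
  thus "x \<in> poly_values L x" unfolding poly_values_def by (force simp: poly_monom)
qed

text \<open>To invert \<open>a(x) \<noteq> 0\<close>, take a nonzero combination
  \<open>d = u a + v m\<close> of least degree, \<open>m\<close> being the minimal polynomial. It
  divides both \<open>a\<close> and \<open>m\<close>. As \<open>d(x) \<noteq> 0\<close>, the
  cofactor of \<open>d\<close> in \<open>m\<close> kills \<open>x\<close>, so \<open>d\<close> is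
  constant by minimality and \<open>u(x) / d\<close> is the inverse.\<close>

lemma csubfield_poly_values:
  assumes p: "poly_over L p" "p \<noteq> 0" "poly p x = 0"
  shows "csubfield (poly_values L x)"
proof -
  obtain m where m: "poly_over L m" "m \<noteq> 0" "poly m x = 0"
    "\<And>q. poly_over L q \<Longrightarrow> poly q x = 0 \<Longrightarrow> \<exists>c. poly_over L c \<and> q = c * m"
    "\<And>q. poly_over L q \<Longrightarrow> poly q x = 0 \<Longrightarrow> Polynomial.degree q < Polynomial.degree m \<Longrightarrow> q = 0"
    using minimal_poly_exists[OF p] by blast
  have inverse: "inverse (poly a x) \<in> poly_values L x" if a: "poly_over L a" for a
  proof (cases "poly a x = 0")
    case True
    thus ?thesis using poly_values_superset(1) csubfield_0[OF L] by auto
  next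
    case False
    define I where "I d \<longleftrightarrow> d \<noteq> 0 \<and> (\<exists>u v. poly_over L u \<and> poly_over L v \<and> d = u * a + v * m)" for d
    have "I m" unfolding I_def using m(2) poly_over_0 poly_over_1
      by (intro conjI exI[of _ 0] exI[of _ 1]) auto
    then obtain d where d: "I d" "\<And>d'. I d' \<Longrightarrow> Polynomial.degree d \<le> Polynomial.degree d'"
      using ex_has_least_nat[of I m Polynomial.degree] by blast
    then obtain u v where uv: "poly_over L u" "poly_over L v" "d = u * a + v * m" "d \<noteq> 0" by (auto simp: I_def)
    have dL: "poly_over L d" unfolding uv(3) by (intro poly_over_add poly_over_mult uv a m)
    have div: "\<exists>q. poly_over L q \<and> e = q * d"
      if e: "poly_over L e" "e = u' * a + v' * m" "poly_over L u'" "poly_over L v'" for e u' v'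
    proof -
      obtain q r where qr: "poly_over L q" "poly_over L r" "e = q * d + r" "r = 0 \<or> Polynomial.degree r < Polynomial.degree d"
        using poly_over_division[OF e(1) dL uv(4)] by blast
      have "r = (u' - q * u) * a + (v' - q * v) * m" using qr(3) e(2) by (simp add: uv(3) algebra_simps)
      hence "r \<noteq> 0 \<Longrightarrow> I r" unfolding I_def using e uv qr
        by (intro conjI exI[of _ "u' - q * u"] exI[of _ "v' - q * v"]) (auto intro!: poly_over_diff poly_over_mult)
      hence "r = 0" using d(2) qr(4) by fastforce
      thus ?thesis using qr by auto
    qed
    obtain qa where qa: "a = qa * d" using div[of a 1 0] a poly_over_0 poly_over_1 by auto
    obtain qm where qm: "poly_over L qm" "m = qm * d" using div[of m 0 1] m(1) poly_over_0 poly_over_1 by auto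
    have dx: "poly d x \<noteq> 0" using False qa by auto
    hence "poly qm x = 0" using m(3) qm(2) by simp
    moreover have "qm \<noteq> 0" using qm m(2) by auto
    moreover have "Polynomial.degree m = Polynomial.degree qm + Polynomial.degree d"
      unfolding qm(2) by (rule degree_mult_eq) (use \<open>qm \<noteq> 0\<close> uv in auto)
    ultimately have "Polynomial.degree d = 0" using m(5)[OF qm(1)] by fastforce
    then obtain c where c: "d = [:c:]" by (metis degree_eq_zeroE)
    have "c \<in> L" "c \<noteq> 0" using dL uv(4) unfolding c poly_over_def by (metis coeff_pCons_0, auto)
    have "c = poly u x * poly a x" using uv(3) m(3) c by (metis add_0_right mult_zero_right poly_add poly_const_conv poly_mult)
    hence "inverse (poly a x) = poly (u * [:inverse c:]) x" using \<open>c \<noteq> 0\<close> False by (simp add: field_simps)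
    moreover have "poly_over L (u * [:inverse c:])"
      by (intro poly_over_mult uv poly_over_const csubfield_inverse[OF L] \<open>c \<in> L\<close>)
    ultimately show ?thesis unfolding poly_values_def by blast
  qed
  show ?thesis unfolding csubfield_def
  proof (intro conjI ballI)
    show "1 \<in> poly_values L x" using poly_values_superset(1) csubfield_1[OF L] by blast
  next
    fix y z assume "y \<in> poly_values L x" "z \<in> poly_values L x"
    then obtain p q where pq: "y = poly p x" "z = poly q x" "poly_over L p" "poly_over L q" by (auto simp: poly_values_def)
    show "y - z \<in> poly_values L x" unfolding poly_values_def
      using pq by (auto intro!: exI[of _ "p - q"] poly_over_diff)
    show "y * z \<in> poly_values L x" unfolding poly_values_def
      using pq by (auto intro!: exI[of _ "p * q"] poly_over_mult)
  next
    fix y assume "y \<in> poly_values L x"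
    thus "inverse y \<in> poly_values L x" using inverse by (auto simp: poly_values_def)
  qed
qed

lemma embedding_map_poly:
  assumes s: "field_embedding L s"
  shows "Polynomial.coeff (map_poly s p) i = s (Polynomial.coeff p i)"
    and "map_poly s [:a:] = [:s a:]"
    and "poly_over L p \<Longrightarrow> poly_over L q \<Longrightarrow> map_poly s (p + q) = map_poly s p + map_poly s q"
    and "poly_over L p \<Longrightarrow> poly_over L q \<Longrightarrow> map_poly s (p * q) = map_poly s p * map_poly s q"
proof -
  show c: "Polynomial.coeff (map_poly s p) i = s (Polynomial.coeff p i)" for p i
    by (rule coeff_map_poly) (rule emb_0[OF L s])
  show "map_poly s [:a:] = [:s a:]" for a
    by (rule poly_eqI) (simp add: c coeff_pCons emb_0[OF L s] split: nat.split)
  show "poly_over L p \<Longrightarrow> poly_over L q \<Longrightarrow> map_poly s (p + q) = map_poly s p + map_poly s q"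
    by (rule poly_eqI) (auto simp: c emb_add[OF L s] poly_over_def)
  show "poly_over L p \<Longrightarrow> poly_over L q \<Longrightarrow> map_poly s (p * q) = map_poly s p * map_poly s q"
    by (rule poly_eqI) (auto simp: c emb_sum[OF L s] emb_mult[OF L s] csubfield_mult[OF L] coeff_mult poly_over_def)
qed

text \<open>Polynomials with the same value at \<open>x\<close> differ by a multiple of
  \<open>m\<close>, whose image under \<open>s\<close> vanishes at \<open>y\<close>; sending
  \<open>p(x)\<close> to \<open>(s p)(y)\<close> is therefore well defined.\<close>

lemma embedding_extends_to_root:
  assumes s: "field_embedding L s" and m: "poly_over L m"
    "\<And>q. poly_over L q \<Longrightarrow> poly q x = 0 \<Longrightarrow> \<exists>c. poly_over L c \<and> q = c * m"
    and y: "poly (map_poly s m) y = 0"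
  obtains s' where "field_embedding (poly_values L x) s'"
    "\<And>p. poly_over L p \<Longrightarrow> s' (poly p x) = poly (map_poly s p) y"
proof -
  note mp = embedding_map_poly[OF s]
  define s' where "s' z = poly (map_poly s (SOME p. poly_over L p \<and> poly p x = z)) y" for z
  have s': "s' (poly p x) = poly (map_poly s p) y" if p: "poly_over L p" for p
  proof -
    define q where "q = (SOME q. poly_over L q \<and> poly q x = poly p x)"
    have q: "poly_over L q \<and> poly q x = poly p x" unfolding q_def by (rule someI[of _ p]) (use p in auto)
    hence "poly_over L (q - p)" "poly (q - p) x = 0" using p by (auto intro: poly_over_diff)
    from m(2)[OF this] obtain c where c: "poly_over L c" "q - p = c * m" by blast
    hence "map_poly s q = map_poly s (c * m + p)" by (metis diff_add_cancel)
    also have "\<dots> = map_poly s c * map_poly s m + map_poly s p"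
      using mp(3)[OF poly_over_mult[OF c(1) m(1)] p] mp(4)[OF c(1) m(1)] by simp
    finally show ?thesis using y by (simp add: s'_def q_def)
  qed
  have "field_embedding (poly_values L x) s'" unfolding field_embedding_def
  proof (intro conjI ballI)
    have "s' (poly [:1:] x) = poly (map_poly s [:1:]) y" by (rule s') (rule poly_over_const[OF csubfield_1[OF L]])
    thus "s' 1 = 1" by (simp add: mp(2) emb_1[OF L s])
  next
    fix a b assume "a \<in> poly_values L x" "b \<in> poly_values L x"
    then obtain p q where pq: "a = poly p x" "b = poly q x" "poly_over L p" "poly_over L q" by (auto simp: poly_values_def)
    show "s' (a + b) = s' a + s' b"
      using s'[OF poly_over_add[OF pq(3,4)]] s'[OF pq(3)] s'[OF pq(4)] mp(3)[OF pq(3,4)] by (simp add: pq(1,2))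
    show "s' (a * b) = s' a * s' b"
      using s'[OF poly_over_mult[OF pq(3,4)]] s'[OF pq(3)] s'[OF pq(4)] mp(4)[OF pq(3,4)] by (simp add: pq(1,2))
  qed
  with that s' show ?thesis by blast
qed

lemma poly_over_unity: "poly_over L (Polynomial.monom 1 n - 1)"
  by (intro poly_over_diff poly_over_monom poly_over_1 csubfield_1[OF L])

text \<open>The image of the minimal polynomial stays nonconstant because \<open>s\<close> is
  injective, so it has a complex root to which \<open>x\<close> can be sent.\<close>

lemma embedding_extends_to_unity:
  assumes s: "field_embedding L s" and n: "n > 0" "x ^ n = 1"
  obtains s' where "field_embedding (poly_values L x) s'" "\<And>y. y \<in> L \<Longrightarrow> s' y = s y"
proof -
  have px: "poly (Polynomial.monom 1 n - 1) x = 0" using n by (simp add: poly_monom)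
  obtain m where m: "poly_over L m" "m \<noteq> 0" "poly m x = 0"
    "\<And>q. poly_over L q \<Longrightarrow> poly q x = 0 \<Longrightarrow> \<exists>c. poly_over L c \<and> q = c * m"
    by (rule minimal_poly_exists[OF poly_over_unity unity_poly_nonzero[OF n(1)] px]) blast
  have "\<exists>y. poly (map_poly s m) y = 0"
  proof (rule fundamental_theorem_of_algebra_alt)
    show "\<not> (\<exists>a l. a \<noteq> 0 \<and> l = 0 \<and> map_poly s m = pCons a l)"
    proof
      assume "\<exists>a l. a \<noteq> 0 \<and> l = 0 \<and> map_poly s m = pCons a l"
      then obtain a where a: "map_poly s m = [:a:]" by blast
      have "Polynomial.coeff m i = 0" if "i > 0" for i
      proof -
        have "s (Polynomial.coeff m i) = Polynomial.coeff [:a:] i"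
          using embedding_map_poly(1)[OF s, of m i] a by simp
        hence "s (Polynomial.coeff m i) = 0" using that by (simp add: coeff_pCons split: nat.split)
        thus ?thesis using emb_eq_0_iff[OF L s] m(1) by (auto simp: poly_over_def)
      qed
      hence "Polynomial.degree m = 0" by (metis leading_coeff_0_iff not_gr0 degree_0)
      then obtain b where "m = [:b:]" by (metis degree_eq_zeroE)
      thus False using m(2,3) by simp
    qed
  qed
  then obtain y where y: "poly (map_poly s m) y = 0" by blast
  obtain s' where s': "field_embedding (poly_values L x) s'"
    "\<And>p. poly_over L p \<Longrightarrow> s' (poly p x) = poly (map_poly s p) y"
    by (rule embedding_extends_to_root[where x = x, OF s m(1,4) y]) (assumption | rule that)+
  have "s' c = s c" if "c \<in> L" for c
    using s'(2)[OF poly_over_const[OF that]] by (simp add: embedding_map_poly(2)[OF s])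
  with that s'(1) show ?thesis by blast
qed

text \<open>The minimal polynomial of a root of unity splits into distinct linear factors, and a polynomial
  of smaller degree taking the same value at all its roots is constant.\<close>

lemma fixed_by_embeddings:
  assumes n: "n > 0" "x ^ n = 1" and z: "z \<in> poly_values L x"
    and fix_z: "\<And>s. field_embedding (poly_values L x) s \<Longrightarrow> (\<And>y. y \<in> L \<Longrightarrow> s y = y) \<Longrightarrow> s z = z"
  shows "z \<in> L"
proof -
  let ?u = "Polynomial.monom 1 n - 1 :: complex poly"
  have px: "poly ?u x = 0" using n by (simp add: poly_monom)
  obtain m where m: "poly_over L m" "m \<noteq> 0" "poly m x = 0"
    "\<And>q. poly_over L q \<Longrightarrow> poly q x = 0 \<Longrightarrow> \<exists>c. poly_over L c \<and> q = c * m"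
    by (rule minimal_poly_exists[OF poly_over_unity unity_poly_nonzero[OF n(1)] px]) blast
  obtain c where c: "poly_over L c" "?u = c * m" using m(4)[OF poly_over_unity px] by blast
  have c0: "c \<noteq> 0" using c(2) unity_poly_nonzero[OF n(1)] by auto
  have degu: "Polynomial.degree ?u = n"
    using degree_add_eq_left[of "- 1 :: complex poly" "Polynomial.monom 1 n"] n(1) by (simp add: degree_monom_eq)
  \<comment> \<open>\<open>m\<close> divides \<open>X ^ n - 1\<close>, which has \<open>n\<close>
    distinct roots, so \<open>m\<close> has as many roots as its degree.\<close>
  have roots: "Polynomial.degree m \<le> card {y. poly m y = 0}"
  proof -
    have "n = card {y::complex. y ^ n = 1}" using card_roots_unity_eq[OF n(1)] by simp
    also have "{y::complex. y ^ n = 1} = {y. poly ?u y = 0}" by (simp add: poly_monom)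
    also have "\<dots> = {y. poly c y = 0} \<union> {y. poly m y = 0}" unfolding c(2) by auto
    also have "card \<dots> \<le> card {y. poly c y = 0} + card {y. poly m y = 0}" by (rule card_Un_le)
    also have "card {y. poly c y = 0} \<le> Polynomial.degree c" by (rule card_poly_roots_bound[OF c0])
    finally have "n \<le> Polynomial.degree c + card {y. poly m y = 0}" by simp
    moreover have "n = Polynomial.degree c + Polynomial.degree m"
      using degu degree_mult_eq[OF c0 m(2)] c(2) by simp
    ultimately show ?thesis by simp
  qed
  have degm: "Polynomial.degree m > 0"
  proof (rule ccontr)
    assume "\<not> Polynomial.degree m > 0"
    then obtain b where "m = [:b:]" by (metis degree_eq_zeroE not_gr0)
    thus False using m(2,3) by simp
  qed
  obtain p where p: "poly_over L p" "z = poly p x" using z by (auto simp: poly_values_def)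
  obtain q r where qr: "poly_over L q" "poly_over L r" "p = q * m + r" "r = 0 \<or> Polynomial.degree r < Polynomial.degree m"
    using poly_over_division[OF p(1) m(1,2)] by blast
  have zr: "z = poly r x" using p(2) m(3) by (simp add: qr(3))
  \<comment> \<open>A root \<open>y\<close> of \<open>m\<close> defines an embedding over
    \<open>L\<close> that sends \<open>x\<close> to \<open>y\<close> and \<open>z = r(x)\<close> to
    \<open>r(y)\<close>; by hypothesis it fixes \<open>z\<close>.\<close>
  have const: "poly r y = z" if ym: "poly m y = 0" for y
  proof -
    have id: "map_poly (\<lambda>x. x) t = t" for t :: "complex poly" by (rule poly_eqI) (simp add: coeff_map_poly)
    have y: "poly (map_poly (\<lambda>x. x) m) y = 0" using ym by (simp add: id)
    obtain s where s: "field_embedding (poly_values L x) s" "\<And>p. poly_over L p \<Longrightarrow> s (poly p x) = poly (map_poly (\<lambda>x. x) p) y"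
      by (rule embedding_extends_to_root[where x = x, OF field_embedding_id m(1,4) y]) (assumption | rule that)+
    have "s b = b" if "b \<in> L" for b using s(2)[OF poly_over_const[OF that]] by (simp add: id)
    hence "s z = z" using fix_z[OF s(1)] by blast
    thus ?thesis using s(2)[OF qr(2)] by (simp add: id zr)
  qed
  have "r - [:z:] = 0"
  proof (rule ccontr)
    assume nz: "r - [:z:] \<noteq> 0"
    have "Polynomial.degree m \<le> card {y. poly m y = 0}" by (rule roots)
    also have "\<dots> \<le> card {y. poly (r - [:z:]) y = 0}"
      by (rule card_mono) (use const poly_roots_finite[OF nz] in auto)
    also have "\<dots> \<le> Polynomial.degree (r - [:z:])" by (rule card_poly_roots_bound[OF nz])
    also have "\<dots> \<le> max (Polynomial.degree r) (Polynomial.degree [:z:])" by (rule degree_diff_le_max)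
    also have "\<dots> < Polynomial.degree m" using qr(4) degm by auto
    finally show False by simp
  qed
  hence "z = Polynomial.coeff r 0" by (metis coeff_pCons_0 eq_iff_diff_eq_0)
  thus ?thesis using qr(2) by (simp add: poly_over_def)
qed

end

text \<open>By injectivity of \<open>s\<close>, the image of \<open>zeta Q\<close> still has exact
  order \<open>Q\<close>.\<close>

lemma embedding_root_of_unity:
  assumes E: "csubfield E" and s: "field_embedding E s" and Q: "Q > 0" and z: "zeta Q \<in> E"
  obtains l where "coprime l (int Q)" "s (zeta Q) = zeta Q powi l"
proof -
  have "s (zeta Q) ^ Q = 1"
    using emb_power[OF E s z, of Q] zeta_power_eq_1_iff[OF Q, of Q] emb_1[OF E s] by simp
  then obtain j where j: "j < Q" "s (zeta Q) = exp (2 * of_real pi * \<i> * of_nat j / of_nat Q)"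
    using complex_roots_unity[of Q] Q by auto
  hence sj: "s (zeta Q) = zeta Q ^ j" by (simp add: zeta_power)
  define d where "d = gcd j Q"
  have d: "d > 0" "d dvd j" "d dvd Q" using Q by (auto simp: d_def)
  then obtain u v where uv: "j = d * u" "Q = d * v" by (meson dvdE)
  have "s (zeta Q ^ v) = zeta Q ^ (j * v)" using emb_power[OF E s z] by (simp add: sj power_mult)
  also have "\<dots> = 1" using zeta_power_eq_1_iff[OF Q, of "j * v"] by (simp add: uv)
  finally have "s (zeta Q ^ v - 1) = 0"
    using emb_diff[OF E s csubfield_power[OF E z] csubfield_1[OF E]] emb_1[OF E s] by simp
  hence "zeta Q ^ v = 1"
    using emb_eq_0_iff[OF E s csubfield_diff[OF E csubfield_power[OF E z] csubfield_1[OF E]]] by simp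
  hence "Q dvd v" using zeta_power_eq_1_iff[OF Q] by blast
  hence "d = 1" using uv Q by (metis dvd_antisym dvd_triv_right mult.commute mult_eq_self_implies_10 neq0_conv)
  hence "coprime (int j) (int Q)" by (simp add: d_def coprime_iff_gcd_eq_1)
  thus ?thesis using that[of "int j"] sj by simp
qed

section \<open>The main theorem\<close>

text \<open>The lift is \<open>d' = d + t * Q\<close>, where \<open>t\<close> is the product of the
  primes of \<open>c'\<close> that do not divide \<open>d\<close>: each prime of \<open>c'\<close>
  then divides exactly one of the two summands.\<close>

lemma coprime_lift:
  fixes c d Q :: int
  assumes Q: "Q > 0" and cd: "\<And>p. Factorial_Ring.prime p \<Longrightarrow> p dvd c \<Longrightarrow> p dvd d \<Longrightarrow> \<not> p dvd Q"
  obtains c' d' where "[c' = c] (mod Q)" "[d' = d] (mod Q)" "coprime c' d'"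
proof -
  \<comment> \<open>\<open>c = 0\<close> is divisible by every prime, so it is replaced by the
    congruent value \<open>Q\<close>.\<close>
  define c' where "c' = (if c = 0 then Q else c)"
  have c': "c' \<noteq> 0" "[c' = c] (mod Q)" using Q by (auto simp: c'_def cong_def)
  have cd': "\<not> p dvd Q" if "Factorial_Ring.prime p" "p dvd c'" "p dvd d" for p
    using that cd[of p] by (cases "c = 0") (auto simp: c'_def)
  define t where "t = \<Prod>{p \<in> prime_factors c'. \<not> p dvd d}"
  have "coprime c' (d + t * Q)"
  proof (rule ccontr)
    assume "\<not> coprime c' (d + t * Q)"
    then obtain x where x: "x dvd c'" "x dvd d + t * Q" "\<not> is_unit x" by (rule not_coprimeE)
    have "x \<noteq> 0" using x c' by auto
    then obtain p where "p dvd x" "Factorial_Ring.prime p" using prime_divisor_exists[of x] x(3) by blast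
    hence p: "Factorial_Ring.prime p" "p dvd c'" "p dvd d + t * Q" using x dvd_trans by blast+
    show False
    proof (cases "p dvd d")
      case True
      hence "p dvd t * Q" using p(3) by (simp add: dvd_add_right_iff)
      moreover have "\<not> p dvd Q" using cd' p True by blast
      ultimately have "p dvd t" using p(1) by (simp add: prime_dvd_mult_iff)
      then obtain q where q: "q \<in> prime_factors c'" "\<not> q dvd d" "p dvd q"
        using p(1) by (auto simp: t_def prime_dvd_prod_iff)
      hence "p = q" using p(1) by (auto intro: primes_dvd_imp_eq)
      thus False using True q by blast
    next
      case False
      hence "p \<in> {p \<in> prime_factors c'. \<not> p dvd d}" using p c' by (auto intro: prime_factorsI)
      hence "p dvd t" unfolding t_def by (intro dvd_prodI) auto
      hence "p dvd t * Q" by simp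
      thus False using False p(3) by (simp add: dvd_add_left_iff)
    qed
  qed
  thus ?thesis using that[of c' "d + t * Q"] c' by (simp add: cong_def)
qed

text \<open>Once the bottom row is lifted to a coprime pair,
  \<open>(a, b) = u (y, -x) + j (c', d')\<close> with \<open>u = a d' - b c'\<close> congruent to 1.
  Putting 1 in place of \<open>u\<close> preserves the residues and makes the determinant equal to
  \<open>x c' + y d' = 1\<close>.\<close>

lemma SL2Z_lift:
  assumes Q: "Q > 0" and det: "[a * d - b * c = 1] (mod int Q)"
  obtains h where "h \<in> SL2Z" "[h $ 1 $ 1 = a] (mod int Q)" "[h $ 1 $ 2 = b] (mod int Q)"
    "[h $ 2 $ 1 = c] (mod int Q)" "[h $ 2 $ 2 = d] (mod int Q)"
proof -
  have "\<not> p dvd int Q" if p: "Factorial_Ring.prime p" "p dvd c" "p dvd d" for p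
  proof
    assume "p dvd int Q"
    hence "[a * d - b * c = 1] (mod p)" using det cong_dvd_modulus by blast
    moreover have "p dvd a * d - b * c" using p by simp
    ultimately have "p dvd 1" using cong_dvd_iff by blast
    thus False using p(1) by (simp add: not_prime_unit)
  qed
  then obtain c' d' where cd: "[c' = c] (mod int Q)" "[d' = d] (mod int Q)" "coprime c' d'"
    using coprime_lift[of "int Q" c d] Q by (metis of_nat_0_less_iff)
  obtain x y where xy: "x * c' + y * d' = 1" using bezout_int[of c' d'] cd(3) by (metis coprime_iff_gcd_eq_1)
  define u where "u = a * d' - b * c'"
  define j where "j = a * x + b * y"
  define h where "h = mat22 (y + j * c') (- x + j * d') c' d'"
  have "h \<in> SL2Z" unfolding h_def mat22_SL2Z_iff using xy by (simp add: algebra_simps)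
  moreover have u: "[u = 1] (mod int Q)"
  proof -
    have "[u = a * d - b * c] (mod int Q)" unfolding u_def by (intro cong_diff cong_mult cd) auto
    thus ?thesis using det cong_trans by blast
  qed
  have "a = u * y + j * c'" "b = - u * x + j * d'"
  proof -
    have "u * y + j * c' = a * (x * c' + y * d')" by (simp add: u_def j_def algebra_simps)
    thus "a = u * y + j * c'" using xy by simp
    have "- u * x + j * d' = b * (x * c' + y * d')" by (simp add: u_def j_def algebra_simps)
    thus "b = - u * x + j * d'" using xy by simp
  qed
  hence "[y + j * c' = a] (mod int Q)" "[- x + j * d' = b] (mod int Q)"
    using cong_add[OF cong_mult[OF u cong_refl[of y]] cong_refl[of "j * c'"]]
      cong_add[OF cong_mult[OF u cong_refl[of "- x"]] cong_refl[of "j * d'"]]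
    by (simp_all add: cong_sym_eq)
  ultimately show ?thesis using that[of h] cd by (simp add: h_def)
qed

lemma twisted_exists:
  assumes Q: "Q > 0" and l: "coprime l (int Q)" and g: "g \<in> SL2Z"
  obtains h where "h \<in> SL2Z" "twisted Q l g h"
proof -
  obtain k where k: "[l * k = 1] (mod int Q)" using cong_solve_coprime_int[OF l] by blast
  define a b c d where "a = g $ 1 $ 1" "b = g $ 1 $ 2" "c = g $ 2 $ 1" "d = g $ 2 $ 2"
  have "[a * d - (l * k) * (b * c) = a * d - 1 * (b * c)] (mod int Q)"
    by (intro cong_diff cong_mult k) auto
  hence "[a * d - (l * b) * (k * c) = 1] (mod int Q)"
    using g by (simp add: SL2Z_iff a_b_c_d_def mult_ac)
  then obtain h where h: "h \<in> SL2Z" "[h $ 1 $ 1 = a] (mod int Q)" "[h $ 1 $ 2 = l * b] (mod int Q)"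
    "[h $ 2 $ 1 = k * c] (mod int Q)" "[h $ 2 $ 2 = d] (mod int Q)"
    using SL2Z_lift[OF Q] by metis
  have "[l * h $ 2 $ 1 = l * (k * c)] (mod int Q)" by (intro cong_mult h) auto
  moreover have "[l * (k * c) = c] (mod int Q)" using cong_mult[OF k cong_refl[of c]] by (simp add: mult_ac)
  ultimately have "[l * h $ 2 $ 1 = c] (mod int Q)" using cong_trans by blast
  thus ?thesis using that[OF h(1)] h unfolding twisted_def a_b_c_d_def by blast
qed

lemma zeta_power_div:
  assumes "n dvd Q" "Q > 0"
  shows "zeta Q ^ (Q div n) = zeta n"
proof -
  obtain k where "Q = n * k" "k > 0" "n > 0" using assms by (auto elim!: dvdE)
  thus ?thesis by (simp add: zeta_power zeta_def[of n])
qed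

lemma dirichlet_character_1: "dirichlet_character m chi \<Longrightarrow> chi 1 = 1"
  unfolding dirichlet_character_def by (metis coprime_1_left mult_cancel_left2)

lemma dirichlet_character_cong: "dirichlet_character m chi \<Longrightarrow> [a = b] (mod int m) \<Longrightarrow> chi a = chi b"
  unfolding dirichlet_character_def by blast

text \<open>The congruence says that \<open>h ** SL2_inv g\<close> lies in \<open>Gamma0 N\<close>,
  and the argument of \<open>chi\<close> is the lower right entry of that matrix.\<close>

lemma modular_form_slash_coset:
  assumes f: "f \<in> modular_forms k N chi" and gh: "g \<in> SL2Z" "h \<in> SL2Z" and t: "\<tau> \<in> upper_half_plane"
    and c: "[h $ 2 $ 1 * g $ 2 $ 2 = h $ 2 $ 2 * g $ 2 $ 1] (mod int N)"
  shows "slash k f h \<tau> = chi (h $ 2 $ 2 * g $ 1 $ 1 - h $ 2 $ 1 * g $ 1 $ 2) * slash k f g \<tau>"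
proof -
  define \<gamma> where "\<gamma> = h ** SL2_inv g"
  have \<gamma>: "\<gamma> \<in> SL2Z" unfolding \<gamma>_def by (intro SL2Z_mult gh SL2_inv_in)
  have e: "\<gamma> $ 2 $ 1 = h $ 2 $ 1 * g $ 2 $ 2 - h $ 2 $ 2 * g $ 2 $ 1"
    "\<gamma> $ 2 $ 2 = h $ 2 $ 2 * g $ 1 $ 1 - h $ 2 $ 1 * g $ 1 $ 2"
    by (simp_all add: \<gamma>_def matrix_mult_nth2 SL2_inv_def)
  have "int N dvd \<gamma> $ 2 $ 1" unfolding e using c by (simp add: cong_iff_dvd_diff)
  hence "\<gamma> \<in> Gamma0 N" using \<gamma> by (simp add: Gamma0_def)
  hence s: "slash k f \<gamma> \<sigma> = chi (\<gamma> $ 2 $ 2) * f \<sigma>" if "\<sigma> \<in> upper_half_plane" for \<sigma>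
    using f that by (simp add: modular_forms_def)
  have "\<gamma> ** g = h" unfolding \<gamma>_def
    by (metis SL2_inv_left[OF gh(1)] matrix_mul_assoc matrix_mul_rid)
  hence "slash k f h \<tau> = slash k (slash k f \<gamma>) g \<tau>" using slash_mult[OF \<gamma> gh(1) t, of k f] by simp
  also have "\<dots> = slash k (\<lambda>\<sigma>. chi (\<gamma> $ 2 $ 2) * f \<sigma>) g \<tau>"
    by (rule slash_cong[OF gh(1) t s])
  finally show ?thesis by (simp add: slash_cmult e)
qed

theorem theorem4p3:
  fixes k N m N' m' M :: nat and chi :: "int \<Rightarrow> complex" and f :: "complex \<Rightarrow> complex"
    and g :: "int ^ 2 ^ 2" and A B C D :: int and K L :: "complex set"
    and G :: "(complex \<Rightarrow> complex) set" and chi_g :: "(complex \<Rightarrow> complex) \<Rightarrow> complex"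
  assumes "k \<ge> 1" and "N \<ge> 1"
    and "m dvd N" and "primitive_character m chi"
    and "f \<in> modular_forms k N chi"
    and "g = vector [vector [A, B], vector [C, D]]" and "g \<in> SL2Z"
    and "N' = N div nat (gcd (C * D) (int N))"
    and "m' = m div nat (gcd (B * C) (int m))"
    and "M = lcm N' m'"
    and "K = adjoin (coeff_field f) (zeta N')"
    and "L = adjoin (coeff_field f) (zeta M)"
    and "G = galois_group L K"
    and "chi_g = (\<lambda>\<sigma>. chi (A * D - modular_inverse (int m') (cyclotomic_character m' \<sigma>) * (B * C)))"
  shows "\<forall>n. fourier_coeff N (slash k f g) n \<in> eigen_subset L G chi_g"
proof -
  define Q where "Q = 3 * N"
  have Q: "Q > 0" "Q \<ge> 3" "N dvd Q" "N > 0" using assms(2) by (auto simp: Q_def)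
  have m: "m > 0" "dirichlet_character m chi" using assms(4) by (auto simp: primitive_character_def)
  have g_mat: "g = mat22 A B C D" using assms(6) by (simp add: mat22_def)
  have det: "A * D - B * C = 1" using assms(7) by (simp add: g_mat mat22_SL2Z_iff)
  have "N' > 0" "N' dvd N"
  proof -
    define d where "d = nat (gcd (C * D) (int N))"
    have "int d dvd int N" by (simp add: d_def)
    hence "d dvd N" by (simp only: int_dvd_int_iff)
    thus "N' > 0" "N' dvd N" using Q(4) assms(8) unfolding d_def[symmetric]
      by (auto elim!: dvdE)
  qed
  have "m' > 0" "m' dvd m"
  proof -
    define d where "d = nat (gcd (B * C) (int m))"
    have "int d dvd int m" by (simp add: d_def)
    hence "d dvd m" by (simp only: int_dvd_int_iff)
    thus "m' > 0" "m' dvd m" using m(1) assms(9) unfolding d_def[symmetric]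
      by (auto elim!: dvdE)
  qed
  have M: "M > 0" "M dvd Q" "N' dvd M" "m' dvd M" "N' dvd Q" "m' dvd Q"
  proof -
    have "m' dvd N" using \<open>m' dvd m\<close> assms(3) by (rule dvd_trans)
    hence "M dvd N" using \<open>N' dvd N\<close> by (simp add: assms(10))
    thus "M > 0" "M dvd Q" "N' dvd M" "m' dvd M" "N' dvd Q" "m' dvd Q"
      using \<open>N' > 0\<close> \<open>m' > 0\<close> \<open>N' dvd N\<close> \<open>m' dvd N\<close> Q(3) dvd_trans by (auto simp: assms(10) lcm_pos_nat)
  qed
  note L_field = csubfield_adjoin[of "coeff_field f" "zeta M", folded assms(12)]
  have L_sub: "coeff_field f \<subseteq> L" "zeta M \<in> L" unfolding assms(12) by (rule adjoin_subset, rule adjoin_mem)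
  have zL: "zeta n \<in> L" if "n dvd M" for n
    using csubfield_power[OF L_field L_sub(2), of "M div n"] zeta_power_div[OF that M(1)] by simp
  have KL: "K \<subseteq> L" unfolding assms(11) using L_sub zL M(3) by (intro adjoin_least L_field) auto
  have K_sub: "coeff_field f \<subseteq> K" "zeta N' \<in> K" unfolding assms(11) by (rule adjoin_subset, rule adjoin_mem)
  have zQ: "zeta Q ^ Q = 1" using zeta_power_eq_1_iff[OF Q(1), of Q] by simp

  \<comment> \<open>\<open>E\<close> is \<open>L(zeta Q)\<close>, large enough for the level
    \<open>Q\<close> results; the coefficients are brought down to \<open>L\<close> only in
    \<open>in_L\<close>.\<close>
  define E where "E = poly_values L (zeta Q)"
  have E: "csubfield E" unfolding E_def
    by (rule csubfield_poly_values[OF L_field poly_over_unity[OF L_field] unity_poly_nonzero[OF Q(1)]])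
       (use zQ in \<open>simp add: poly_monom\<close>)
  have LE: "L \<subseteq> E" "zeta Q \<in> E" unfolding E_def by (rule poly_values_superset[OF L_field])+

  have slash_exp: "\<exists>a. fexp N (slash k f h) a" if h: "h \<in> SL2Z" for h
  proof -
    have "\<forall>h\<in>SL2Z. \<exists>b. has_fourier_expansion N (slash k f h) b"
      using assms(5) by (simp add: modular_forms_def)
    then obtain b where "has_fourier_expansion N (slash k f h) b" using h by blast
    hence "fexp N (slash k f h) (Abs_fps b)" by (simp add: fexp_def Abs_fps_inverse)
    thus ?thesis by blast
  qed
  have ascend: "fexp Q F (stretch_fps 3 a)" if "fexp N F a" for F a
    using fexp_ascend[OF _ that, of 3] by (simp add: Q_def)
  have slash_exp_Q: "\<exists>a. fexp Q (slash k f h) a" if "h \<in> SL2Z" for h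
    using slash_exp[OF that] ascend by blast
  have inv: "slash k f h \<tau> = slash k f h' \<tau>"
    if "h \<in> SL2Z" "h' \<in> SL2Z" "\<tau> \<in> upper_half_plane"
      "residue_row Q (row_mult (0, 1) h) = residue_row Q (row_mult (0, 1) h')" for h h' \<tau>
  proof -
    have "[h $ 2 $ 1 = h' $ 2 $ 1] (mod int Q)" "[h $ 2 $ 2 = h' $ 2 $ 2] (mod int Q)"
      using that(4) by (simp_all add: residue_row_eq_iff row_mult_def)
    hence c: "[h $ 2 $ 1 = h' $ 2 $ 1] (mod int N)" "[h $ 2 $ 2 = h' $ 2 $ 2] (mod int N)"
      using Q(3) cong_dvd_modulus int_dvd_int_iff by blast+
    have "[h $ 2 $ 2 * h' $ 1 $ 1 - h $ 2 $ 1 * h' $ 1 $ 2 = h' $ 2 $ 2 * h' $ 1 $ 1 - h' $ 2 $ 1 * h' $ 1 $ 2] (mod int N)"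
      by (intro cong_diff cong_mult c) auto
    hence "[h $ 2 $ 2 * h' $ 1 $ 1 - h $ 2 $ 1 * h' $ 1 $ 2 = 1] (mod int N)"
      using that(2) by (simp add: SL2Z_iff mult.commute)
    hence "[h $ 2 $ 2 * h' $ 1 $ 1 - h $ 2 $ 1 * h' $ 1 $ 2 = 1] (mod int m)"
      using assms(3) cong_dvd_modulus int_dvd_int_iff by blast
    hence "chi (h $ 2 $ 2 * h' $ 1 $ 1 - h $ 2 $ 1 * h' $ 1 $ 2) = 1"
      using dirichlet_character_cong[OF m(2)] dirichlet_character_1[OF m(2)] by metis
    moreover have "[h $ 2 $ 1 * h' $ 2 $ 2 = h' $ 2 $ 1 * h $ 2 $ 2] (mod int N)"
      using c by (intro cong_mult) (auto intro: cong_sym)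
    ultimately show ?thesis
      using modular_form_slash_coset[OF assms(5) that(2,1,3)] by (simp add: mult.commute)
  qed

  obtain a1 where a1: "fexp 1 f a1" "coeffs_in (coeff_field f) a1"
  proof -
    obtain b where b: "fexp N f b" using slash_exp[OF SL2Z_one] by auto
    have "f (\<tau> + 1) = f \<tau>" if t: "\<tau> \<in> upper_half_plane" for \<tau>
    proof -
      have T: "mat22 1 1 0 1 \<in> SL2Z" by (simp add: mat22_SL2Z_iff)
      have "slash k f (mat22 1 1 0 1) \<tau> = slash k f (mat 1) \<tau>"
        by (rule inv[OF T SL2Z_one t]) (simp add: row_mult_def mat_def)
      thus ?thesis by (simp add: slash_eq[of _ _ "mat22 1 1 0 1"] jac_def mob_def)
    qed
    hence f1: "fexp 1 f (Abs_fps (\<lambda>n. fps_nth b (N * n)))" by (rule fexp_descend[OF Q(4) b])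
    have "fps_nth (Abs_fps (\<lambda>n. fps_nth b (N * n))) n \<in> coeff_field f" for n
    proof -
      have "fourier_coeff 1 f = fps_nth (Abs_fps (\<lambda>n. fps_nth b (N * n)))"
        using f1 unfolding fexp_def by (intro fourier_coeff_eqI) auto
      hence "fps_nth (Abs_fps (\<lambda>n. fps_nth b (N * n))) n \<in> range (fourier_coeff 1 f)" by (metis rangeI)
      thus ?thesis unfolding coeff_field_def by (rule generate_field.incl)
    qed
    with that f1 show ?thesis by (simp add: coeffs_in_def)
  qed
  define \<phi> where "\<phi> = stretch_fps Q a1"
  have \<phi>: "fexp Q f \<phi>" using fexp_ascend[OF Q(1) a1(1)] by (simp add: \<phi>_def)
  have \<phi>_K: "fps_nth \<phi> n \<in> coeff_field f" for n
    using a1(2) csubfield_0[OF csubfield_generate_field] by (auto simp: \<phi>_def stretch_fps_def coeffs_in_def coeff_field_def)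
  have \<phi>_E: "coeffs_in E \<phi>" using \<phi>_K L_sub(1) LE(1) by (auto simp: coeffs_in_def)

  obtain b where b: "fexp N (slash k f g) b" using slash_exp[OF assms(7)] by blast
  define \<psi> where "\<psi> = stretch_fps 3 b"
  have \<psi>: "fexp Q (slash k f g) \<psi>" unfolding \<psi>_def by (rule ascend[OF b])
  \<comment> \<open>The passage from level \<open>N\<close> to \<open>Q = 3 * N\<close> moves the
    coefficient of index \<open>n\<close> to index \<open>3 * n\<close>.\<close>
  have coeff: "fourier_coeff N (slash k f g) n = fps_nth \<psi> (3 * n)" for n
    using fourier_coeff_eqI[OF Q(4)] b by (simp add: fexp_def \<psi>_def stretch_fps_def)

  \<comment> \<open>With the identity embedding, the theorem on expansions says just where the
    coefficients lie.\<close>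
  have \<psi>_E: "coeffs_in E \<psi>"
  proof -
    have tw: "twisted Q 1 g g" by (simp add: twisted_def)
    have "\<exists>a. coeffs_in E a \<and> fexp Q (slash k f g) a \<and> fexp Q (slash k f g) (map_fps (\<lambda>x. x) a)"
      by (rule galois_action_on_expansions[OF E field_embedding_id LE(2) _ Q(2) _ slash_exp_Q inv \<phi> \<phi>_E _ assms(7,7) tw])
         (auto simp: fps_eq_iff)
    thus ?thesis using fexp_unique[OF Q(1) \<psi>] by blast
  qed

  \<comment> \<open>Used twice: for embeddings that fix \<open>L\<close>, to show that the
    coefficients lie in \<open>L\<close>, and for extensions of elements of \<open>G\<close>, to
    find the eigenvalue. Here \<open>v\<close> represents the inverse of \<open>l\<close>.\<close>
  have action: "\<exists>l v. coprime l (int m') \<and> [l * v = 1] (mod int m') \<and> s (zeta m') = zeta m' powi l \<and>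
      (\<forall>n. s (fps_nth \<psi> n) = chi (A * D - v * (B * C)) * fps_nth \<psi> n)"
    if s: "field_embedding E s" and sK: "\<And>x. x \<in> K \<Longrightarrow> s x = x" for s
  proof -
    obtain l where l: "coprime l (int Q)" "s (zeta Q) = zeta Q powi l"
      using embedding_root_of_unity[OF E s Q(1) LE(2)] by blast
    have s_zeta: "s (zeta n) = zeta n powi l" if "n dvd Q" for n
      using emb_power[OF E s LE(2), of "Q div n"] zeta_power_div[OF that Q(1)] l(2)
      by (metis power_int_commutes power_int_of_nat power_int_power' power_int_mult mult.commute)
    obtain v where v: "[l * v = 1] (mod int Q)" using cong_solve_coprime_int[OF l(1)] by blast
    have vn: "[l * v = 1] (mod int n)" if "n dvd Q" for n
      using v that cong_dvd_modulus int_dvd_int_iff by blast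
    obtain h where h: "h \<in> SL2Z" "twisted Q l g h" using twisted_exists[OF Q(1) l(1) assms(7)] by blast
    have s\<phi>: "map_fps s \<phi> = \<phi>" using \<phi>_K K_sub(1) sK by (auto simp: fps_eq_iff)
    obtain \<psi>' where \<psi>': "fexp Q (slash k f g) \<psi>'" "fexp Q (slash k f h) (map_fps s \<psi>')"
      using galois_action_on_expansions[OF E s LE(2) l(2) Q(2) l(1) slash_exp_Q inv \<phi> \<phi>_E s\<phi> assms(7) h] by blast
    have "\<psi>' = \<psi>" using fexp_unique[OF Q(1) \<psi>'(1) \<psi>] .
    have lN: "[v = 1] (mod int N')"
    proof -
      have "zeta N' powi l = zeta N' powi 1" using s_zeta[OF M(5)] sK[OF K_sub(2)] by simp
      hence "[l = 1] (mod int N')" using zeta_powi_eq_iff[OF \<open>N' > 0\<close>] by blast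
      hence "[l * v = 1 * v] (mod int N')" by (rule cong_mult) simp
      thus ?thesis using vn[OF M(5)] by (metis cong_sym cong_trans mult_1)
    qed
    have hQ: "[h $ 2 $ 1 = v * C] (mod int Q)" "[h $ 2 $ 2 = D] (mod int Q)"
    proof -
      have "[l * h $ 2 $ 1 = C] (mod int Q)" using h(2) by (simp add: twisted_def g_mat)
      hence *: "[v * (l * h $ 2 $ 1) = v * C] (mod int Q)" by (rule cong_mult[OF cong_refl])
      have "[1 * h $ 2 $ 1 = (l * v) * h $ 2 $ 1] (mod int Q)"
        by (intro cong_mult cong_sym[OF v] cong_refl)
      also have "(l * v) * h $ 2 $ 1 = v * (l * h $ 2 $ 1)" by (simp add: mult_ac)
      also note *
      finally show "[h $ 2 $ 1 = v * C] (mod int Q)" by simp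
      show "[h $ 2 $ 2 = D] (mod int Q)" using h(2) by (simp add: twisted_def g_mat)
    qed
    hence hN: "[h $ 2 $ 1 = v * C] (mod int N)" "[h $ 2 $ 2 = D] (mod int N)"
      using Q(3) cong_dvd_modulus int_dvd_int_iff by blast+
    \<comment> \<open>This is where \<open>N'\<close> enters: since
      \<open>N' = N / gcd(C D, N)\<close>, the congruence \<open>v \<equiv> 1\<close> modulo
      \<open>N'\<close> becomes one modulo \<open>N\<close> after multiplication by
      \<open>C * D\<close>, as in \<open>twist_argument_cong\<close> with first argument 0.\<close>
    have "[h $ 2 $ 1 * D = h $ 2 $ 2 * C] (mod int N)"
    proof -
      have "[0 - v * (C * D) = 0 - 1 * (C * D)] (mod int N)"
        by (rule twist_argument_cong) (use Q(4) lN assms(8) in auto)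
      hence *: "[v * (C * D) = C * D] (mod int N)" by (simp add: cong_minus_minus_iff)
      have "[h $ 2 $ 1 * D = (v * C) * D] (mod int N)" by (intro cong_mult hN cong_refl)
      also have "(v * C) * D = v * (C * D)" by (rule mult.assoc)
      also note *
      also have "C * D = D * C" by (rule mult.commute)
      also have "[D * C = h $ 2 $ 2 * C] (mod int N)" by (intro cong_mult cong_sym[OF hN(2)] cong_refl)
      finally show ?thesis .
    qed
    hence sl: "slash k f h \<tau> = chi (h $ 2 $ 2 * A - h $ 2 $ 1 * B) * slash k f g \<tau>" if "\<tau> \<in> upper_half_plane" for \<tau>
      using modular_form_slash_coset[OF assms(5,7) h(1) that] by (simp add: g_mat)
    have hm: "[h $ 2 $ 1 = v * C] (mod int m)" "[h $ 2 $ 2 = D] (mod int m)"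
      using hN assms(3) cong_dvd_modulus int_dvd_int_iff by blast+
    have "[h $ 2 $ 2 * A - h $ 2 $ 1 * B = D * A - (v * C) * B] (mod int m)"
      by (intro cong_diff cong_mult hm cong_refl)
    also have "D * A - (v * C) * B = A * D - v * (B * C)" by (simp add: mult_ac)
    finally have "[h $ 2 $ 2 * A - h $ 2 $ 1 * B = A * D - v * (B * C)] (mod int m)" .
    hence "chi (h $ 2 $ 2 * A - h $ 2 $ 1 * B) = chi (A * D - v * (B * C))"
      by (rule dirichlet_character_cong[OF m(2)])
    hence "fexp Q (slash k f h) (fps_const (chi (A * D - v * (B * C))) * \<psi>)"
      using fexp_cmult[OF \<psi>, of "chi (A * D - v * (B * C))"] sl
        fexp_cong[of "slash k f h" "\<lambda>\<tau>. chi (A * D - v * (B * C)) * slash k f g \<tau>"] by simp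
    hence "map_fps s \<psi> = fps_const (chi (A * D - v * (B * C))) * \<psi>"
      using \<psi>'(2) fexp_unique[OF Q(1)] unfolding \<open>\<psi>' = \<psi>\<close> by blast
    hence "s (fps_nth \<psi> n) = chi (A * D - v * (B * C)) * fps_nth \<psi> n" for n
      by (metis map_fps_nth fps_mult_left_const_nth)
    moreover have "coprime l (int m')"
      using l(1) M(6) by (meson coprime_divisors dvd_refl int_dvd_int_iff)
    ultimately show ?thesis using vn[OF M(6)] s_zeta[OF M(6)] by blast
  qed

  have chi_cong: "chi (A * D - v * (B * C)) = chi (A * D - v' * (B * C))" if "[v = v'] (mod int m')" for v v'
    by (rule dirichlet_character_cong[OF m(2)], rule twist_argument_cong) (use m(1) that assms(9) in auto)

  \<comment> \<open>An embedding that fixes \<open>L\<close> fixes \<open>zeta m'\<close>, so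
    \<open>v\<close> is congruent to 1 modulo \<open>m'\<close> and the factor becomes
    \<open>chi (A * D - B * C) = chi 1 = 1\<close>.\<close>
  have in_L: "fps_nth \<psi> n \<in> L" for n
  proof (rule fixed_by_embeddings[OF L_field Q(1) zQ])
    show "fps_nth \<psi> n \<in> poly_values L (zeta Q)" using \<psi>_E by (simp add: coeffs_in_def E_def)
    fix s assume s: "field_embedding (poly_values L (zeta Q)) s" "\<And>y. y \<in> L \<Longrightarrow> s y = y"
    then obtain l v where lv: "[l * v = 1] (mod int m')" "s (zeta m') = zeta m' powi l"
      "s (fps_nth \<psi> n) = chi (A * D - v * (B * C)) * fps_nth \<psi> n"
      using action[of s] KL unfolding E_def by blast
    have "zeta m' powi l = zeta m' powi 1" using lv(2) s(2)[OF zL[OF M(4)]] by simp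
    hence "[l = 1] (mod int m')" using zeta_powi_eq_iff[OF \<open>m' > 0\<close>] by blast
    hence "[l * v = 1 * v] (mod int m')" by (rule cong_mult) simp
    hence "[v = 1] (mod int m')" using lv(1) by (metis cong_sym cong_trans mult_1)
    from chi_cong[OF this] show "s (fps_nth \<psi> n) = fps_nth \<psi> n"
      using lv(3) det dirichlet_character_1[OF m(2)] by simp
  qed

  have "\<sigma> (fps_nth \<psi> n) = chi_g \<sigma> * fps_nth \<psi> n" if \<sigma>: "\<sigma> \<in> G" for \<sigma> n
  proof -
    have \<sigma>_emb: "field_embedding L \<sigma>" and \<sigma>K: "\<And>x. x \<in> K \<Longrightarrow> \<sigma> x = x"
      using \<sigma> unfolding assms(13) galois_group_def field_embedding_def
      by (auto simp: ring_hom_def ring_of_type_algebra_def)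
    \<comment> \<open>\<open>action\<close> is about embeddings of \<open>E\<close>, so \<sigma> is
      extended from \<open>L\<close>. Its exponent \<open>l\<close> and the cyclotomic character are
      then compared on \<open>zeta m'\<close>, which lies in \<open>L\<close>.\<close>
    obtain s where s: "field_embedding E s" "\<And>y. y \<in> L \<Longrightarrow> s y = \<sigma> y"
      unfolding E_def by (rule embedding_extends_to_unity[OF L_field \<sigma>_emb Q(1) zQ]) blast
    have "s x = x" if "x \<in> K" for x using s(2)[of x] \<sigma>K[OF that] KL that by auto
    with action[OF s(1)] obtain l v where lv: "coprime l (int m')" "[l * v = 1] (mod int m')"
      "s (zeta m') = zeta m' powi l" "s (fps_nth \<psi> n) = chi (A * D - v * (B * C)) * fps_nth \<psi> n"
      by blast
    define c where "c = cyclotomic_character m' \<sigma>"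
    have "subfield L complex_field"
      unfolding assms(12) adjoin_def
      by (rule field.generate_field_is_subfield[OF field_from_type_algebra]) (simp add: ring_of_type_algebra_def)
    from theI'[OF cyclotomic_character_ex1[OF this \<open>m' > 0\<close> zL[OF M(4)] \<sigma>[unfolded assms(13)]]]
    have c: "coprime c (int m')" "\<sigma> (zeta m') = zeta m' powi c"
      unfolding c_def cyclotomic_character_def by blast+
    have "zeta m' powi l = zeta m' powi c" using lv(3) c(2) s(2)[OF zL[OF M(4)]] by simp
    hence lc: "[l = c] (mod int m')" using zeta_powi_eq_iff[OF \<open>m' > 0\<close>] by blast
    define w where "w = modular_inverse (int m') c"
    have w: "[c * w = 1] (mod int m')"
      using cong_modular_inverse1[of c "int m'"] c(1) by (simp add: w_def)
    have "[v = w] (mod int m')"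
    proof -
      have "[v * 1 = v * (c * w)] (mod int m')" by (intro cong_mult cong_sym[OF w] cong_refl)
      also have "v * (c * w) = c * (v * w)" by (rule mult.left_commute)
      also have "[c * (v * w) = l * (v * w)] (mod int m')" by (intro cong_mult cong_sym[OF lc] cong_refl)
      also have "l * (v * w) = (l * v) * w" by (rule mult.assoc[symmetric])
      also have "[(l * v) * w = 1 * w] (mod int m')" by (intro cong_mult lv cong_refl)
      finally show ?thesis by simp
    qed
    from chi_cong[OF this] show ?thesis
      using lv(4) s(2)[OF in_L] unfolding assms(14) c_def[symmetric] w_def[symmetric] by simp
  qed
  with in_L show ?thesis by (simp add: eigen_subset_def coeff)
qed

end
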